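(* Let $(E,d)$ be a locally compact separable metric space, $\mu$ a positive Borel measure on $E$, finite on compacts, with full support, and let $(\mathcal E,\mathcal F)$ be a symmetric strongly local regular Dirichlet form on $L^2(E,\mu)$ expressed as $\mathcal E(f,g)=\int_E\Gamma(f,g)\,d\mu$ for $f,g\in\mathcal F$, with carré du champ $\Gamma$. Let $(T_t)_{t>0}$ be its semigroup. Fix $x_0\in E$, write $d(x):=d(x,x_0)$, and assume that $d(\cdot)\in\mathcal F_{loc}$, that $E_r:=\{x\in E:d(x)<r\}$ is a relatively compact open set in $E$ for any $r>0$, and that there exists a compact subset $K_0$ of $E$ such that $\Gamma(d,d)\in L^\infty_{loc}(K_0^c,\mu)$. (i) Assume there are constants $M,N>0$ and $0\le\beta\le2$ such that $$\Gamma(d,d)\le M(d+1)^2(\log(d+1))^\beta$$ $\mu$-a.e. outside some (arbitrary) compact subset $K$ of $E$ with $K\supset K_0$, and, for all sufficiently large $n$, $$\mu(E_{4n}\setminus E_{2n})\le\exp\bigl(2N(\log(n+1))^{2-\beta}\bigr)\quad\text{if }0\le\beta<2,$$ or $$\mu(E_{4n}\setminus E_{2n})\le(\log(n+1))^{2N}\quad\text{if }\beta=2.$$ Then $(T_t)_{t>0}$ is conservative. (ii) Assume there are constants $M,N>0$ such that $\Gamma(d,d)\le M$ $\mu$-a.e. outside some (arbitrary) compact subset $K$ of $E$ with $K\supset K_0$, and $\mu(E_{4n}\setminus E_{2n})\le\exp(2Nn^2)$ for all sufficiently large $n$. Then $(T_t)_{t>0}$ is conservative.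
   Context: The carré du champ $\Gamma$ is a positive semidefinite symmetric bilinear form on $\mathcal F$ with values in $L^1(E,\mu)$; by strong locality ($\mathcal E(u,v)=0$ whenever $u$ is constant on a neighborhood of $\operatorname{supp}(v)$) it satisfies Leibniz and chain rules and extends to $\mathcal F_{loc}$, the set of measurable $u$ such that for every relatively compact open $V$ there is $v\in\mathcal F$ with $u=v$ $\mu$-a.e. on $V$. $T_t$ is extended to $L^\infty(E,\mu)$ by $T_tf=\lim_nT_tf_n$ for $0\le f_n\nearrow f$, $f_n\in L^2(E,\mu)\cap L^\infty(E,\mu)$ (and by linearity); $(T_t)_{t>0}$ is conservative if $T_t1=1$ $\mu$-a.e. for some (equivalently any) $t>0$. *)

theory Defs
  imports "HOL-Analysis.Analysis"
begin

text \<open>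
  Elements of Lebesgue spaces are represented by measurable real-valued functions; the set-valued
  notions below are closed under, and the operations respect, almost everywhere equality.
\<close>

definition L2 :: "'a measure \<Rightarrow> ('a \<Rightarrow> real) set" where
  "L2 \<mu> = {f \<in> borel_measurable \<mu>. integrable \<mu> (\<lambda>x. (f x)\<^sup>2)}"

definition L2_inner :: "'a measure \<Rightarrow> ('a \<Rightarrow> real) \<Rightarrow> ('a \<Rightarrow> real) \<Rightarrow> real" where
  "L2_inner \<mu> f g = (\<integral>x. f x * g x \<partial>\<mu>)"

definition L2_norm :: "'a measure \<Rightarrow> ('a \<Rightarrow> real) \<Rightarrow> real" where
  "L2_norm \<mu> f = sqrt (L2_inner \<mu> f f)"

definition Linf :: "'a measure \<Rightarrow> ('a \<Rightarrow> real) set" where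
  "Linf \<mu> = {f \<in> borel_measurable \<mu>. \<exists>B. AE x in \<mu>. \<bar>f x\<bar> \<le> B}"

text \<open>Locally essentially bounded functions on an open set \<open>U\<close>.\<close>

definition Linf_loc :: "'a::topological_space set \<Rightarrow> 'a measure \<Rightarrow> ('a \<Rightarrow> real) set" where
  "Linf_loc U \<mu> = {f. set_borel_measurable \<mu> U f \<and>
     (\<forall>C. compact C \<and> C \<subseteq> U \<longrightarrow> (\<exists>B. AE x in \<mu>. x \<in> C \<longrightarrow> \<bar>f x\<bar> \<le> B))}"

definition Cc :: "('a::topological_space \<Rightarrow> real) set" where
  "Cc = {f. continuous_on UNIV f \<and> compact (closure {x. f x \<noteq> 0})}"

text \<open>The support of the measure \<open>\<bar>f\<bar> \<mu>\<close>, which depends only on the class of \<open>f\<close>.\<close>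

definition supp :: "'a::topological_space measure \<Rightarrow> ('a \<Rightarrow> real) \<Rightarrow> 'a set" where
  "supp \<mu> f = {x. \<forall>U. open U \<and> x \<in> U \<longrightarrow> \<not> (AE y in \<mu>. y \<in> U \<longrightarrow> f y = 0)}"

definition relatively_compact_open :: "'a::topological_space set \<Rightarrow> bool" where
  "relatively_compact_open V \<longleftrightarrow> open V \<and> compact (closure V)"

definition form1 ::
    "'a measure \<Rightarrow> (('a \<Rightarrow> real) \<Rightarrow> ('a \<Rightarrow> real) \<Rightarrow> real) \<Rightarrow> ('a \<Rightarrow> real) \<Rightarrow> ('a \<Rightarrow> real) \<Rightarrow> real" where
  "form1 \<mu> \<E> u v = \<E> u v + L2_inner \<mu> u v"

locale dirichlet_form =
  fixes \<mu> :: "'a measure"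
    and \<E> :: "('a \<Rightarrow> real) \<Rightarrow> ('a \<Rightarrow> real) \<Rightarrow> real"
    and \<F> :: "('a \<Rightarrow> real) set"
  assumes domain_L2: "\<F> \<subseteq> L2 \<mu>"
    and domain_cong: "\<lbrakk>u \<in> \<F>; v \<in> borel_measurable \<mu>; AE x in \<mu>. u x = v x\<rbrakk> \<Longrightarrow> v \<in> \<F>"
    and domain_zero: "(\<lambda>x. 0) \<in> \<F>"
    and domain_add: "\<lbrakk>u \<in> \<F>; v \<in> \<F>\<rbrakk> \<Longrightarrow> (\<lambda>x. u x + v x) \<in> \<F>"
    and domain_scale: "u \<in> \<F> \<Longrightarrow> (\<lambda>x. c * u x) \<in> \<F>"
    and domain_dense: "\<lbrakk>f \<in> L2 \<mu>; e > 0\<rbrakk> \<Longrightarrow> \<exists>u\<in>\<F>. L2_norm \<mu> (\<lambda>x. f x - u x) < e"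
    and form_cong: "\<lbrakk>u \<in> \<F>; v \<in> \<F>; w \<in> \<F>; AE x in \<mu>. u x = v x\<rbrakk> \<Longrightarrow> \<E> u w = \<E> v w"
    and form_sym: "\<lbrakk>u \<in> \<F>; v \<in> \<F>\<rbrakk> \<Longrightarrow> \<E> u v = \<E> v u"
    and form_add: "\<lbrakk>u \<in> \<F>; v \<in> \<F>; w \<in> \<F>\<rbrakk> \<Longrightarrow> \<E> (\<lambda>x. u x + v x) w = \<E> u w + \<E> v w"
    and form_scale: "\<lbrakk>u \<in> \<F>; w \<in> \<F>\<rbrakk> \<Longrightarrow> \<E> (\<lambda>x. c * u x) w = c * \<E> u w"
    and form_nonneg: "u \<in> \<F> \<Longrightarrow> 0 \<le> \<E> u u"
    and form_closed:
      "\<lbrakk>\<And>n. U n \<in> \<F>;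
        \<And>e. e > 0 \<Longrightarrow> \<exists>N. \<forall>m\<ge>N. \<forall>n\<ge>N.
           form1 \<mu> \<E> (\<lambda>x. U m x - U n x) (\<lambda>x. U m x - U n x) < e\<rbrakk>
       \<Longrightarrow> \<exists>u\<in>\<F>. (\<lambda>n. form1 \<mu> \<E> (\<lambda>x. U n x - u x) (\<lambda>x. U n x - u x)) \<longlonglongrightarrow> 0"
    and form_markov:
      "u \<in> \<F> \<Longrightarrow> (\<lambda>x. min (max (u x) 0) 1) \<in> \<F> \<and>
         \<E> (\<lambda>x. min (max (u x) 0) 1) (\<lambda>x. min (max (u x) 0) 1) \<le> \<E> u u"

locale regular_dirichlet_form = dirichlet_form \<mu> \<E> \<F>
  for \<mu> :: "'a::topological_space measure" and \<E> \<F> +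
  assumes core_dense_domain:
      "\<lbrakk>u \<in> \<F>; e > 0\<rbrakk> \<Longrightarrow>
         \<exists>\<phi> \<in> \<F> \<inter> Cc. form1 \<mu> \<E> (\<lambda>x. u x - \<phi> x) (\<lambda>x. u x - \<phi> x) < e"
    and core_dense_Cc:
      "\<lbrakk>f \<in> Cc; e > 0\<rbrakk> \<Longrightarrow> \<exists>\<phi> \<in> \<F> \<inter> Cc. \<forall>x. \<bar>f x - \<phi> x\<bar> < e"

definition strongly_local ::
    "'a::topological_space measure \<Rightarrow> (('a \<Rightarrow> real) \<Rightarrow> ('a \<Rightarrow> real) \<Rightarrow> real) \<Rightarrow> ('a \<Rightarrow> real) set \<Rightarrow> bool"
  where
  "strongly_local \<mu> \<E> \<F> \<longleftrightarrow>
     (\<forall>u\<in>\<F>. \<forall>v\<in>\<F>.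
        (\<exists>W c. open W \<and> supp \<mu> v \<subseteq> W \<and> (AE x in \<mu>. x \<in> W \<longrightarrow> u x = c)) \<longrightarrow> \<E> u v = 0)"

text \<open>
  The integral representation of the form alone does not determine \<open>\<Gamma>\<close> (on the real line,
  composing a carre du champ with a translation gives another representation). The standard
  requirement that \<open>\<Gamma> u v\<close> is the density of the energy measure of \<open>u\<close> and \<open>v\<close> is
  \<open>carre_energy\<close>; its factor 2 belongs to the normalisation \<open>\<E> u v = \<integral> \<Gamma> u v\<close>,
  in which \<open>\<E>\<close> carries no factor 1/2.
\<close>

locale carre_du_champ =
  fixes \<mu> :: "'a measure"
    and \<E> :: "('a \<Rightarrow> real) \<Rightarrow> ('a \<Rightarrow> real) \<Rightarrow> real"
    and \<F> :: "('a \<Rightarrow> real) set"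
    and \<Gamma> :: "('a \<Rightarrow> real) \<Rightarrow> ('a \<Rightarrow> real) \<Rightarrow> 'a \<Rightarrow> real"
  assumes carre_integrable: "\<lbrakk>u \<in> \<F>; v \<in> \<F>\<rbrakk> \<Longrightarrow> integrable \<mu> (\<Gamma> u v)"
    and carre_cong: "\<lbrakk>u \<in> \<F>; v \<in> \<F>; w \<in> \<F>; AE x in \<mu>. u x = v x\<rbrakk> \<Longrightarrow> AE x in \<mu>. \<Gamma> u w x = \<Gamma> v w x"
    and carre_sym: "\<lbrakk>u \<in> \<F>; v \<in> \<F>\<rbrakk> \<Longrightarrow> AE x in \<mu>. \<Gamma> u v x = \<Gamma> v u x"
    and carre_add: "\<lbrakk>u \<in> \<F>; v \<in> \<F>; w \<in> \<F>\<rbrakk> \<Longrightarrow>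
      AE x in \<mu>. \<Gamma> (\<lambda>y. u y + v y) w x = \<Gamma> u w x + \<Gamma> v w x"
    and carre_scale: "\<lbrakk>u \<in> \<F>; w \<in> \<F>\<rbrakk> \<Longrightarrow> AE x in \<mu>. \<Gamma> (\<lambda>y. c * u y) w x = c * \<Gamma> u w x"
    and carre_nonneg: "u \<in> \<F> \<Longrightarrow> AE x in \<mu>. 0 \<le> \<Gamma> u u x"
    and carre_form: "\<lbrakk>u \<in> \<F>; v \<in> \<F>\<rbrakk> \<Longrightarrow> \<E> u v = (\<integral>x. \<Gamma> u v x \<partial>\<mu>)"
    and carre_energy:
      "\<lbrakk>u \<in> \<F> \<inter> Linf \<mu>; v \<in> \<F> \<inter> Linf \<mu>; h \<in> \<F> \<inter> Linf \<mu>\<rbrakk> \<Longrightarrow>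
         \<E> (\<lambda>x. u x * h x) v + \<E> (\<lambda>x. v x * h x) u - \<E> (\<lambda>x. u x * v x) h =
           2 * (\<integral>x. h x * \<Gamma> u v x \<partial>\<mu>)"

definition F_loc ::
    "'a::topological_space measure \<Rightarrow> ('a \<Rightarrow> real) set \<Rightarrow> ('a \<Rightarrow> real) set" where
  "F_loc \<mu> \<F> = {u \<in> borel_measurable \<mu>.
     \<forall>V. relatively_compact_open V \<longrightarrow> (\<exists>v\<in>\<F>. AE x in \<mu>. x \<in> V \<longrightarrow> u x = v x)}"

text \<open>
  The extension of \<open>\<Gamma>\<close> to \<open>F_loc \<mu> \<F>\<close>. By locality of \<open>\<Gamma>\<close> the
  function described exists and is unique up to almost everywhere equality.
\<close>

definition carre_loc ::
    "'a::topological_space measure \<Rightarrow> ('a \<Rightarrow> real) set \<Rightarrow>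
     (('a \<Rightarrow> real) \<Rightarrow> ('a \<Rightarrow> real) \<Rightarrow> 'a \<Rightarrow> real) \<Rightarrow> ('a \<Rightarrow> real) \<Rightarrow> ('a \<Rightarrow> real) \<Rightarrow> 'a \<Rightarrow> real" where
  "carre_loc \<mu> \<F> \<Gamma> u w = (SOME g. g \<in> borel_measurable \<mu> \<and>
     (\<forall>V. relatively_compact_open V \<longrightarrow>
        (\<forall>u'\<in>\<F>. \<forall>w'\<in>\<F>.
           (AE x in \<mu>. x \<in> V \<longrightarrow> u x = u' x) \<and> (AE x in \<mu>. x \<in> V \<longrightarrow> w x = w' x) \<longrightarrow>
           (AE x in \<mu>. x \<in> V \<longrightarrow> g x = \<Gamma> u' w' x))))"

text \<open>
  The strongly continuous semigroup of symmetric contractions on \<open>L2 \<mu>\<close> whose generator \<open>A\<close> is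
  the operator of the form: \<open>u\<close> is in the domain of \<open>A\<close> and \<open>A u = f\<close> iff \<open>u \<in> \<F>\<close> and
  \<open>\<E> u v\<close> is the inner product of \<open>- f\<close> and \<open>v\<close> for all \<open>v \<in> \<F>\<close>.
\<close>

locale form_semigroup =
  fixes \<mu> :: "'a measure"
    and \<E> :: "('a \<Rightarrow> real) \<Rightarrow> ('a \<Rightarrow> real) \<Rightarrow> real"
    and \<F> :: "('a \<Rightarrow> real) set"
    and T :: "real \<Rightarrow> ('a \<Rightarrow> real) \<Rightarrow> 'a \<Rightarrow> real"
  assumes sg_L2: "\<lbrakk>t > 0; f \<in> L2 \<mu>\<rbrakk> \<Longrightarrow> T t f \<in> L2 \<mu>"
    and sg_cong: "\<lbrakk>t > 0; f \<in> L2 \<mu>; g \<in> L2 \<mu>; AE x in \<mu>. f x = g x\<rbrakk> \<Longrightarrow> AE x in \<mu>. T t f x = T t g x"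
    and sg_add: "\<lbrakk>t > 0; f \<in> L2 \<mu>; g \<in> L2 \<mu>\<rbrakk> \<Longrightarrow>
      AE x in \<mu>. T t (\<lambda>y. f y + g y) x = T t f x + T t g x"
    and sg_scale: "\<lbrakk>t > 0; f \<in> L2 \<mu>\<rbrakk> \<Longrightarrow> AE x in \<mu>. T t (\<lambda>y. c * f y) x = c * T t f x"
    and sg_sym: "\<lbrakk>t > 0; f \<in> L2 \<mu>; g \<in> L2 \<mu>\<rbrakk> \<Longrightarrow> L2_inner \<mu> (T t f) g = L2_inner \<mu> f (T t g)"
    and sg_contraction: "\<lbrakk>t > 0; f \<in> L2 \<mu>\<rbrakk> \<Longrightarrow> L2_norm \<mu> (T t f) \<le> L2_norm \<mu> f"
    and sg_semigroup: "\<lbrakk>s > 0; t > 0; f \<in> L2 \<mu>\<rbrakk> \<Longrightarrow> AE x in \<mu>. T (s + t) f x = T s (T t f) x"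
    and sg_continuous: "f \<in> L2 \<mu> \<Longrightarrow> ((\<lambda>t. L2_norm \<mu> (\<lambda>x. T t f x - f x)) \<longlongrightarrow> 0) (at_right 0)"
    and sg_generator: "\<lbrakk>u \<in> L2 \<mu>; f \<in> L2 \<mu>\<rbrakk> \<Longrightarrow>
      ((\<lambda>t. L2_norm \<mu> (\<lambda>x. (T t u x - u x) / t - f x)) \<longlongrightarrow> 0) (at_right 0) \<longleftrightarrow>
      u \<in> \<F> \<and> (\<forall>v\<in>\<F>. \<E> u v = - L2_inner \<mu> f v)"

definition L2_approx :: "'a measure \<Rightarrow> ('a \<Rightarrow> real) \<Rightarrow> (nat \<Rightarrow> 'a \<Rightarrow> real) \<Rightarrow> bool" where
  "L2_approx \<mu> f F \<longleftrightarrow> (\<forall>n. F n \<in> L2 \<mu> \<inter> Linf \<mu>) \<and>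
     (AE x in \<mu>. (\<forall>n. 0 \<le> F n x \<and> F n x \<le> F (Suc n) x) \<and> (\<lambda>n. F n x) \<longlonglongrightarrow> f x)"

text \<open>
  The extension of \<open>T t\<close> to bounded functions, first to nonnegative ones. For a Markovian semigroup
  the almost everywhere limit exists and does not depend on the approximating sequence.
\<close>

definition Linf_ext_nonneg ::
    "'a measure \<Rightarrow> (real \<Rightarrow> ('a \<Rightarrow> real) \<Rightarrow> 'a \<Rightarrow> real) \<Rightarrow> real \<Rightarrow> ('a \<Rightarrow> real) \<Rightarrow> 'a \<Rightarrow> real" where
  "Linf_ext_nonneg \<mu> T t f = (SOME g. g \<in> borel_measurable \<mu> \<and>
     (\<forall>F. L2_approx \<mu> f F \<longrightarrow> (AE x in \<mu>. (\<lambda>n. T t (F n) x) \<longlonglongrightarrow> g x)))"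

definition Linf_ext ::
    "'a measure \<Rightarrow> (real \<Rightarrow> ('a \<Rightarrow> real) \<Rightarrow> 'a \<Rightarrow> real) \<Rightarrow> real \<Rightarrow> ('a \<Rightarrow> real) \<Rightarrow> 'a \<Rightarrow> real" where
  "Linf_ext \<mu> T t f = (\<lambda>x. Linf_ext_nonneg \<mu> T t (\<lambda>y. max (f y) 0) x
                          - Linf_ext_nonneg \<mu> T t (\<lambda>y. max (- f y) 0) x)"

definition conservative :: "'a measure \<Rightarrow> (real \<Rightarrow> ('a \<Rightarrow> real) \<Rightarrow> 'a \<Rightarrow> real) \<Rightarrow> bool" where
  "conservative \<mu> T \<longleftrightarrow> (\<forall>t>0. AE x in \<mu>. Linf_ext \<mu> T t (\<lambda>y. 1) x = 1)"

text \<open>Powers of nonnegative reals with \<open>0\<^sup>0 = 1\<close>, in contrast to \<open>0 powr 0 = 0\<close>.\<close>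

definition rpow :: "real \<Rightarrow> real \<Rightarrow> real" where
  "rpow x a = (if a = 0 then 1 else x powr a)"

end

theory Submission
  imports Defs "HOL-Real_Asymp.Real_Asymp"
begin

text \<open>
  By symmetry of the semigroup it suffices that \<open>T t\<close> preserves the integral of every bounded
  \<open>f \<ge> 0\<close> vanishing outside a ball, for all small \<open>t\<close>. Let \<open>w\<close> be the resolvent of \<open>f\<close> at \<open>l > 0\<close> and
  \<open>\<phi>\<close> a cutoff function equal to 1 on the support of \<open>f\<close>. A differential inequality for
  \<open>s \<mapsto> \<integral>f - l \<integral>\<phi> T s w\<close> bounds the mass loss \<open>\<integral>f - \<integral>T t f\<close> by \<open>exp (l t) \<E>(w, \<phi>)\<close>.

  Let \<open>\<eta>\<close> be a function of \<open>\<rho>(d)\<close> that is 1 on the support of \<open>f\<close>, grows at most at exponential rate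
  \<open>3 \<alpha> / 2\<close>, and has the constant value \<open>exp (\<alpha> L)\<close> near the annulus where \<open>\<phi>\<close> decreases; here \<open>\<rho>\<close>
  is chosen such that \<open>\<Gamma>(\<rho>(d), \<rho>(d))\<close> is bounded, and \<open>L\<close> is the increment of \<open>\<rho>\<close>. For
  \<open>l\<close> a suitable multiple of \<open>\<alpha>\<^sup>2\<close> one has \<open>\<Gamma>(\<eta>, \<eta>) \<le> (l / 2) \<eta>\<^sup>2\<close>; testing the resolvent equation with
  \<open>\<eta>\<^sup>2 w\<close> then bounds \<open>\<E>(\<eta> w, \<eta> w)\<close> by \<open>\<integral>f w\<close>, and locality gives
  \<open>\<E>(w, \<phi>) \<le> exp (- \<alpha> L) \<parallel>f\<parallel> (\<E>(\<phi>, \<phi>) / l)\<^sup>1\<^sup>/\<^sup>2\<close>.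

  For \<open>\<rho>(d) = d\<close>, \<open>(ln (d + 1))\<close> to the power \<open>1 - \<beta> / 2\<close>, and \<open>ln (ln (d + 1))\<close>, respectively, the volume
  hypothesis gives \<open>\<E>(\<phi>, \<phi>) \<le> exp (2 N \<rho>(n)\<^sup>2)\<close> with a new \<open>N\<close>. Taking \<open>\<alpha> = (N + 1) \<rho>(n)\<close>, so that \<open>l\<close> is of
  order \<open>\<rho>(n)\<^sup>2\<close>, the bound tends to 0 as \<open>n\<close> grows, provided that \<open>t\<close> is small.
\<close>

text \<open>The obstacle is that almost no calculus is given: a contraction axiom, strong locality
  and the identity \<open>carre_energy\<close>. Sign rules for mutual energies, a chain rule for
  functions of continuous elements of \<F> and the locality of \<Gamma> are extracted from these.
  Working with the resolvent turns the weighted estimate into an elliptic identity; time enters only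
  through exp (l t) and through Euler sums. Constants need not lie in \<F> and d is only locally in
  \<F>, so a weight growing outward is written C - \<kappa> with \<kappa> vanishing outside a ball.
  The scales match as follows. Put \<nu> = \<open>\<rho> (real n)\<close>. The weight gains exp (-
  (N + 1) \<nu>^2) up to a factor exp (c \<nu>), the energy of the cutoff costs exp (N \<nu>^2)
  after the square root, and exp (l t) costs at most exp (\<nu>^2 / 2) when t is at most 1 / (9 M (N
  + 1)^2). What remains is exp (c \<nu> - \<nu>^2 / 2). The bound on t depends neither on f nor on
  n, so composing short times reaches every t.\<close>

lemma nonneg_quadratic_imp_le:
  fixes a b c :: real
  assumes "\<And>t. 0 \<le> a + 2 * t * b + t\<^sup>2 * c" "0 \<le> c"
  shows "b\<^sup>2 \<le> a * c"
proof (cases "c = 0")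
  case True
  have "b = 0"
  proof (rule ccontr)
    assume "b \<noteq> 0"
    \<comment> \<open>For c = 0 the quadratic is affine in t, and at this t it equals -1.\<close>
    then have "2 * (- (a + 1) / (2 * b)) * b = - (a + 1)" by (simp add: field_simps)
    with assms(1)[of "- (a + 1) / (2 * b)"] True show False by simp
  qed
  with True show ?thesis by simp
next
  case False
  with assms(2) have c: "c > 0" by simp
  have "0 \<le> a - b\<^sup>2 / c"
    using assms(1)[of "- b / c"] c by (simp add: power2_eq_square field_simps)
  then show ?thesis using c by (simp add: field_simps)
qed

text \<open>Second-order expansion at x of the squared positive part: slope 2 max (x - c) 0,
  curvature at most 2. It replaces differentiation in time of the squared norm of an excess.\<close>

lemma sq_pos_part_le:
  fixes x y c :: real
  shows "(max (y - c) 0)\<^sup>2 \<le> (max (x - c) 0)\<^sup>2 + 2 * (max (x - c) 0 * (y - x)) + (y - x)\<^sup>2"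
proof -
  have "(max (y - c) 0)\<^sup>2 \<le> (max (x - c) 0 + (y - x))\<^sup>2" if "y > c"
    using that by (intro power_mono) auto
  moreover have "0 \<le> (max (x - c) 0 + (y - x))\<^sup>2" by simp
  ultimately have "(max (y - c) 0)\<^sup>2 \<le> (max (x - c) 0 + (y - x))\<^sup>2"
    by (cases "y > c") auto
  then show ?thesis by (simp add: power2_sum)
qed

lemma measure_le_of_emeasure_le:
  assumes "emeasure \<mu> A \<le> ennreal c" "0 \<le> c"
  shows "measure \<mu> A \<le> c"
  unfolding measure_def using assms by (intro enn2real_leI) auto

lemma integrable_bounded_mult:
  fixes f g :: "'a \<Rightarrow> real"
  assumes "integrable \<mu> f" "g \<in> borel_measurable \<mu>" "AE x in \<mu>. \<bar>g x\<bar> \<le> B"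
  shows "integrable \<mu> (\<lambda>x. g x * f x)"
proof (rule Bochner_Integration.integrable_bound)
  show "integrable \<mu> (\<lambda>x. B * f x)" using assms by simp
  show "AE x in \<mu>. norm (g x * f x) \<le> norm (B * f x)"
    using assms(3)
  proof eventually_elim
    fix x assume "\<bar>g x\<bar> \<le> B"
    then have "\<bar>g x\<bar> * \<bar>f x\<bar> \<le> \<bar>B\<bar> * \<bar>f x\<bar>" by (intro mult_right_mono) auto
    then show "norm (g x * f x) \<le> norm (B * f x)" by (simp add: abs_mult)
  qed
qed (use assms in auto)

section \<open>Square integrable functions\<close>

lemma L2_measurable [dest]: "f \<in> L2 \<mu> \<Longrightarrow> f \<in> borel_measurable \<mu>"
  by (simp add: L2_def)

lemma L2_integrable_square: "f \<in> L2 \<mu> \<Longrightarrow> integrable \<mu> (\<lambda>x. (f x)\<^sup>2)"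
  by (simp add: L2_def)

lemma L2_integrable_mult:
  assumes "f \<in> L2 \<mu>" "g \<in> L2 \<mu>"
  shows "integrable \<mu> (\<lambda>x. f x * g x)"
proof (rule Bochner_Integration.integrable_bound)
  show "integrable \<mu> (\<lambda>x. (f x)\<^sup>2 + (g x)\<^sup>2)"
    using assms by (simp add: L2_integrable_square)
  show "(\<lambda>x. f x * g x) \<in> borel_measurable \<mu>"
    using assms by (auto intro: borel_measurable_times)
  show "AE x in \<mu>. norm (f x * g x) \<le> norm ((f x)\<^sup>2 + (g x)\<^sup>2)"
  proof (rule AE_I2)
    fix x
    have "2 * (\<bar>f x\<bar> * \<bar>g x\<bar>) \<le> (f x)\<^sup>2 + (g x)\<^sup>2"
      using sum_squares_bound[of "\<bar>f x\<bar>" "\<bar>g x\<bar>"] by (simp add: mult.assoc)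
    moreover have "0 \<le> \<bar>f x\<bar> * \<bar>g x\<bar>" by simp
    ultimately show "norm (f x * g x) \<le> norm ((f x)\<^sup>2 + (g x)\<^sup>2)"
      unfolding real_norm_def abs_mult by linarith
  qed
qed

lemma L2_zero [simp]: "(\<lambda>x. 0) \<in> L2 \<mu>"
  by (simp add: L2_def)

lemma L2_add: "f \<in> L2 \<mu> \<Longrightarrow> g \<in> L2 \<mu> \<Longrightarrow> (\<lambda>x. f x + g x) \<in> L2 \<mu>"
  unfolding L2_def using L2_integrable_mult[of f \<mu> g]
  by (auto simp: power2_sum L2_def mult.assoc)

lemma L2_scale: "f \<in> L2 \<mu> \<Longrightarrow> (\<lambda>x. c * f x) \<in> L2 \<mu>"
  unfolding L2_def by (auto simp: power_mult_distrib)

lemma L2_diff: "f \<in> L2 \<mu> \<Longrightarrow> g \<in> L2 \<mu> \<Longrightarrow> (\<lambda>x. f x - g x) \<in> L2 \<mu>"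
  using L2_add[of f \<mu> "\<lambda>x. (-1) * g x"] L2_scale[of g \<mu> "-1"] by simp

lemma L2_minus: "f \<in> L2 \<mu> \<Longrightarrow> (\<lambda>x. - f x) \<in> L2 \<mu>"
  using L2_scale[of f \<mu> "-1"] by simp

lemma L2_bound:
  assumes "f \<in> L2 \<mu>" "g \<in> borel_measurable \<mu>" "AE x in \<mu>. \<bar>g x\<bar> \<le> \<bar>f x\<bar>"
  shows "g \<in> L2 \<mu>"
proof -
  have "integrable \<mu> (\<lambda>x. (g x)\<^sup>2)"
  proof (rule Bochner_Integration.integrable_bound)
    show "integrable \<mu> (\<lambda>x. (f x)\<^sup>2)" using assms(1) by (rule L2_integrable_square)
    show "AE x in \<mu>. norm ((g x)\<^sup>2) \<le> norm ((f x)\<^sup>2)"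
      using assms(3) by eventually_elim (simp add: abs_le_square_iff)
  qed (use assms in measurable)
  then show ?thesis using assms(2) by (simp add: L2_def)
qed

lemma L2_inner_commute: "L2_inner \<mu> f g = L2_inner \<mu> g f"
  by (simp add: L2_inner_def mult.commute)

lemma L2_inner_add_left:
  "f \<in> L2 \<mu> \<Longrightarrow> g \<in> L2 \<mu> \<Longrightarrow> h \<in> L2 \<mu> \<Longrightarrow>
    L2_inner \<mu> (\<lambda>x. f x + g x) h = L2_inner \<mu> f h + L2_inner \<mu> g h"
  by (simp add: L2_inner_def distrib_right L2_integrable_mult)

lemma L2_inner_diff_left:
  "f \<in> L2 \<mu> \<Longrightarrow> g \<in> L2 \<mu> \<Longrightarrow> h \<in> L2 \<mu> \<Longrightarrow>
    L2_inner \<mu> (\<lambda>x. f x - g x) h = L2_inner \<mu> f h - L2_inner \<mu> g h"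
  by (simp add: L2_inner_def left_diff_distrib L2_integrable_mult)

lemma L2_inner_scale_left: "L2_inner \<mu> (\<lambda>x. c * f x) h = c * L2_inner \<mu> f h"
  by (simp add: L2_inner_def mult.assoc)

lemma L2_inner_add_right:
  "f \<in> L2 \<mu> \<Longrightarrow> g \<in> L2 \<mu> \<Longrightarrow> h \<in> L2 \<mu> \<Longrightarrow>
    L2_inner \<mu> h (\<lambda>x. f x + g x) = L2_inner \<mu> h f + L2_inner \<mu> h g"
  by (simp add: L2_inner_def distrib_left L2_integrable_mult)

lemma L2_inner_diff_right:
  "f \<in> L2 \<mu> \<Longrightarrow> g \<in> L2 \<mu> \<Longrightarrow> h \<in> L2 \<mu> \<Longrightarrow>
    L2_inner \<mu> h (\<lambda>x. f x - g x) = L2_inner \<mu> h f - L2_inner \<mu> h g"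
  by (simp add: L2_inner_def right_diff_distrib L2_integrable_mult)

lemma L2_inner_scale_right: "L2_inner \<mu> h (\<lambda>x. c * f x) = c * L2_inner \<mu> h f"
  by (simp add: L2_inner_def mult.left_commute)

lemmas L2_inner_simps = L2_inner_add_left L2_inner_diff_left L2_inner_scale_left
  L2_inner_add_right L2_inner_diff_right L2_inner_scale_right

lemma L2_inner_cong:
  assumes "f \<in> borel_measurable \<mu>" "g \<in> borel_measurable \<mu>" "h \<in> borel_measurable \<mu>"
    "AE x in \<mu>. f x = g x"
  shows "L2_inner \<mu> f h = L2_inner \<mu> g h"
  unfolding L2_inner_def
  by (rule integral_cong_AE) (use assms in auto)

lemma L2_inner_self_nonneg: "0 \<le> L2_inner \<mu> f f"
  by (simp add: L2_inner_def)

lemma L2_norm_nonneg [simp]: "0 \<le> L2_norm \<mu> f"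
  by (simp add: L2_norm_def L2_inner_self_nonneg)

lemma L2_norm_square: "(L2_norm \<mu> f)\<^sup>2 = L2_inner \<mu> f f"
  by (simp add: L2_norm_def L2_inner_self_nonneg)

lemma L2_inner_Cauchy_Schwarz:
  assumes "f \<in> L2 \<mu>" "g \<in> L2 \<mu>"
  shows "\<bar>L2_inner \<mu> f g\<bar> \<le> L2_norm \<mu> f * L2_norm \<mu> g"
proof -
  have "(L2_inner \<mu> f g)\<^sup>2 \<le> L2_inner \<mu> f f * L2_inner \<mu> g g"
  proof (rule nonneg_quadratic_imp_le)
    fix t
    have "0 \<le> L2_inner \<mu> (\<lambda>x. f x + t * g x) (\<lambda>x. f x + t * g x)"
      by (rule L2_inner_self_nonneg)
    also have "\<dots> = L2_inner \<mu> f f + 2 * t * L2_inner \<mu> f g + t\<^sup>2 * L2_inner \<mu> g g"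
      using assms by (simp add: L2_inner_simps L2_add L2_scale L2_inner_commute[of \<mu> g f]
          power2_eq_square algebra_simps)
    finally show "0 \<le> L2_inner \<mu> f f + 2 * t * L2_inner \<mu> f g + t\<^sup>2 * L2_inner \<mu> g g" .
  qed (rule L2_inner_self_nonneg)
  then have "(L2_inner \<mu> f g)\<^sup>2 \<le> (L2_norm \<mu> f * L2_norm \<mu> g)\<^sup>2"
    by (simp add: power_mult_distrib L2_norm_square)
  then show ?thesis by (simp add: abs_le_square_iff[symmetric])
qed

lemma L2_norm_triangle:
  assumes "f \<in> L2 \<mu>" "g \<in> L2 \<mu>"
  shows "L2_norm \<mu> (\<lambda>x. f x + g x) \<le> L2_norm \<mu> f + L2_norm \<mu> g"
proof (rule power2_le_imp_le)
  have "(L2_norm \<mu> (\<lambda>x. f x + g x))\<^sup>2 =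
      L2_inner \<mu> f f + 2 * L2_inner \<mu> f g + L2_inner \<mu> g g"
    using assms by (simp add: L2_norm_square L2_inner_simps L2_add L2_inner_commute[of \<mu> g f])
  also have "\<dots> \<le> (L2_norm \<mu> f + L2_norm \<mu> g)\<^sup>2"
    using L2_inner_Cauchy_Schwarz[OF assms] by (simp add: power2_sum L2_norm_square)
  finally show "(L2_norm \<mu> (\<lambda>x. f x + g x))\<^sup>2 \<le> (L2_norm \<mu> f + L2_norm \<mu> g)\<^sup>2" .
qed simp

lemma L2_norm_scale: "L2_norm \<mu> (\<lambda>x. c * f x) = \<bar>c\<bar> * L2_norm \<mu> f"
  by (simp add: L2_norm_def L2_inner_simps real_sqrt_mult flip: mult.assoc)

lemma L2_norm_diff_le:
  assumes "f \<in> L2 \<mu>" "g \<in> L2 \<mu>"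
  shows "L2_norm \<mu> (\<lambda>x. f x - g x) \<le> L2_norm \<mu> f + L2_norm \<mu> g"
  using L2_norm_triangle[OF assms(1) L2_minus[OF assms(2)]] L2_norm_scale[of \<mu> "-1" g] by simp

lemma L2_norm_minus_commute: "L2_norm \<mu> (\<lambda>x. f x - g x) = L2_norm \<mu> (\<lambda>x. g x - f x)"
  by (simp add: L2_norm_def L2_inner_def power2_commute flip: power2_eq_square)

lemma L2_norm_cong:
  assumes "f \<in> borel_measurable \<mu>" "g \<in> borel_measurable \<mu>" "AE x in \<mu>. f x = g x"
  shows "L2_norm \<mu> f = L2_norm \<mu> g"
  unfolding L2_norm_def using L2_inner_cong[OF assms(1,2,1,3)] L2_inner_cong[OF assms(1,2,2,3)]
  by (simp add: L2_inner_commute)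

lemma L2_norm_mono:
  assumes "g \<in> L2 \<mu>" "f \<in> borel_measurable \<mu>" "AE x in \<mu>. \<bar>f x\<bar> \<le> \<bar>g x\<bar>"
  shows "L2_norm \<mu> f \<le> L2_norm \<mu> g"
  unfolding L2_norm_def L2_inner_def
proof (rule real_sqrt_le_mono, rule integral_mono_AE)
  show "AE x in \<mu>. f x * f x \<le> g x * g x"
    using assms(3) by eventually_elim (simp add: abs_le_square_iff flip: power2_eq_square)
  show "integrable \<mu> (\<lambda>x. f x * f x)"
    using L2_bound[OF assms] by (simp add: L2_integrable_mult)
qed (use assms in \<open>simp add: L2_integrable_mult\<close>)

lemma L2_inner_self_eq_0D:
  assumes "f \<in> L2 \<mu>" "L2_inner \<mu> f f = 0"
  shows "AE x in \<mu>. f x = 0"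
  using assms integral_nonneg_eq_0_iff_AE[of \<mu> "\<lambda>x. f x * f x"]
  by (simp add: L2_inner_def L2_integrable_mult)

lemma L2_dominated_convergence:
  assumes "g \<in> L2 \<mu>" "\<And>n. F n \<in> borel_measurable \<mu>" "f \<in> borel_measurable \<mu>"
    and "\<And>n. AE x in \<mu>. \<bar>F n x - f x\<bar> \<le> g x"
    and "AE x in \<mu>. (\<lambda>n. F n x) \<longlonglongrightarrow> f x"
  shows "(\<lambda>n. L2_norm \<mu> (\<lambda>x. F n x - f x)) \<longlonglongrightarrow> 0"
proof -
  have "(\<lambda>n. \<integral>x. (F n x - f x)\<^sup>2 \<partial>\<mu>) \<longlonglongrightarrow> (\<integral>x. 0 \<partial>\<mu>)"
  proof (rule integral_dominated_convergence[where w="\<lambda>x. (g x)\<^sup>2"])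
    show "AE x in \<mu>. (\<lambda>n. (F n x - f x)\<^sup>2) \<longlonglongrightarrow> 0"
      using assms(5)
    proof eventually_elim
      fix x assume "(\<lambda>n. F n x) \<longlonglongrightarrow> f x"
      then have "(\<lambda>n. (F n x - f x)\<^sup>2) \<longlonglongrightarrow> (f x - f x)\<^sup>2" by (intro tendsto_intros)
      then show "(\<lambda>n. (F n x - f x)\<^sup>2) \<longlonglongrightarrow> 0" by simp
    qed
    show "AE x in \<mu>. norm ((F n x - f x)\<^sup>2) \<le> (g x)\<^sup>2" for n
      using assms(4)[of n] by eventually_elim (simp add: abs_le_square_iff[symmetric])
  qed (use assms in \<open>auto simp: L2_integrable_square\<close>)
  then have "(\<lambda>n. sqrt (\<integral>x. (F n x - f x)\<^sup>2 \<partial>\<mu>)) \<longlonglongrightarrow> sqrt 0"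
    by (intro tendsto_real_sqrt) simp
  then show ?thesis by (simp add: L2_norm_def L2_inner_def power2_eq_square)
qed

lemma L2_inner_tendsto:
  assumes "\<And>n. F n \<in> L2 \<mu>" "f \<in> L2 \<mu>" "g \<in> L2 \<mu>"
    and "(\<lambda>n. L2_norm \<mu> (\<lambda>x. F n x - f x)) \<longlonglongrightarrow> 0"
  shows "(\<lambda>n. L2_inner \<mu> (F n) g) \<longlonglongrightarrow> L2_inner \<mu> f g"
proof (subst LIM_zero_iff[symmetric], rule tendsto_0_le[where K = "L2_norm \<mu> g"])
  show "(\<lambda>n. L2_norm \<mu> (\<lambda>x. F n x - f x)) \<longlonglongrightarrow> 0" by fact
  show "\<forall>\<^sub>F n in sequentially. norm (L2_inner \<mu> (F n) g - L2_inner \<mu> f g)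
      \<le> norm (L2_norm \<mu> (\<lambda>x. F n x - f x)) * L2_norm \<mu> g"
    using L2_inner_Cauchy_Schwarz[OF L2_diff[OF assms(1,2)] assms(3)] assms
    by (simp add: L2_inner_simps)
qed

lemma indicator_L2:
  assumes "A \<in> sets \<mu>" "emeasure \<mu> A < \<infinity>"
  shows "indicat_real A \<in> L2 \<mu>"
proof -
  have "(\<lambda>x. (indicat_real A x)\<^sup>2) = indicat_real A" by (auto simp: indicator_def)
  then show ?thesis using assms by (simp add: L2_def)
qed

lemma Linf_I: "u \<in> borel_measurable \<mu> \<Longrightarrow> (\<And>x. \<bar>u x\<bar> \<le> B) \<Longrightarrow> u \<in> Linf \<mu>"
  by (auto simp: Linf_def intro!: exI[of _ B])

section \<open>The Hilbert space of a closed form\<close>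

context dirichlet_form
begin

abbreviation ip :: "('a \<Rightarrow> real) \<Rightarrow> ('a \<Rightarrow> real) \<Rightarrow> real" where "ip \<equiv> L2_inner \<mu>"
abbreviation nrm :: "('a \<Rightarrow> real) \<Rightarrow> real" where "nrm \<equiv> L2_norm \<mu>"

lemma F_L2 [dest]: "u \<in> \<F> \<Longrightarrow> u \<in> L2 \<mu>"
  using domain_L2 by auto

lemma F_measurable [dest]: "u \<in> \<F> \<Longrightarrow> u \<in> borel_measurable \<mu>"
  by auto

lemma F_diff: "u \<in> \<F> \<Longrightarrow> v \<in> \<F> \<Longrightarrow> (\<lambda>x. u x - v x) \<in> \<F>"
  using domain_add[of u "\<lambda>x. (-1) * v x"] domain_scale[of v "-1"] by simp

lemma F_minus: "u \<in> \<F> \<Longrightarrow> (\<lambda>x. - u x) \<in> \<F>"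
  using domain_scale[of u "-1"] by simp

lemma F_sum: "(\<And>i. i \<in> I \<Longrightarrow> u i \<in> \<F>) \<Longrightarrow> (\<lambda>x. \<Sum>i\<in>I. u i x) \<in> \<F>"
  by (induction I rule: infinite_finite_induct) (auto simp: domain_zero domain_add)

lemmas F_intros = domain_add domain_scale F_diff F_minus F_sum domain_zero

lemma form_add_right:
  "u \<in> \<F> \<Longrightarrow> v \<in> \<F> \<Longrightarrow> w \<in> \<F> \<Longrightarrow> \<E> w (\<lambda>x. u x + v x) = \<E> w u + \<E> w v"
  using form_add[of u v w] by (simp add: form_sym domain_add)

lemma form_scale_right: "u \<in> \<F> \<Longrightarrow> w \<in> \<F> \<Longrightarrow> \<E> w (\<lambda>x. c * u x) = c * \<E> w u"
  using form_scale[of u w c] by (simp add: form_sym domain_scale)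

lemma form_diff: "u \<in> \<F> \<Longrightarrow> v \<in> \<F> \<Longrightarrow> w \<in> \<F> \<Longrightarrow> \<E> (\<lambda>x. u x - v x) w = \<E> u w - \<E> v w"
  using form_add[of u "\<lambda>x. (-1) * v x" w] form_scale[of v w "-1"] domain_scale[of v "-1"] by simp

lemma form_minus: "u \<in> \<F> \<Longrightarrow> w \<in> \<F> \<Longrightarrow> \<E> (\<lambda>x. - u x) w = - \<E> u w"
  using form_scale[of u w "-1"] by simp

lemma form_minus_right: "u \<in> \<F> \<Longrightarrow> w \<in> \<F> \<Longrightarrow> \<E> w (\<lambda>x. - u x) = - \<E> w u"
  using form_scale_right[of u w "-1"] by simp

lemma form_diff_right:
  "u \<in> \<F> \<Longrightarrow> v \<in> \<F> \<Longrightarrow> w \<in> \<F> \<Longrightarrow> \<E> w (\<lambda>x. u x - v x) = \<E> w u - \<E> w v"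
  using form_diff[of u v w] by (simp add: form_sym F_diff)

lemma form_zero: "w \<in> \<F> \<Longrightarrow> \<E> (\<lambda>x. 0) w = 0"
  using form_scale[of "\<lambda>x. 0" w 0] by (simp add: domain_zero)

lemma form_zero_right: "w \<in> \<F> \<Longrightarrow> \<E> w (\<lambda>x. 0) = 0"
  using form_scale_right[of "\<lambda>x. 0" w 0] by (simp add: domain_zero)

lemma form_sum:
  "(\<And>i. i \<in> I \<Longrightarrow> u i \<in> \<F>) \<Longrightarrow> w \<in> \<F> \<Longrightarrow> \<E> (\<lambda>x. \<Sum>i\<in>I. u i x) w = (\<Sum>i\<in>I. \<E> (u i) w)"
  by (induction I rule: infinite_finite_induct) (auto simp: form_zero form_add F_sum)

lemma form_sum_right:
  "(\<And>i. i \<in> I \<Longrightarrow> u i \<in> \<F>) \<Longrightarrow> w \<in> \<F> \<Longrightarrow> \<E> w (\<lambda>x. \<Sum>i\<in>I. u i x) = (\<Sum>i\<in>I. \<E> w (u i))"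
  by (induction I rule: infinite_finite_induct) (auto simp: form_zero_right form_add_right F_sum)

lemma form_cong_both:
  assumes "u \<in> \<F>" "u' \<in> \<F>" "v \<in> \<F>" "v' \<in> \<F>"
    "AE x in \<mu>. u x = u' x" "AE x in \<mu>. v x = v' x"
  shows "\<E> u v = \<E> u' v'"
  using form_cong[of u u' v] form_cong[of v v' u'] assms form_sym by metis

lemmas form_simps = form_add form_scale form_diff form_minus form_add_right form_scale_right
  form_diff_right form_minus_right F_intros

section \<open>The shifted forms and the Riesz representation\<close>

definition frm :: "real \<Rightarrow> ('a \<Rightarrow> real) \<Rightarrow> ('a \<Rightarrow> real) \<Rightarrow> real" where
  "frm l u v = \<E> u v + l * ip u v"

lemma frm_sym: "u \<in> \<F> \<Longrightarrow> v \<in> \<F> \<Longrightarrow> frm l u v = frm l v u"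
  by (simp add: frm_def form_sym L2_inner_commute)

lemma frm_nonneg: "u \<in> \<F> \<Longrightarrow> 0 \<le> l \<Longrightarrow> 0 \<le> frm l u u"
  by (simp add: frm_def form_nonneg L2_inner_self_nonneg)

lemma frm_expand:
  assumes "u \<in> \<F>" "v \<in> \<F>"
  shows "frm l (\<lambda>x. u x + t * v x) (\<lambda>x. u x + t * v x) = frm l u u + 2 * t * frm l u v + t\<^sup>2 * frm l v v"
  using assms
  by (simp add: frm_def form_simps form_sym[of v u] L2_inner_simps L2_add L2_scale F_L2
      L2_inner_commute[of \<mu> v u] power2_eq_square algebra_simps)

lemma frm_diff_left: "u \<in> \<F> \<Longrightarrow> v \<in> \<F> \<Longrightarrow> w \<in> \<F> \<Longrightarrow> frm l (\<lambda>x. u x - v x) w = frm l u w - frm l v w"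
  by (simp add: frm_def form_simps L2_inner_simps F_L2 algebra_simps)

lemma frm_Cauchy_Schwarz:
  assumes "u \<in> \<F>" "v \<in> \<F>" "0 \<le> l"
  shows "\<bar>frm l u v\<bar> \<le> sqrt (frm l u u) * sqrt (frm l v v)"
proof -
  have "(frm l u v)\<^sup>2 \<le> frm l u u * frm l v v"
    using frm_nonneg[OF domain_add[OF assms(1) domain_scale[OF assms(2)]] assms(3)]
    by (intro nonneg_quadratic_imp_le) (simp_all add: frm_expand assms frm_nonneg)
  from real_sqrt_le_mono[OF this] show ?thesis by (simp add: real_sqrt_mult)
qed

lemma form_Cauchy_Schwarz:
  assumes "u \<in> \<F>" "v \<in> \<F>"
  shows "\<bar>\<E> u v\<bar> \<le> sqrt (\<E> u u) * sqrt (\<E> v v)"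
  using frm_Cauchy_Schwarz[OF assms, of 0] by (simp add: frm_def)

lemma form_expand:
  assumes "u \<in> \<F>" "v \<in> \<F>"
  shows "\<E> (\<lambda>x. u x + t * v x) (\<lambda>x. u x + t * v x) = \<E> u u + 2 * t * \<E> u v + t\<^sup>2 * \<E> v v"
  using frm_expand[OF assms, of 0] by (simp add: frm_def)

text \<open>A minimising sequence of J = \<open>frm l v v\<close> - 2 L v is Cauchy by the
  parallelogram identity, and \<open>form_closed\<close> supplies the limit. The subspace S need not
  be closed, so the representative p lies only in \<F>; the sequence in S converging to it is part
  of the conclusion because density arguments use it.\<close>

lemma Riesz:
  assumes S: "S \<subseteq> \<F>" "(\<lambda>x. 0) \<in> S"
    "\<And>u v. u \<in> S \<Longrightarrow> v \<in> S \<Longrightarrow> (\<lambda>x. u x + v x) \<in> S"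
    "\<And>c u. u \<in> S \<Longrightarrow> (\<lambda>x. c * u x) \<in> S"
    and L: "\<And>u v. u \<in> S \<Longrightarrow> v \<in> S \<Longrightarrow> L (\<lambda>x. u x + v x) = L u + L v"
    "\<And>c u. u \<in> S \<Longrightarrow> L (\<lambda>x. c * u x) = c * L u"
    and bound: "\<And>u. u \<in> S \<Longrightarrow> \<bar>L u\<bar> \<le> C * sqrt (frm l u u)"
    and l: "0 < l"
  obtains p s where "p \<in> \<F>" "\<And>n::nat. s n \<in> S"
    "(\<lambda>n. frm l (\<lambda>x. s n x - p x) (\<lambda>x. s n x - p x)) \<longlonglongrightarrow> 0"
    "\<And>v. v \<in> S \<Longrightarrow> frm l p v = L v"
proof -
  define J where "J v = frm l v v - 2 * L v" for v
  define m where "m = Inf (J ` S)"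
  have SF: "v \<in> \<F>" if "v \<in> S" for v using that S(1) by blast
  have J_bound: "- C\<^sup>2 \<le> J v" if "v \<in> S" for v
  proof -
    have "2 * L v \<le> 2 * (C * sqrt (frm l v v))" using bound[OF that] by linarith
    also have "\<dots> \<le> C\<^sup>2 + (sqrt (frm l v v))\<^sup>2"
      using sum_squares_bound[of C "sqrt (frm l v v)"] by (simp add: mult.assoc)
    finally show ?thesis using frm_nonneg[OF SF[OF that], of l] l by (simp add: J_def)
  qed
  have bdd: "bdd_below (J ` S)" using J_bound by (auto intro!: bdd_belowI2)
  have m_le: "m \<le> J v" if "v \<in> S" for v
    unfolding m_def using that bdd by (auto intro: cInf_lower)
  have "\<exists>v\<in>S. J v < m + 1 / (real n + 1)" for n
    using cInf_less_iff[of "J ` S" "m + 1 / (real n + 1)"] bdd S(2) unfolding m_def by auto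
  then obtain s where s: "\<And>n. s n \<in> S" "\<And>n. J (s n) < m + 1 / (real n + 1)" by metis
  have J_expand: "J (\<lambda>x. u x + t * v x) = J u + 2 * t * (frm l u v - L v) + t\<^sup>2 * frm l v v"
    if "u \<in> S" "v \<in> S" for u v t
    using that by (simp add: J_def frm_expand SF L S(4) algebra_simps)
  have diff: "frm l (\<lambda>x. s i x - s j x) (\<lambda>x. s i x - s j x) \<le> 2 / (real i + 1) + 2 / (real j + 1)" for i j
  proof -
    let ?d = "\<lambda>x. s i x + (- 1) * s j x"
    have d: "?d \<in> S" using s(1) by (intro S(3,4)) auto
    \<comment> \<open>The midpoint of \<open>s i\<close> and \<open>s j\<close> cannot beat the
      infimum; this controls the distance of two near-minimisers.\<close>
    have "m \<le> J (\<lambda>x. s j x + 1/2 * ?d x)" by (intro m_le S(3,4) d s(1))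
    also have "\<dots> = J (s j) + (frm l (s j) ?d - L ?d) + 1/4 * frm l ?d ?d"
      using J_expand[OF s(1)[of j] d, of "1/2"] by (simp add: power2_eq_square)
    finally have 1: "m \<le> J (s j) + (frm l (s j) ?d - L ?d) + 1/4 * frm l ?d ?d" .
    have "J (s i) = J (\<lambda>x. s j x + 1 * ?d x)" by simp
    also have "\<dots> = J (s j) + 2 * (frm l (s j) ?d - L ?d) + frm l ?d ?d"
      using J_expand[OF s(1)[of j] d, of 1] by simp
    finally have "frm l ?d ?d \<le> 2 * (J (s i) - m) + 2 * (J (s j) - m)" using 1 by argo
    with s(2)[of i] s(2)[of j] show ?thesis by (simp add: diff_conv_add_uminus[symmetric])
  qed
  \<comment> \<open>\<open>form_closed\<close> speaks of \<open>form1\<close>, so the Cauchy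
    property and the limit are transferred through the equivalence of \<open>form1\<close> and
    \<open>frm l\<close>, with constants min 1 l and max 1 l.\<close>
  define m1 where "m1 = min 1 l"
  have m1: "m1 > 0" "m1 \<le> 1" "m1 \<le> l" using l by (auto simp: m1_def)
  have le_frm: "m1 * form1 \<mu> \<E> v v \<le> frm l v v" if "v \<in> \<F>" for v
  proof -
    have "m1 * \<E> v v \<le> 1 * \<E> v v" "m1 * ip v v \<le> l * ip v v"
      using m1 form_nonneg[OF that] L2_inner_self_nonneg[of \<mu> v] by (intro mult_right_mono; simp)+
    then show ?thesis by (simp add: form1_def frm_def distrib_left)
  qed
  have "\<exists>N. \<forall>i\<ge>N. \<forall>j\<ge>N. form1 \<mu> \<E> (\<lambda>x. s i x - s j x) (\<lambda>x. s i x - s j x) < e"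
    if e: "e > 0" for e
  proof -
    obtain N :: nat where N: "4 / (m1 * e) < real N" using reals_Archimedean2 by blast
    have "form1 \<mu> \<E> (\<lambda>x. s i x - s j x) (\<lambda>x. s i x - s j x) < e" if "i \<ge> N" "j \<ge> N" for i j
    proof -
      have N0: "real N > 0" using N e m1 by (smt (verit) divide_pos_pos mult_pos_pos)
      have "2 / (real i + 1) \<le> 2 / real N" "2 / (real j + 1) \<le> 2 / real N"
        using that N0 by (auto intro!: divide_left_mono)
      then have "m1 * form1 \<mu> \<E> (\<lambda>x. s i x - s j x) (\<lambda>x. s i x - s j x) \<le> 4 / real N"
        using diff[of i j] le_frm[OF F_diff[OF SF[OF s(1)[of i]] SF[OF s(1)[of j]]]] by linarith
      also have "4 / real N < m1 * e" using N e m1 N0 by (simp add: field_simps)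
      finally show ?thesis using m1 by simp
    qed
    then show ?thesis by blast
  qed
  from form_closed[OF SF[OF s(1)] this] obtain p where p: "p \<in> \<F>"
    "(\<lambda>n. form1 \<mu> \<E> (\<lambda>x. s n x - p x) (\<lambda>x. s n x - p x)) \<longlonglongrightarrow> 0"
    by blast
  have lim: "(\<lambda>n. frm l (\<lambda>x. s n x - p x) (\<lambda>x. s n x - p x)) \<longlonglongrightarrow> 0"
  proof (rule tendsto_sandwich)
    show "\<forall>\<^sub>F n in sequentially. 0 \<le> frm l (\<lambda>x. s n x - p x) (\<lambda>x. s n x - p x)"
      using l by (intro always_eventually allI frm_nonneg F_diff SF s(1) p(1)) simp
    show "\<forall>\<^sub>F n in sequentially. frm l (\<lambda>x. s n x - p x) (\<lambda>x. s n x - p x)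
        \<le> max 1 l * form1 \<mu> \<E> (\<lambda>x. s n x - p x) (\<lambda>x. s n x - p x)"
    proof (rule always_eventually, rule allI)
      fix n
      let ?v = "\<lambda>x. s n x - p x"
      have "1 * \<E> ?v ?v \<le> max 1 l * \<E> ?v ?v" "l * ip ?v ?v \<le> max 1 l * ip ?v ?v"
        using form_nonneg[OF F_diff[OF SF[OF s(1)] p(1)]] L2_inner_self_nonneg[of \<mu> ?v]
        by (intro mult_right_mono; simp)+
      then show "frm l ?v ?v \<le> max 1 l * form1 \<mu> \<E> ?v ?v"
        by (simp add: form1_def frm_def distrib_left)
    qed
    show "(\<lambda>n. max 1 l * form1 \<mu> \<E> (\<lambda>x. s n x - p x) (\<lambda>x. s n x - p x)) \<longlonglongrightarrow> 0"
      using tendsto_mult_left[OF p(2), of "max 1 l"] by simp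
  qed simp
  have "frm l p v = L v" if v: "v \<in> S" for v
  proof (rule LIMSEQ_unique)
    have "(\<lambda>n. frm l (s n) v - frm l p v) \<longlonglongrightarrow> 0"
    proof (rule Lim_null_comparison)
      show "\<forall>\<^sub>F n in sequentially. norm (frm l (s n) v - frm l p v) \<le>
          sqrt (frm l (\<lambda>x. s n x - p x) (\<lambda>x. s n x - p x)) * sqrt (frm l v v)"
        using frm_Cauchy_Schwarz[OF F_diff[OF SF[OF s(1)] p(1)] SF[OF v]] l
        by (simp add: frm_diff_left SF s(1) p(1) v)
      show "(\<lambda>n. sqrt (frm l (\<lambda>x. s n x - p x) (\<lambda>x. s n x - p x)) * sqrt (frm l v v)) \<longlonglongrightarrow> 0"
        using tendsto_mult_right[OF tendsto_real_sqrt[OF lim], of "sqrt (frm l v v)"] by simp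
    qed
    then show "(\<lambda>n. frm l (s n) v) \<longlonglongrightarrow> frm l p v" by (simp add: LIM_zero_iff)
    have "(\<lambda>n. frm l (s n) v - L v) \<longlonglongrightarrow> 0"
    proof (rule Lim_null_comparison)
      have "\<bar>frm l (s n) v - L v\<bar> \<le> sqrt ((1 / (real n + 1)) * frm l v v)" for n
      proof -
        \<comment> \<open>At a near-minimiser the derivative of J in direction v is small: its
          square is bounded by the gap \<open>J (s n) - m\<close>, again by the
          discriminant.\<close>
        have "(frm l (s n) v - L v)\<^sup>2 \<le> (J (s n) - m) * frm l v v"
        proof (rule nonneg_quadratic_imp_le)
          fix t
          have "m \<le> J (\<lambda>x. s n x + t * v x)" by (intro m_le S(3,4) v s(1))
          then show "0 \<le> J (s n) - m + 2 * t * (frm l (s n) v - L v) + t\<^sup>2 * frm l v v"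
            by (simp add: J_expand s(1) v)
        qed (use l SF[OF v] frm_nonneg in auto)
        also have "\<dots> \<le> (1 / (real n + 1)) * frm l v v"
          using s(2)[of n] frm_nonneg[OF SF[OF v], of l] l by (intro mult_right_mono) auto
        finally show ?thesis by (metis real_sqrt_abs real_sqrt_le_mono)
      qed
      then show "\<forall>\<^sub>F n in sequentially. norm (frm l (s n) v - L v) \<le> sqrt (1 / (real n + 1) * frm l v v)"
        by simp
      have "(\<lambda>n. 1 / (real n + 1)) \<longlonglongrightarrow> 0"
        using LIMSEQ_inverse_real_of_nat by (simp add: inverse_eq_divide add.commute)
      from tendsto_real_sqrt[OF tendsto_mult_right[OF this, of "frm l v v"]]
      show "(\<lambda>n. sqrt (1 / (real n + 1) * frm l v v)) \<longlonglongrightarrow> 0" by simp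
    qed
    then show "(\<lambda>n. frm l (s n) v) \<longlonglongrightarrow> L v" by (simp add: LIM_zero_iff)
  qed
  with that p(1) s(1) lim show ?thesis by blast
qed

section \<open>Resolvents as weak solutions, determined only up to null sets\<close>

definition is_resolvent :: "real \<Rightarrow> ('a \<Rightarrow> real) \<Rightarrow> ('a \<Rightarrow> real) \<Rightarrow> bool" where
  "is_resolvent l f w \<longleftrightarrow> w \<in> \<F> \<and> (\<forall>v\<in>\<F>. frm l w v = ip f v)"

lemma resolvent_exists:
  assumes "f \<in> L2 \<mu>" "0 < l"
  obtains w where "is_resolvent l f w"
proof -
  have bound: "\<bar>ip f u\<bar> \<le> nrm f / sqrt l * sqrt (frm l u u)" if u: "u \<in> \<F>" for u
  proof -
    have "l * ip u u \<le> frm l u u" by (simp add: frm_def form_nonneg u)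
    then have "sqrt l * nrm u \<le> sqrt (frm l u u)"
      by (simp add: L2_norm_def flip: real_sqrt_mult)
    then have "nrm u \<le> sqrt (frm l u u) / sqrt l" using assms(2) by (simp add: field_simps)
    from mult_left_mono[OF this, of "nrm f"] L2_inner_Cauchy_Schwarz[OF assms(1) F_L2[OF u]]
    show ?thesis by simp
  qed
  obtain p where "p \<in> \<F>" "\<And>v. v \<in> \<F> \<Longrightarrow> frm l p v = ip f v"
  proof (rule Riesz[of \<F> "ip f" "nrm f / sqrt l" l])
    show "\<bar>ip f u\<bar> \<le> nrm f / sqrt l * sqrt (frm l u u)" if "u \<in> \<F>" for u by (rule bound) fact
  qed (use assms in \<open>auto simp: F_intros L2_inner_simps F_L2\<close>)
  with that show ?thesis by (auto simp: is_resolvent_def)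
qed

lemma resolvent_symmetric:
  assumes "is_resolvent l f w" "is_resolvent l g z"
  shows "ip f z = ip w g"
  using assms frm_sym[of w z l] L2_inner_commute[of \<mu> w g] by (metis is_resolvent_def)

text \<open>
  The resolvent images form a dense subspace on which \<open>\<lambda>u. form1 \<mu> \<E> u s\<close> is continuous for the
  \<open>L2\<close> norm; by density, boundedness of the form along an \<open>L2\<close> convergent sequence yields weak
  convergence in \<open>\<F>\<close>.
\<close>

definition gens :: "('a \<Rightarrow> real) set" where
  "gens = {s. \<exists>g\<in>L2 \<mu>. is_resolvent 1 g s}"

lemma gens_F: "gens \<subseteq> \<F>"
  by (auto simp: gens_def is_resolvent_def)

lemma gens_zero: "(\<lambda>x. 0) \<in> gens"
  unfolding gens_def is_resolvent_def
  by (auto intro!: bexI[of _ "\<lambda>x. 0"] simp: domain_zero frm_def form_zero L2_inner_def)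

lemma gens_add: "u \<in> gens \<Longrightarrow> v \<in> gens \<Longrightarrow> (\<lambda>x. u x + v x) \<in> gens"
proof -
  assume "u \<in> gens" "v \<in> gens"
  then obtain f g where *: "f \<in> L2 \<mu>" "g \<in> L2 \<mu>" "is_resolvent 1 f u" "is_resolvent 1 g v"
    by (auto simp: gens_def)
  then have "is_resolvent 1 (\<lambda>x. f x + g x) (\<lambda>x. u x + v x)"
    unfolding is_resolvent_def
    by (auto simp: domain_add frm_def form_add L2_inner_simps F_L2 algebra_simps)
  with * show ?thesis unfolding gens_def by (auto intro!: bexI[of _ "\<lambda>x. f x + g x"] simp: L2_add)
qed

lemma gens_scale: "u \<in> gens \<Longrightarrow> (\<lambda>x. c * u x) \<in> gens"
proof -
  assume "u \<in> gens"
  then obtain f where *: "f \<in> L2 \<mu>" "is_resolvent 1 f u"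
    by (auto simp: gens_def)
  then have "is_resolvent 1 (\<lambda>x. c * f x) (\<lambda>x. c * u x)"
    unfolding is_resolvent_def
    by (auto simp: domain_scale frm_def form_scale L2_inner_simps F_L2 simp flip: distrib_left)
  with * show ?thesis unfolding gens_def by (auto intro!: bexI[of _ "\<lambda>x. c * f x"] simp: L2_scale)
qed

text \<open>Testing with the resolvent of p - u itself gives zero norm of p - u. This identifies a
  Riesz vector with a function known beforehand only to be square integrable.\<close>

lemma L2_orthogonal_gens:
  assumes "u \<in> L2 \<mu>" "p \<in> \<F>" "\<And>g s. g \<in> L2 \<mu> \<Longrightarrow> is_resolvent 1 g s \<Longrightarrow> frm 1 p s = ip g u"
  shows "AE x in \<mu>. p x = u x"
proof -
  let ?g = "\<lambda>x. p x - u x"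
  have g: "?g \<in> L2 \<mu>" using assms by (auto intro: L2_diff)
  obtain s where s: "is_resolvent 1 ?g s" using resolvent_exists[OF g, of 1] by auto
  have "ip ?g p = ip ?g u"
    using assms(3)[OF g s] s assms(2) frm_sym[of p s 1] by (auto simp: is_resolvent_def)
  then have "ip ?g ?g = 0" using g assms by (subst L2_inner_diff_right) auto
  from L2_inner_self_eq_0D[OF g this] show ?thesis by eventually_elim simp
qed

text \<open>Riesz on \<open>gens\<close> produces the projection p of u onto its closure. Both have
  the same pairings with \<open>gens\<close>, hence agree almost everywhere, and the sequence
  approaching p approaches u.\<close>

lemma gens_dense:
  assumes "u \<in> \<F>" "e > 0"
  obtains s where "s \<in> gens" "frm 1 (\<lambda>x. s x - u x) (\<lambda>x. s x - u x) < e"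
proof -
  obtain p s where p: "p \<in> \<F>" "\<And>n::nat. s n \<in> gens"
    "(\<lambda>n. frm 1 (\<lambda>x. s n x - p x) (\<lambda>x. s n x - p x)) \<longlonglongrightarrow> 0"
    "\<And>v. v \<in> gens \<Longrightarrow> frm 1 p v = frm 1 u v"
  proof (rule Riesz[of gens "frm 1 u" "sqrt (frm 1 u u)" 1])
    show "frm 1 u (\<lambda>x. v x + w x) = frm 1 u v + frm 1 u w" if "v \<in> gens" "w \<in> gens" for v w
    proof -
      have "v \<in> \<F>" "w \<in> \<F>" using that gens_F by auto
      with assms show ?thesis by (simp add: frm_def form_simps L2_inner_simps F_L2)
    qed
    show "frm 1 u (\<lambda>x. c * v x) = c * frm 1 u v" if "v \<in> gens" for v c
    proof -
      have "v \<in> \<F>" using that gens_F by auto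
      with assms show ?thesis by (simp add: frm_def form_simps L2_inner_simps F_L2 algebra_simps)
    qed
  qed (use assms gens_F gens_zero gens_add gens_scale in \<open>auto intro: frm_Cauchy_Schwarz\<close>)
  have "AE x in \<mu>. p x = u x"
  proof (rule L2_orthogonal_gens)
    fix g s assume "g \<in> L2 \<mu>" "is_resolvent 1 g s"
    then show "frm 1 p s = ip g u"
      using p(4)[of s] frm_sym[of u s 1] assms(1) by (auto simp: gens_def is_resolvent_def)
  qed (use assms p in auto)
  then have "frm 1 (\<lambda>x. s n x - p x) (\<lambda>x. s n x - p x) = frm 1 (\<lambda>x. s n x - u x) (\<lambda>x. s n x - u x)" for n
  proof -
    have F: "s n \<in> \<F>" using p(2) gens_F by blast
    have ae: "AE x in \<mu>. s n x - p x = s n x - u x"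
      using \<open>AE x in \<mu>. p x = u x\<close> by eventually_elim simp
    show ?thesis unfolding frm_def
      using form_cong_both[OF _ _ _ _ ae ae] L2_norm_cong[OF _ _ ae] F assms(1) p(1)
      by (auto simp: F_diff F_measurable simp flip: L2_norm_square)
  qed
  with p(3) have "(\<lambda>n. frm 1 (\<lambda>x. s n x - u x) (\<lambda>x. s n x - u x)) \<longlonglongrightarrow> 0" by simp
  from order_tendstoD(2)[OF this assms(2)] obtain n
    where "frm 1 (\<lambda>x. s n x - u x) (\<lambda>x. s n x - u x) < e" by (auto dest: eventually_happens)
  with p(2) that show ?thesis by blast
qed

section \<open>Weak convergence in the form domain\<close>

text \<open>No weak compactness is invoked. Against a resolvent image, \<open>frm 1 (U n)\<close> is
  an \<open>L2\<close> pairing and so converges; the energy bound makes the limit a bounded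
  functional on \<open>gens\<close>, and its Riesz vector is u.\<close>

lemma bounded_form_limit:
  assumes U: "\<And>n::nat. U n \<in> \<F>" "\<And>n. \<E> (U n) (U n) \<le> C"
    and u: "u \<in> L2 \<mu>" and lim: "(\<lambda>n. nrm (\<lambda>x. U n x - u x)) \<longlonglongrightarrow> 0"
  shows "u \<in> \<F>"
proof -
  have ULs: "U n \<in> L2 \<mu>" for n using U(1) by auto
  have conv: "(\<lambda>n. frm 1 (U n) s) \<longlonglongrightarrow> ip g u" if "g \<in> L2 \<mu>" "is_resolvent 1 g s" for g s
  proof -
    have "frm 1 (U n) s = ip (U n) g" for n
      using that U(1)[of n] frm_sym[of "U n" s 1] by (auto simp: is_resolvent_def L2_inner_commute)
    with L2_inner_tendsto[OF ULs u that(1) lim] show ?thesis by (simp add: L2_inner_commute)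
  qed
  define L where "L s = Topological_Spaces.lim (\<lambda>n. frm 1 (U n) s)" for s
  have L: "(\<lambda>n. frm 1 (U n) s) \<longlonglongrightarrow> L s" if "s \<in> gens" for s
    using that conv unfolding gens_def L_def by (auto intro: convergent_LIMSEQ_iff[THEN iffD1] convergentI)
  have "Bseq (\<lambda>n. nrm (\<lambda>x. U n x - u x))" using lim by (rule convergent_imp_Bseq[OF convergentI])
  then obtain D where D: "\<And>n. nrm (\<lambda>x. U n x - u x) \<le> D" by (auto simp: Bseq_def)
  have nU: "nrm (U n) \<le> D + nrm u" for n
    using L2_norm_triangle[OF L2_diff[OF ULs u] u, of n] D[of n] by simp
  have fU: "frm 1 (U n) (U n) \<le> C + (D + nrm u)\<^sup>2" for n
    using U(2)[of n] power_mono[OF nU[of n], of 2] by (simp add: frm_def L2_norm_square)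
  obtain p where p: "p \<in> \<F>" "\<And>v. v \<in> gens \<Longrightarrow> frm 1 p v = L v"
  proof (rule Riesz[of gens L "sqrt (C + (D + nrm u)\<^sup>2)" 1])
    show "L (\<lambda>x. v x + w x) = L v + L w" if "v \<in> gens" "w \<in> gens" for v w
    proof (rule LIMSEQ_unique)
      have "v \<in> \<F>" "w \<in> \<F>" using that gens_F by auto
      then have "frm 1 (U n) (\<lambda>x. v x + w x) = frm 1 (U n) v + frm 1 (U n) w" for n
        using U(1) by (simp add: frm_def form_simps L2_inner_simps F_L2)
      with tendsto_add[OF L[OF that(1)] L[OF that(2)]]
      show "(\<lambda>n. frm 1 (U n) (\<lambda>x. v x + w x)) \<longlonglongrightarrow> L v + L w" by simp
    qed (intro L gens_add that)
    show "L (\<lambda>x. c * v x) = c * L v" if "v \<in> gens" for v c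
    proof (rule LIMSEQ_unique)
      have "v \<in> \<F>" using that gens_F by auto
      then have "frm 1 (U n) (\<lambda>x. c * v x) = c * frm 1 (U n) v" for n
        using U(1) by (simp add: frm_def form_simps L2_inner_simps F_L2 algebra_simps)
      with tendsto_mult_left[OF L[OF that(1)], of c]
      show "(\<lambda>n. frm 1 (U n) (\<lambda>x. c * v x)) \<longlonglongrightarrow> c * L v" by simp
    qed (intro L gens_scale that)
    show "\<bar>L v\<bar> \<le> sqrt (C + (D + nrm u)\<^sup>2) * sqrt (frm 1 v v)" if "v \<in> gens" for v
    proof (rule tendsto_upperbound[OF tendsto_rabs[OF L[OF that]]], rule always_eventually, rule allI)
      fix n
      have v: "v \<in> \<F>" using that gens_F by auto
      have "\<bar>frm 1 (U n) v\<bar> \<le> sqrt (frm 1 (U n) (U n)) * sqrt (frm 1 v v)"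
        by (rule frm_Cauchy_Schwarz) (use U v in auto)
      also have "\<dots> \<le> sqrt (C + (D + nrm u)\<^sup>2) * sqrt (frm 1 v v)"
        using fU v by (intro mult_right_mono real_sqrt_le_mono) (auto simp: frm_nonneg)
      finally show "\<bar>frm 1 (U n) v\<bar> \<le> sqrt (C + (D + nrm u)\<^sup>2) * sqrt (frm 1 v v)" .
    qed simp
  qed (use gens_F gens_zero gens_add gens_scale in auto)
  have "AE x in \<mu>. p x = u x"
  proof (rule L2_orthogonal_gens[OF u p(1)])
    fix g s assume *: "g \<in> L2 \<mu>" "is_resolvent 1 g s"
    then have "s \<in> gens" by (auto simp: gens_def)
    with p(2)[of s] LIMSEQ_unique[OF L[of s] conv[OF *]] show "frm 1 p s = ip g u" by simp
  qed
  with p(1) u show ?thesis by (auto intro: domain_cong)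
qed

text \<open>Write L as \<open>frm 1 p\<close> and approximate p by some s in \<open>gens\<close>:
  the part with s is an \<open>L2\<close> pairing, the rest is small uniformly in n. A general L is
  allowed because the chain rule applies it to integrals of \<Gamma> against a fixed bounded
  function.\<close>

lemma weak_convergence:
  assumes U: "\<And>n::nat. U n \<in> \<F>" "\<And>n. \<E> (U n) (U n) \<le> C"
    and u: "u \<in> L2 \<mu>" and lim: "(\<lambda>n. nrm (\<lambda>x. U n x - u x)) \<longlonglongrightarrow> 0"
    and L: "\<And>u v. u \<in> \<F> \<Longrightarrow> v \<in> \<F> \<Longrightarrow> L (\<lambda>x. u x + v x) = L u + L v"
    "\<And>c u. u \<in> \<F> \<Longrightarrow> L (\<lambda>x. c * u x) = c * L u"
    "\<And>u. u \<in> \<F> \<Longrightarrow> \<bar>L u\<bar> \<le> D * sqrt (frm 1 u u)"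
  shows "(\<lambda>n. L (U n)) \<longlonglongrightarrow> L u"
proof -
  have uF: "u \<in> \<F>" by (rule bounded_form_limit) fact+
  obtain p where p: "p \<in> \<F>" "\<And>v. v \<in> \<F> \<Longrightarrow> frm 1 p v = L v"
    by (rule Riesz[of \<F> L D 1]) (use L in \<open>auto simp: F_intros\<close>)
  have ULs: "U n \<in> L2 \<mu>" for n using U(1) by auto
  have "Bseq (\<lambda>n. nrm (\<lambda>x. U n x - u x))" using lim by (rule convergent_imp_Bseq[OF convergentI])
  then obtain K where K: "\<And>n. nrm (\<lambda>x. U n x - u x) \<le> K" by (auto simp: Bseq_def)
  let ?d = "\<lambda>n x. U n x - u x"
  define A where "A = 2 * C + 2 * \<E> u u + K\<^sup>2 + 1"
  have A: "frm 1 (?d n) (?d n) \<le> A" for n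
  proof -
    \<comment> \<open>Parallelogram bound: the energy of a difference is at most twice the sum of
      the energies.\<close>
    have "0 \<le> \<E> (\<lambda>x. U n x + 1 * u x) (\<lambda>x. U n x + 1 * u x)"
      by (intro form_nonneg F_intros U uF)
    then have "\<E> (?d n) (?d n) \<le> 2 * \<E> (U n) (U n) + 2 * \<E> u u"
      using form_expand[OF U(1) uF, of n 1] form_expand[OF U(1) uF, of n "-1"] by simp
    moreover have "ip (?d n) (?d n) \<le> K\<^sup>2"
      using power_mono[OF K[of n], of 2] by (simp add: L2_norm_square)
    ultimately show ?thesis using U(2)[of n] by (simp add: frm_def A_def)
  qed
  have A1: "A > 0"
  proof -
    have "0 \<le> C" using U(2)[of 0] form_nonneg[OF U(1)[of 0]] by linarith
    then show ?thesis using form_nonneg[OF uF] unfolding A_def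
      by (smt (verit) zero_le_power2)
  qed
  have "(\<lambda>n. L (U n) - L u) \<longlonglongrightarrow> 0"
  proof (rule LIMSEQ_I)
    fix e :: real assume e: "e > 0"
    obtain s where s: "s \<in> gens" "frm 1 (\<lambda>x. s x - p x) (\<lambda>x. s x - p x) < (e / 2)\<^sup>2 / A"
      using gens_dense[OF p(1), of "(e / 2)\<^sup>2 / A"] e A1 by auto
    obtain g where g: "g \<in> L2 \<mu>" "is_resolvent 1 g s" using s(1) by (auto simp: gens_def)
    have sF: "s \<in> \<F>" using s gens_F by auto
    have "(\<lambda>n. ip (U n) g - ip u g) \<longlonglongrightarrow> 0"
      using L2_inner_tendsto[OF ULs u g(1) lim] by (simp add: LIM_zero_iff)
    from LIMSEQ_D[OF this, of "e/2"] e obtain N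
      where N: "\<And>n. n \<ge> N \<Longrightarrow> \<bar>ip (U n) g - ip u g\<bar> < e / 2" by auto
    have "\<bar>L (U n) - L u\<bar> < e" if "n \<ge> N" for n
    proof -
      have dF: "?d n \<in> \<F>" using U uF by (auto intro: F_diff)
      have "L (U n) - L u = frm 1 p (U n) - frm 1 p u" using p U uF by simp
      also have "\<dots> = frm 1 p (?d n)" using p U uF dF by (simp add: frm_sym[of p] frm_diff_left)
      also have "\<dots> = frm 1 s (?d n) - frm 1 (\<lambda>x. s x - p x) (?d n)"
        using p sF dF by (simp add: frm_diff_left)
      finally have 1: "L (U n) - L u = frm 1 s (?d n) - frm 1 (\<lambda>x. s x - p x) (?d n)" .
      have "frm 1 s (?d n) = ip g (?d n)" using g dF by (auto simp: is_resolvent_def)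
      also have "\<dots> = ip (U n) g - ip u g"
        using g u ULs by (simp add: L2_inner_simps L2_inner_commute[of \<mu> g])
      finally have 2: "\<bar>frm 1 s (?d n)\<bar> < e / 2" using N[OF that] by simp
      have "\<bar>frm 1 (\<lambda>x. s x - p x) (?d n)\<bar> \<le>
          sqrt (frm 1 (\<lambda>x. s x - p x) (\<lambda>x. s x - p x)) * sqrt (frm 1 (?d n) (?d n))"
        by (rule frm_Cauchy_Schwarz) (use sF p dF F_diff in auto)
      also have "\<dots> \<le> sqrt ((e / 2)\<^sup>2 / A) * sqrt A"
        using s A[of n] dF sF p by (intro mult_mono real_sqrt_le_mono)
          (use A1 in \<open>auto simp: frm_nonneg F_diff\<close>)
      also have "\<dots> = e / 2" using A1 e by (simp add: real_sqrt_divide)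
      finally show ?thesis using 1 2 by linarith
    qed
    then show "\<exists>N. \<forall>n\<ge>N. norm (L (U n) - L u - 0) < e" by auto
  qed
  then show ?thesis by (simp add: LIM_zero_iff)
qed

lemma sqrt_form_le_frm: "u \<in> \<F> \<Longrightarrow> sqrt (\<E> u u) \<le> sqrt (frm 1 u u)"
  by (simp add: frm_def L2_inner_self_nonneg)

lemma form_tendsto_of_bounded:
  assumes U: "\<And>n::nat. U n \<in> \<F>" "\<And>n. \<E> (U n) (U n) \<le> C"
    and u: "u \<in> L2 \<mu>" and lim: "(\<lambda>n. nrm (\<lambda>x. U n x - u x)) \<longlonglongrightarrow> 0"
    and v: "v \<in> \<F>"
  shows "(\<lambda>n. \<E> (U n) v) \<longlonglongrightarrow> \<E> u v"
proof (rule weak_convergence[OF U u lim, where L = "\<lambda>u. \<E> u v" and D = "sqrt (\<E> v v)"])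
  fix u assume u: "u \<in> \<F>"
  have "\<bar>\<E> u v\<bar> \<le> sqrt (\<E> u u) * sqrt (\<E> v v)" by (rule form_Cauchy_Schwarz) fact+
  also have "\<dots> \<le> sqrt (frm 1 u u) * sqrt (\<E> v v)"
    by (intro mult_right_mono sqrt_form_le_frm u) (simp add: form_nonneg v)
  finally show "\<bar>\<E> u v\<bar> \<le> sqrt (\<E> v v) * sqrt (frm 1 u u)" by (simp add: mult.commute)
qed (use v in \<open>auto simp: form_simps\<close>)

text \<open>Weak convergence tested against u itself, with Cauchy-Schwarz before the limit.\<close>

lemma form_lower_semicontinuous:
  assumes U: "\<And>n::nat. U n \<in> \<F>" "\<And>n. \<E> (U n) (U n) \<le> C"
    and u: "u \<in> L2 \<mu>" and lim: "(\<lambda>n. nrm (\<lambda>x. U n x - u x)) \<longlonglongrightarrow> 0"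
  shows "\<E> u u \<le> C"
proof -
  have uF: "u \<in> \<F>" by (rule bounded_form_limit) fact+
  have C: "C \<ge> 0" using U(2)[of 0] form_nonneg[OF U(1)[of 0]] by linarith
  have "\<E> u u \<le> sqrt C * sqrt (\<E> u u)"
  proof (rule tendsto_upperbound[OF form_tendsto_of_bounded[OF U u lim uF]],
      rule always_eventually, rule allI)
    fix n
    have "\<E> (U n) u \<le> sqrt (\<E> (U n) (U n)) * sqrt (\<E> u u)"
      using form_Cauchy_Schwarz[OF U(1) uF, of n] by linarith
    also have "\<dots> \<le> sqrt C * sqrt (\<E> u u)"
      by (intro mult_right_mono real_sqrt_le_mono U) (simp add: form_nonneg uF)
    finally show "\<E> (U n) u \<le> sqrt C * sqrt (\<E> u u)" .
  qed simp
  then have "sqrt (\<E> u u) * sqrt (\<E> u u) \<le> sqrt C * sqrt (\<E> u u)"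
    by (simp add: form_nonneg uF)
  then have "sqrt (\<E> u u) \<le> sqrt C \<or> sqrt (\<E> u u) = 0"
    by (metis form_nonneg mult_le_cancel_right not_less_iff_gr_or_eq real_sqrt_ge_0_iff uF not_less)
  then show ?thesis using C by auto
qed

text \<open>Weak convergence becomes strong when no energy exceeds that of the limit: expanding the
  square then leaves at most 2 (\<open>\<E> u u\<close> - \<open>\<E> (U n) u\<close>).\<close>

lemma strong_convergence:
  assumes U: "\<And>n::nat. U n \<in> \<F>" "\<And>n. \<E> (U n) (U n) \<le> \<E> u u"
    and u: "u \<in> \<F>" and lim: "(\<lambda>n. nrm (\<lambda>x. U n x - u x)) \<longlonglongrightarrow> 0"
  shows "(\<lambda>n. \<E> (\<lambda>x. u x - U n x) (\<lambda>x. u x - U n x)) \<longlonglongrightarrow> 0"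
proof (rule tendsto_sandwich)
  show "\<forall>\<^sub>F n in sequentially. 0 \<le> \<E> (\<lambda>x. u x - U n x) (\<lambda>x. u x - U n x)"
    by (intro always_eventually allI form_nonneg F_diff U u)
  show "\<forall>\<^sub>F n in sequentially. \<E> (\<lambda>x. u x - U n x) (\<lambda>x. u x - U n x) \<le> 2 * (\<E> u u - \<E> (U n) u)"
  proof (rule always_eventually, rule allI)
    fix n
    show "\<E> (\<lambda>x. u x - U n x) (\<lambda>x. u x - U n x) \<le> 2 * (\<E> u u - \<E> (U n) u)"
      using form_expand[OF u U(1)[of n], of "-1"] U(2)[of n] form_sym[OF u U(1), of n] by simp
  qed
  have "(\<lambda>n. \<E> u u - \<E> (U n) u) \<longlonglongrightarrow> \<E> u u - \<E> u u"
    by (intro tendsto_intros form_tendsto_of_bounded[OF U(1,2) F_L2[OF u] lim u])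
  from tendsto_mult_left[OF this, of 2] show "(\<lambda>n. 2 * (\<E> u u - \<E> (U n) u)) \<longlonglongrightarrow> 0" by simp
qed simp

end

section \<open>Contraction properties of the form\<close>

context dirichlet_form
begin

lemma form_scale_both: "u \<in> \<F> \<Longrightarrow> \<E> (\<lambda>x. c * u x) (\<lambda>x. c * u x) = c\<^sup>2 * \<E> u u"
  by (simp add: form_simps power2_eq_square)

lemma F_cut:
  assumes "u \<in> \<F>" "0 < c"
  shows "(\<lambda>x. min (max (u x) 0) c) \<in> \<F>"
    and "\<E> (\<lambda>x. min (max (u x) 0) c) (\<lambda>x. min (max (u x) 0) c) \<le> \<E> u u"
proof -
  let ?v = "\<lambda>x. min (max (1 / c * u x) 0) 1"
  have *: "(\<lambda>x. min (max (u x) 0) c) = (\<lambda>x. c * ?v x)"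
    using assms(2) by (auto simp: fun_eq_iff min_def max_def field_simps zero_le_divide_iff)
  have v: "?v \<in> \<F>" "\<E> ?v ?v \<le> \<E> (\<lambda>x. 1 / c * u x) (\<lambda>x. 1 / c * u x)"
    using form_markov[OF domain_scale[OF assms(1)], of "1 / c"] by auto
  show "(\<lambda>x. min (max (u x) 0) c) \<in> \<F>" unfolding * by (intro domain_scale v)
  have "\<E> (\<lambda>x. c * ?v x) (\<lambda>x. c * ?v x) \<le> c\<^sup>2 * ((1 / c)\<^sup>2 * \<E> u u)"
    using v(2) by (simp only: form_scale_both v(1) assms(1) mult_left_mono zero_le_power2)
  also have "\<dots> = \<E> u u" using assms(2) by (simp add: power2_eq_square)
  finally show "\<E> (\<lambda>x. min (max (u x) 0) c) (\<lambda>x. min (max (u x) 0) c) \<le> \<E> u u" unfolding * .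
qed

lemma cut_tendsto_pos_part:
  assumes "u \<in> L2 \<mu>"
  shows "(\<lambda>n. nrm (\<lambda>x. min (max (u x) 0) (real n + 1) - max (u x) 0)) \<longlonglongrightarrow> 0"
proof (rule L2_dominated_convergence[where g = "\<lambda>x. \<bar>u x\<bar>"])
  show "(\<lambda>x. \<bar>u x\<bar>) \<in> L2 \<mu>"
    by (rule L2_bound[OF assms]) (use assms in auto)
  show "AE x in \<mu>. (\<lambda>n. min (max (u x) 0) (real n + 1)) \<longlonglongrightarrow> max (u x) 0"
  proof (rule AE_I2)
    fix x
    obtain N :: nat where N: "\<bar>u x\<bar> < real N" using reals_Archimedean2 by blast
    have "\<forall>\<^sub>F n in sequentially. min (max (u x) 0) (real n + 1) = max (u x) 0"
      using eventually_ge_at_top[of N] by eventually_elim (use N in auto)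
    then show "(\<lambda>n. min (max (u x) 0) (real n + 1)) \<longlonglongrightarrow> max (u x) 0"
      by (rule tendsto_eventually)
  qed
qed (use assms in \<open>auto simp: min_def max_def intro!: AE_I2\<close>)

text \<open>The axiom only covers cuts from both sides. The positive part is the \<open>L2\<close>
  limit of cuts at levels n + 1, whose energies stay below \<open>\<E> u u\<close>.\<close>

lemma F_pos_part:
  assumes "u \<in> \<F>"
  shows "(\<lambda>x. max (u x) 0) \<in> \<F>" "\<E> (\<lambda>x. max (u x) 0) (\<lambda>x. max (u x) 0) \<le> \<E> u u"
proof -
  let ?U = "\<lambda>n::nat. \<lambda>x. min (max (u x) 0) (real n + 1)"
  have U: "?U n \<in> \<F>" "\<E> (?U n) (?U n) \<le> \<E> u u" for n
    by (auto intro!: F_cut assms)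
  have L: "(\<lambda>x. max (u x) 0) \<in> L2 \<mu>"
    by (rule L2_bound[of u]) (use assms in auto)
  note lim = cut_tendsto_pos_part[OF F_L2[OF assms]]
  show "(\<lambda>x. max (u x) 0) \<in> \<F>" by (rule bounded_form_limit[OF U L lim])
  show "\<E> (\<lambda>x. max (u x) 0) (\<lambda>x. max (u x) 0) \<le> \<E> u u"
    by (rule form_lower_semicontinuous[OF U L lim])
qed

lemma F_neg_part: "u \<in> \<F> \<Longrightarrow> (\<lambda>x. max (- u x) 0) \<in> \<F>"
  using F_pos_part(1)[OF F_minus] .

lemma F_trunc:
  assumes "u \<in> \<F>" "\<And>x. 0 \<le> u x" "0 \<le> c"
  shows "(\<lambda>x. min (u x) c) \<in> \<F>" "\<E> (\<lambda>x. min (u x) c) (\<lambda>x. min (u x) c) \<le> \<E> u u"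
proof -
  have "(\<lambda>x. min (u x) c) \<in> \<F> \<and> \<E> (\<lambda>x. min (u x) c) (\<lambda>x. min (u x) c) \<le> \<E> u u"
  proof (cases "c = 0")
    case True
    then have "(\<lambda>x. min (u x) c) = (\<lambda>x. 0)" using assms(2) by (auto simp: min_absorb2 fun_eq_iff)
    then show ?thesis by (simp add: domain_zero form_zero form_nonneg assms(1))
  next
    case False
    then show ?thesis using F_cut[OF assms(1), of c] assms(2,3) by (simp add: max_absorb1)
  qed
  then show "(\<lambda>x. min (u x) c) \<in> \<F>" "\<E> (\<lambda>x. min (u x) c) (\<lambda>x. min (u x) c) \<le> \<E> u u" by auto
qed

text \<open>2 \<open>\<E> p q\<close> is the one-sided derivative at s = 0 of the energy of p + s q.
  This converts a contraction property into the sign of a mutual energy.\<close>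

lemma form_nonneg_of_expanding:
  assumes "p \<in> \<F>" "q \<in> \<F>" "\<And>s. 0 < s \<Longrightarrow> \<E> p p \<le> \<E> (\<lambda>x. p x + s * q x) (\<lambda>x. p x + s * q x)"
  shows "0 \<le> \<E> p q"
proof (rule ccontr)
  assume neg: "\<not> 0 \<le> \<E> p q"
  \<comment> \<open>The added 1 avoids division by zero, and s times \<open>\<E> q q\<close> stays
    below - \<open>\<E> p q\<close>, so the linear term dominates.\<close>
  define s where "s = - \<E> p q / (\<E> q q + 1)"
  have q: "\<E> q q + 1 > 0" using form_nonneg[OF assms(2)] by simp
  have s: "s > 0" using neg q unfolding s_def by (intro divide_pos_pos) auto
  have "0 \<le> s * (2 * \<E> p q + s * \<E> q q)"
    using assms(3)[OF s] by (simp add: form_expand assms power2_eq_square algebra_simps)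
  then have "0 \<le> 2 * \<E> p q + s * \<E> q q" using s by (simp add: zero_le_mult_iff)
  moreover have "s * \<E> q q \<le> s * (\<E> q q + 1)" using s by simp
  moreover have "s * (\<E> q q + 1) = - \<E> p q" using q by (simp add: s_def)
  ultimately show False using neg by linarith
qed

text \<open>For every s > 0 the positive part of u is also the positive part of p - s q, so
  subtracting s q cannot lower the energy.\<close>

lemma form_pos_neg_part:
  assumes "u \<in> \<F>"
  shows "\<E> (\<lambda>x. max (u x) 0) (\<lambda>x. max (- u x) 0) \<le> 0"
proof -
  let ?p = "\<lambda>x. max (u x) 0" and ?q = "\<lambda>x. max (- u x) 0"
  have F: "?p \<in> \<F>" "?q \<in> \<F>" by (intro F_pos_part F_neg_part assms)+
  have "0 \<le> \<E> ?p (\<lambda>x. - ?q x)"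
  proof (rule form_nonneg_of_expanding)
    fix s :: real assume s: "s > 0"
    have "?p = (\<lambda>x. max (?p x + s * - ?q x) 0)"
      using s by (auto simp: fun_eq_iff max_def mult_le_0_iff)
    then show "\<E> ?p ?p \<le> \<E> (\<lambda>x. ?p x + s * - ?q x) (\<lambda>x. ?p x + s * - ?q x)"
      using F_pos_part(2)[of "\<lambda>x. ?p x + s * - ?q x"] F by (simp only: F_intros)
  qed (use F in \<open>auto intro: F_minus\<close>)
  then show ?thesis using F by (simp add: form_simps)
qed

lemma form_disjoint:
  assumes "p \<in> \<F>" "q \<in> \<F>" "\<And>x. 0 \<le> p x" "\<And>x. 0 \<le> q x" "\<And>x. p x = 0 \<or> q x = 0"
  shows "\<E> p q \<le> 0"
proof -
  have "(\<lambda>x. max (p x - q x) 0) = p" "(\<lambda>x. max (- (p x - q x)) 0) = q"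
    using assms(3-5) by (auto simp: fun_eq_iff max_def)
      (metis add.inverse_inverse diff_0 diff_0_right diff_ge_0_iff_ge order_antisym)+
  then show ?thesis using form_pos_neg_part[OF F_diff[OF assms(1,2)]] by simp
qed

text \<open>Since q lives where p already equals c, truncating p + s q at c returns p. This sign
  drives both the maximum principle and the estimate of the level pieces below.\<close>

lemma form_saturated:
  assumes "p \<in> \<F>" "q \<in> \<F>" "\<And>x. 0 \<le> p x" "\<And>x. p x \<le> c" "\<And>x. 0 \<le> q x"
    "\<And>x. q x = 0 \<or> p x = c" "0 \<le> c"
  shows "0 \<le> \<E> p q"
proof (rule form_nonneg_of_expanding[OF assms(1,2)])
  fix s :: real assume s: "s > 0"
  have nn: "0 \<le> p x + s * q x" for x using s assms(3,5) by (simp add: add_nonneg_nonneg)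
  have "(\<lambda>x. min (p x + s * q x) c) = p"
  proof
    fix x
    show "min (p x + s * q x) c = p x"
      using assms(6)[of x] assms(4)[of x] mult_nonneg_nonneg[of s "q x"] assms(5)[of x] s
      by (auto intro: min_absorb1 min_absorb2)
  qed
  then show "\<E> p p \<le> \<E> (\<lambda>x. p x + s * q x) (\<lambda>x. p x + s * q x)"
    using F_trunc(2)[of "\<lambda>x. p x + s * q x" c] nn assms by (simp add: F_intros)
qed

text \<open>Split u into the part below c, the excess and the negative part. The excess is saturated
  with respect to the first, disjoint from the last, and has nonnegative energy with itself.\<close>

lemma form_excess:
  assumes "u \<in> \<F>" "0 \<le> c"
  shows "(\<lambda>x. max (u x - c) 0) \<in> \<F>" "0 \<le> \<E> u (\<lambda>x. max (u x - c) 0)"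
proof -
  let ?p = "\<lambda>x. max (u x) 0" and ?q = "\<lambda>x. max (- u x) 0" and ?m = "\<lambda>x. min (max (u x) 0) c"
  let ?e = "\<lambda>x. max (u x - c) 0"
  have F: "?p \<in> \<F>" "?q \<in> \<F>" "?m \<in> \<F>"
    using assms by (intro F_pos_part F_neg_part F_trunc; simp)+
  have e: "?e = (\<lambda>x. ?p x - ?m x)" using assms(2) by (auto simp: fun_eq_iff max_def min_def)
  show eF: "?e \<in> \<F>" unfolding e by (intro F_diff F)
  have "u = (\<lambda>x. ?m x + ?e x - ?q x)" using assms(2) by (auto simp: fun_eq_iff max_def min_def)
  then have "\<E> u ?e = \<E> (\<lambda>x. ?m x + ?e x - ?q x) ?e" by simp
  also have "\<dots> = \<E> ?m ?e + \<E> ?e ?e - \<E> ?q ?e"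
    using F eF by (simp add: form_simps)
  also have "\<dots> \<ge> 0"
  proof -
    have "0 \<le> \<E> ?m ?e" by (rule form_saturated[of _ _ c]) (use F eF assms in auto)
    moreover have "\<E> ?q ?e \<le> 0" by (rule form_disjoint) (use F eF assms in auto)
    ultimately show ?thesis using form_nonneg[OF eF] by linarith
  qed
  finally show "0 \<le> \<E> u ?e" .
qed

section \<open>Maximum principle and approximation by resolvents\<close>

text \<open>Weak maximum principle: test the equation with the excess of w over c. Its mutual energy
  with w is nonnegative, so f \<le> l c forces the excess to have norm zero.\<close>

lemma resolvent_le:
  assumes "is_resolvent l f w" "0 < l" "0 \<le> c" "f \<in> L2 \<mu>" "AE x in \<mu>. f x \<le> l * c"
  shows "AE x in \<mu>. w x \<le> c"
proof -
  let ?e = "\<lambda>x. max (w x - c) 0"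
  have w: "w \<in> \<F>" using assms by (simp add: is_resolvent_def)
  note e = form_excess[OF w assms(3)]
  have L: "w \<in> L2 \<mu>" "?e \<in> L2 \<mu>" using w e by auto
  have "l * ip ?e ?e = (\<integral>x. l * (?e x * ?e x) \<partial>\<mu>)" by (simp add: L2_inner_def)
  also have "\<dots> \<le> (\<integral>x. l * (w x * ?e x) - f x * ?e x \<partial>\<mu>)"
  proof (rule integral_mono_AE)
    show "AE x in \<mu>. l * (?e x * ?e x) \<le> l * (w x * ?e x) - f x * ?e x"
      using assms(5)
    proof eventually_elim
      fix x assume "f x \<le> l * c"
      then have "0 \<le> (l * c - f x) * ?e x" by (intro mult_nonneg_nonneg) auto
      moreover have "?e x * ?e x = (w x - c) * ?e x" by (auto simp: max_def)
      ultimately show "l * (?e x * ?e x) \<le> l * (w x * ?e x) - f x * ?e x"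
        by (simp only:) (simp add: algebra_simps)
    qed
  qed (use L assms(4) in \<open>auto intro!: L2_integrable_mult integrable_mult_right Bochner_Integration.integrable_diff\<close>)
  also have "\<dots> = l * ip w ?e - ip f ?e"
    using L assms(4) by (simp add: L2_inner_def L2_integrable_mult)
  also have "\<dots> = - \<E> w ?e"
  proof -
    have "\<E> w ?e + l * ip w ?e = ip f ?e"
      using assms(1) e(1) unfolding is_resolvent_def frm_def by blast
    then show ?thesis by linarith
  qed
  also have "\<dots> \<le> 0" using e(2) by simp
  finally have "ip ?e ?e \<le> 0" using assms(2) by (simp add: mult_le_0_iff)
  then have "ip ?e ?e = 0" using L2_inner_self_nonneg[of \<mu> ?e] by linarith
  from L2_inner_self_eq_0D[OF L(2) this] show ?thesis by eventually_elim (auto simp: max_def split: if_splits)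
qed

lemma is_resolvent_diff:
  assumes "is_resolvent l f w" "is_resolvent l g z" "f \<in> L2 \<mu>" "g \<in> L2 \<mu>"
  shows "is_resolvent l (\<lambda>x. f x - g x) (\<lambda>x. w x - z x)"
  using assms by (auto simp: is_resolvent_def F_diff frm_diff_left L2_inner_simps F_L2)

lemma is_resolvent_scale:
  assumes "is_resolvent l f w" "f \<in> L2 \<mu>"
  shows "is_resolvent l (\<lambda>x. c * f x) (\<lambda>x. c * w x)"
  using assms unfolding is_resolvent_def
  by (auto simp: F_intros frm_def form_simps L2_inner_simps F_L2)
    (metis distrib_left mult.left_commute)

lemma resolvent_nonneg:
  assumes "is_resolvent l f w" "0 < l" "f \<in> L2 \<mu>" "AE x in \<mu>. 0 \<le> f x"
  shows "AE x in \<mu>. 0 \<le> w x"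
proof -
  have "AE x in \<mu>. - 1 * w x \<le> 0"
    by (rule resolvent_le[OF is_resolvent_scale[OF assms(1,3)] assms(2)])
      (use assms L2_minus in auto)
  then show ?thesis by simp
qed

lemma resolvent_contraction:
  assumes "is_resolvent l (\<lambda>x. l * f x) w" "f \<in> L2 \<mu>" "0 < l"
  shows "nrm w \<le> nrm f"
proof -
  have w: "w \<in> \<F>" using assms by (simp add: is_resolvent_def)
  have "l * (nrm w)\<^sup>2 \<le> frm l w w" by (simp add: frm_def L2_norm_square form_nonneg w)
  also have "\<dots> = l * ip f w" using assms w by (simp add: is_resolvent_def L2_inner_simps)
  also have "\<dots> \<le> l * (nrm f * nrm w)"
    using L2_inner_Cauchy_Schwarz[OF assms(2) F_L2[OF w]] assms(3) by (intro mult_left_mono) auto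
  finally have "nrm w * nrm w \<le> nrm f * nrm w" using assms(3) by (simp add: power2_eq_square)
  then show ?thesis
    by (metis L2_norm_nonneg mult_le_cancel_right order_le_less)
qed

text \<open>l times the resolvent tends to the identity: quantitatively for v in \<F>, and for f by
  density together with the contraction bound.\<close>

lemma resolvent_approx:
  assumes "f \<in> L2 \<mu>" "0 < e"
  obtains l w where "0 < l" "is_resolvent l (\<lambda>x. l * f x) w" "nrm (\<lambda>x. f x - w x) < e"
proof -
  obtain v where v: "v \<in> \<F>" "nrm (\<lambda>x. f x - v x) < e / 4"
    using domain_dense[OF assms(1), of "e / 4"] assms(2) by auto
  \<comment> \<open>Large enough that the energy of v is at most l (e / 4)^2; the added 1 keeps l
    positive when the energy vanishes.\<close>
  define l where "l = \<E> v v / (e / 4)\<^sup>2 + 1"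
  have l: "l > 0" "\<E> v v \<le> l * (e / 4)\<^sup>2"
    using assms(2) form_nonneg[OF v(1)] by (auto simp: l_def distrib_right add_nonneg_pos)
  obtain w where w: "is_resolvent l (\<lambda>x. l * f x) w"
    using resolvent_exists[OF L2_scale[OF assms(1)] l(1)] by blast
  obtain z where z: "is_resolvent l (\<lambda>x. l * v x) z"
    using resolvent_exists[OF L2_scale[OF F_L2[OF v(1)]] l(1)] by blast
  have F: "w \<in> \<F>" "z \<in> \<F>" using w z by (auto simp: is_resolvent_def)
  let ?d = "\<lambda>x. z x - v x"
  have d: "?d \<in> \<F>" using F v by (auto intro: F_diff)
  have "is_resolvent l (\<lambda>x. l * (f x - v x)) (\<lambda>x. w x - z x)"
    using is_resolvent_diff[OF w z] assms v by (auto simp: L2_scale F_L2 right_diff_distrib)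
  from resolvent_contraction[OF this L2_diff[OF assms(1) F_L2[OF v(1)]] l(1)]
  have 1: "nrm (\<lambda>x. w x - z x) < e / 4" using v(2) by simp
  have "frm l ?d ?d = - \<E> v ?d"
    using z d v F by (simp add: frm_diff_left is_resolvent_def L2_inner_simps F_L2) (simp add: frm_def L2_inner_simps F_L2)
  \<comment> \<open>Nonnegativity of the energy of d + v / 2; the energy of d produced here cancels
    the one contained in \<open>frm l\<close>.\<close>
  also have "\<dots> \<le> \<E> v v / 4 + \<E> ?d ?d"
    using form_nonneg[OF domain_add[OF d domain_scale[OF v(1), of "1/2"]]]
      form_expand[OF d v(1), of "1/2"] form_sym[OF d v(1)] by (simp add: power2_eq_square)
  finally have "l * (nrm ?d)\<^sup>2 \<le> \<E> v v / 4" by (simp add: frm_def L2_norm_square)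
  also have "\<dots> \<le> l * (e / 4)\<^sup>2" using l form_nonneg[OF v(1)] by linarith
  finally have "l * (nrm ?d)\<^sup>2 \<le> l * (e / 4)\<^sup>2" .
  then have 2: "nrm ?d \<le> e / 4" using l(1) assms(2) by (simp add: abs_le_square_iff[symmetric])
  have "nrm (\<lambda>x. (f x - v x) + (v x - w x)) \<le> nrm (\<lambda>x. f x - v x) + nrm (\<lambda>x. (v x - z x) + (z x - w x))"
    using L2_norm_triangle[of "\<lambda>x. f x - v x" \<mu> "\<lambda>x. v x - w x"] assms v F by (simp add: L2_diff F_L2)
  also have "\<dots> \<le> nrm (\<lambda>x. f x - v x) + (nrm (\<lambda>x. v x - z x) + nrm (\<lambda>x. z x - w x))"
    using L2_norm_triangle[of "\<lambda>x. v x - z x" \<mu> "\<lambda>x. z x - w x"] v F by (simp add: L2_diff F_L2)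
  also have "\<dots> < e" using 1 2 v(2) assms(2) L2_norm_minus_commute[of \<mu> v z] L2_norm_minus_commute[of \<mu> w z]
    by simp
  finally have "nrm (\<lambda>x. f x - w x) < e" by simp
  with that l w show ?thesis by blast
qed

end

section \<open>The Markov property of the semigroup\<close>

locale dirichlet_semigroup = dirichlet_form \<mu> \<E> \<F> + form_semigroup \<mu> \<E> \<F> T
  for \<mu> :: "'a measure" and \<E> \<F> T
begin

lemma sg_minus:
  assumes "t > 0" "f \<in> L2 \<mu>"
  shows "AE x in \<mu>. T t (\<lambda>y. - f y) x = - T t f x"
  using sg_scale[OF assms, of "-1"] by simp

lemma sg_diff:
  assumes "t > 0" "f \<in> L2 \<mu>" "g \<in> L2 \<mu>"
  shows "AE x in \<mu>. T t (\<lambda>y. f y - g y) x = T t f x - T t g x"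
  using sg_add[OF assms(1,2) L2_minus[OF assms(3)]] sg_minus[OF assms(1,3)]
  by eventually_elim simp

section \<open>The generator, and differential inequalities by Euler sums\<close>

definition generates :: "('a \<Rightarrow> real) \<Rightarrow> ('a \<Rightarrow> real) \<Rightarrow> bool" where
  "generates u f \<longleftrightarrow> u \<in> \<F> \<and> f \<in> L2 \<mu> \<and> (\<forall>v\<in>\<F>. \<E> u v = - ip f v)"

lemma generates_tendsto:
  assumes "generates u f"
  shows "((\<lambda>t. nrm (\<lambda>x. (T t u x - u x) / t - f x)) \<longlongrightarrow> 0) (at_right 0)"
  using assms sg_generator[of u f] by (auto simp: generates_def)

lemma resolvent_generates:
  assumes "is_resolvent l f w" "f \<in> L2 \<mu>"
  shows "generates w (\<lambda>x. l * w x - f x)"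
proof -
  have w: "w \<in> \<F>" using assms by (simp add: is_resolvent_def)
  have "\<E> w v = - ip (\<lambda>x. l * w x - f x) v" if "v \<in> \<F>" for v
    using that assms w by (simp add: is_resolvent_def frm_def L2_inner_simps F_L2 L2_scale)
      (metis add_diff_cancel_right')
  with w assms show ?thesis by (simp add: generates_def L2_diff L2_scale F_L2)
qed

text \<open>\<open>T t\<close> commutes with the difference quotient of the semigroup and does not
  increase norms, so the limit at u passes to \<open>T t u\<close>.\<close>

lemma generates_sg:
  assumes g: "generates u f" and t: "t > 0"
  shows "generates (T t u) (T t f)"
proof -
  have L: "u \<in> L2 \<mu>" "f \<in> L2 \<mu>" using g by (auto simp: generates_def)
  then have LT: "T t u \<in> L2 \<mu>" "T t f \<in> L2 \<mu>" using sg_L2 t by auto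
  have "((\<lambda>h. nrm (\<lambda>x. (T h (T t u) x - T t u x) / h - T t f x)) \<longlongrightarrow> 0) (at_right 0)"
  proof (rule Lim_null_comparison[OF _ generates_tendsto[OF g]])
    show "\<forall>\<^sub>F h in at_right 0. norm (nrm (\<lambda>x. (T h (T t u) x - T t u x) / h - T t f x))
        \<le> nrm (\<lambda>x. (T h u x - u x) / h - f x)"
      using eventually_at_right_less[of "0::real"]
    proof eventually_elim
      fix h :: real assume h: "0 < h"
      have LTh: "T h u \<in> L2 \<mu>" "T h (T t u) \<in> L2 \<mu>" "T t (T h u) \<in> L2 \<mu>"
        using h t L LT by (auto intro: sg_L2)
      let ?q = "\<lambda>x. (1 / h) * (T h u x - u x) - f x"
      have q: "?q \<in> L2 \<mu>" using LTh L by (intro L2_diff L2_scale)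
      have ae: "AE x in \<mu>. T t ?q x = (1 / h) * (T h (T t u) x - T t u x) - T t f x"
        using sg_diff[OF t L2_scale[OF L2_diff[OF LTh(1) L(1)]] L(2), of "1 / h"]
          sg_scale[OF t L2_diff[OF LTh(1) L(1)], of "1 / h"] sg_diff[OF t LTh(1) L(1)]
          sg_semigroup[OF t h L(1)] sg_semigroup[OF h t L(1)]
        by eventually_elim (simp add: add.commute)
      have "nrm (\<lambda>x. (1 / h) * (T h (T t u) x - T t u x) - T t f x) = nrm (T t ?q)"
        by (intro L2_norm_cong[OF _ _ ae, symmetric] L2_measurable L2_diff L2_scale LTh LT sg_L2[OF t q])
      also have "\<dots> \<le> nrm ?q" by (rule sg_contraction[OF t q])
      finally show "norm (nrm (\<lambda>x. (T h (T t u) x - T t u x) / h - T t f x))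
        \<le> nrm (\<lambda>x. (T h u x - u x) / h - f x)" by simp
    qed
  qed
  with LT sg_generator[of "T t u" "T t f"] show ?thesis by (auto simp: generates_def)
qed

text \<open>The axioms constrain \<open>T t\<close> only for t > 0; the value at 0 is set to the
  identity so that iterations can start there.\<close>

definition Tz :: "real \<Rightarrow> ('a \<Rightarrow> real) \<Rightarrow> 'a \<Rightarrow> real" where
  "Tz t u = (if t = 0 then u else T t u)"

lemma Tz_L2: "0 \<le> t \<Longrightarrow> u \<in> L2 \<mu> \<Longrightarrow> Tz t u \<in> L2 \<mu>"
  by (simp add: Tz_def sg_L2)

lemma Tz_generates: "0 \<le> t \<Longrightarrow> generates u f \<Longrightarrow> generates (Tz t u) (Tz t f)"
  by (simp add: Tz_def generates_sg)

lemma Tz_contraction: "0 \<le> t \<Longrightarrow> u \<in> L2 \<mu> \<Longrightarrow> nrm (Tz t u) \<le> nrm u"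
  by (simp add: Tz_def sg_contraction)

text \<open>The error of an Euler step started at time s is no larger than the one at time 0. This
  uniformity in s lets the errors be summed.\<close>

lemma Tz_increment:
  assumes "0 \<le> s" "0 < h" "u \<in> L2 \<mu>" "f \<in> L2 \<mu>"
  shows "nrm (\<lambda>x. Tz (s + h) u x - Tz s u x - h * Tz s f x) \<le> nrm (\<lambda>x. T h u x - u x - h * f x)"
proof (cases "s = 0")
  case True
  then show ?thesis using assms by (simp add: Tz_def)
next
  case False
  then have s: "s > 0" using assms by simp
  let ?q = "\<lambda>x. T h u x - u x - h * f x"
  have L: "T h u \<in> L2 \<mu>" "?q \<in> L2 \<mu>" using assms by (auto intro!: L2_diff L2_scale sg_L2)
  have "AE x in \<mu>. T s ?q x = T (s + h) u x - T s u x - h * T s f x"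
    using sg_diff[OF s L2_diff[OF L(1) assms(3)] L2_scale[OF assms(4)], of h]
      sg_diff[OF s L(1) assms(3)] sg_scale[OF s assms(4), of h] sg_semigroup[OF s assms(2,3)]
    by eventually_elim simp
  then have "nrm (\<lambda>x. T (s + h) u x - T s u x - h * T s f x) = nrm (T s ?q)"
    using L assms s by (intro L2_norm_cong) (auto intro!: L2_measurable L2_diff L2_scale sg_L2)
  also have "\<dots> \<le> nrm ?q" by (rule sg_contraction[OF s L(2)])
  finally show ?thesis using False assms by (simp add: Tz_def)
qed

text \<open>Discrete Gronwall argument. One-step errors are o(h), and with h = t / Suc n the Suc n
  steps land exactly on t, so the total error vanishes in the limit and the growth factors tend to
  exp (a t).\<close>

lemma generates_euler:
  assumes g: "generates u f" and t: "0 < t" and a: "0 \<le> a" and K: "0 \<le> K"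
    and step: "\<And>s h. 0 \<le> s \<Longrightarrow> 0 < h \<Longrightarrow> h \<le> t \<Longrightarrow>
      N (s + h) \<le> (1 + a * h) * N s + K * (nrm (\<lambda>x. T h u x - u x - h * f x) + h\<^sup>2)"
  shows "N t \<le> exp (a * t) * (N 0 :: real)"
proof -
  define r where "r h = nrm (\<lambda>x. T h u x - u x - h * f x)" for h
  define \<delta> where "\<delta> h = K * (r h + h\<^sup>2)" for h
  have \<delta>0: "0 \<le> \<delta> h" for h using K by (simp add: \<delta>_def r_def add_nonneg_nonneg)
  have iter: "N (real k * h) \<le> (1 + a * h) ^ k * (N 0 + real k * \<delta> h)" if "0 < h" "h \<le> t" for h k
  proof (induction k)
    case 0
    then show ?case by simp
  next
    case (Suc k)
    have "N (real (Suc k) * h) = N (real k * h + h)" by (simp add: algebra_simps)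
    also have "\<dots> \<le> (1 + a * h) * N (real k * h) + \<delta> h"
      using step[of "real k * h" h] that by (simp add: \<delta>_def r_def)
    \<comment> \<open>The new error is inflated by a factor at least 1 so that the recursion keeps
      its closed form.\<close>
    also have "\<dots> \<le> (1 + a * h) * ((1 + a * h) ^ k * (N 0 + real k * \<delta> h)) + (1 + a * h) ^ Suc k * \<delta> h"
    proof (rule add_mono)
      show "(1 + a * h) * N (real k * h) \<le> (1 + a * h) * ((1 + a * h) ^ k * (N 0 + real k * \<delta> h))"
        using Suc.IH a that by (intro mult_left_mono) auto
      have "1 \<le> (1 + a * h) ^ Suc k" by (rule one_le_power) (use a that in simp)
      from mult_right_mono[OF this \<delta>0[of h]] show "\<delta> h \<le> (1 + a * h) ^ Suc k * \<delta> h" by simp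
    qed
    also have "\<dots> = (1 + a * h) ^ Suc k * (N 0 + real (Suc k) * \<delta> h)" by (simp add: algebra_simps)
    finally show ?case .
  qed
  define h where "h n = t / real (Suc n)" for n
  have h: "0 < h n" "h n \<le> t" "real (Suc n) * h n = t" for n
    using t by (auto simp: h_def divide_le_eq mult_le_cancel_left1)
  have h0: "h \<longlonglongrightarrow> 0"
    using tendsto_mult_left[OF LIMSEQ_inverse_real_of_nat, of t] by (simp add: h_def[abs_def] divide_inverse)
  have hr: "filterlim h (at_right 0) sequentially"
  proof -
    have "h n \<in> {0<..} \<and> h n \<noteq> 0" for n using h(1)[of n] by auto
    then show ?thesis using h0 by (auto simp: filterlim_at)
  qed
  have "(\<lambda>n. nrm (\<lambda>x. (T (h n) u x - u x) / h n - f x)) \<longlonglongrightarrow> 0"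
    by (rule filterlim_compose[OF generates_tendsto[OF g] hr])
  moreover have "r (h n) / h n = nrm (\<lambda>x. (T (h n) u x - u x) / h n - f x)" for n
  proof -
    have "(\<lambda>x. (T (h n) u x - u x) / h n - f x) = (\<lambda>x. (1 / h n) * (T (h n) u x - u x - h n * f x))"
      using h(1)[of n] by (auto simp: fun_eq_iff field_simps)
    then show ?thesis using h(1)[of n] by (simp only: r_def L2_norm_scale) simp
  qed
  ultimately have "(\<lambda>n. K * t * (r (h n) / h n + h n)) \<longlonglongrightarrow> K * t * (0 + 0)"
    by (intro tendsto_intros h0) simp
  moreover have "real (Suc n) * \<delta> (h n) = K * t * (r (h n) / h n + h n)" for n
    using h(1)[of n] h(3)[of n, symmetric] by (simp only: \<delta>_def) (simp add: field_simps power2_eq_square)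
  ultimately have 1: "(\<lambda>n. real (Suc n) * \<delta> (h n)) \<longlonglongrightarrow> 0" by simp
  have 2: "(\<lambda>n. (1 + a * h n) ^ Suc n) \<longlonglongrightarrow> exp (a * t)"
    using LIMSEQ_Suc[OF tendsto_exp_limit_sequentially[of "a * t"]] by (simp add: h_def)
  have "(\<lambda>n. (1 + a * h n) ^ Suc n * (N 0 + real (Suc n) * \<delta> (h n))) \<longlonglongrightarrow> exp (a * t) * (N 0 + 0)"
    by (intro tendsto_intros 1 2)
  then have "N t \<le> exp (a * t) * (N 0 + 0)"
  proof (rule tendsto_lowerbound)
    have "N t \<le> (1 + a * h n) ^ Suc n * (N 0 + real (Suc n) * \<delta> (h n))" for n
      using iter[OF h(1,2), of "Suc n" n] h(3)[of n] by simp
    then show "\<forall>\<^sub>F n in sequentially. N t \<le> (1 + a * h n) ^ Suc n * (N 0 + real (Suc n) * \<delta> (h n))"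
      by simp
  qed simp
  then show ?thesis by simp
qed

text \<open>Formally the squared norm of the excess of T_s u over c has derivative -2 \<E>(T_s u,
  excess), which is at most 0 by \<open>form_excess\<close>. The Euler lemma with a = 0 makes this
  rigorous.\<close>

lemma sg_le_domain:
  assumes g: "generates u f" and c: "0 \<le> c" "AE x in \<mu>. u x \<le> c" and t: "t > 0"
  shows "AE x in \<mu>. T t u x \<le> c"
proof -
  have L: "u \<in> L2 \<mu>" "f \<in> L2 \<mu>" using g by (auto simp: generates_def)
  define e where "e s = (\<lambda>x. max (Tz s u x - c) 0)" for s
  \<comment> \<open>The summands pay for the linear error (the excess has norm at most
    \<open>nrm u\<close>), for the square of h times \<open>nrm f\<close>, and for r^2, where the a
    priori bound on r makes the quadratic error linear in r.\<close>
  define K where "K = 2 * nrm u + 2 * (nrm f)\<^sup>2 + 2 * (2 * nrm u + t * nrm f)"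
  have K: "0 \<le> K" using t by (simp add: K_def add_nonneg_nonneg)
  have Lu: "Tz s u \<in> L2 \<mu>" "Tz s f \<in> L2 \<mu>" if "0 \<le> s" for s
    using that L by (auto intro: Tz_L2)
  have Fu: "Tz s u \<in> \<F>" if "0 \<le> s" for s using Tz_generates[OF that g] by (simp add: generates_def)
  have Fe: "e s \<in> \<F>" if "0 \<le> s" for s unfolding e_def by (rule form_excess[OF Fu[OF that] c(1)])
  have "ip (e t) (e t) \<le> exp (0 * t) * ip (e 0) (e 0)"
  proof (rule generates_euler[OF g t _ K, where N = "\<lambda>s. ip (e s) (e s)"])
    fix s h :: real assume s: "0 \<le> s" and h: "0 < h" "h \<le> t"
    define r where "r = nrm (\<lambda>x. T h u x - u x - h * f x)"
    let ?D = "\<lambda>x. Tz (s + h) u x - Tz s u x"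
    let ?R = "\<lambda>x. ?D x - h * Tz s f x"
    have sh: "0 \<le> s + h" using s h by simp
    have LD: "?D \<in> L2 \<mu>" "?R \<in> L2 \<mu>" using Lu s sh by (auto intro!: L2_diff L2_scale)
    have Le: "e s \<in> L2 \<mu>" "e (s + h) \<in> L2 \<mu>" using Fe s sh by auto
    have R: "nrm ?R \<le> r" unfolding r_def by (rule Tz_increment) (use s h L in auto)
    have "nrm (\<lambda>x. T h u x - u x - h * f x) \<le> nrm (T h u) + nrm u + h * nrm f"
      using L2_norm_diff_le[OF L2_diff[OF sg_L2[OF h(1) L(1)] L(1)] L2_scale[OF L(2)], of h]
        L2_norm_diff_le[OF sg_L2[OF h(1) L(1)] L(1)] h by (simp add: L2_norm_scale)
    also have "\<dots> \<le> 2 * nrm u + t * nrm f"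
      using sg_contraction[OF h(1) L(1)] mult_right_mono[OF h(2) L2_norm_nonneg[of \<mu> f]] by simp
    finally have r: "r \<le> 2 * nrm u + t * nrm f" by (simp add: r_def)
    have r0: "0 \<le> r" by (simp add: r_def)
    have ne: "nrm (e s) \<le> nrm u"
    proof -
      have "nrm (e s) \<le> nrm (Tz s u)"
        by (rule L2_norm_mono) (use Lu[OF s] Le c in \<open>auto simp: e_def max_def\<close>)
      then show ?thesis using Tz_contraction[OF s L(1)] by simp
    qed
    have "ip (e (s + h)) (e (s + h)) \<le> ip (e s) (e s) + 2 * ip (e s) ?D + ip ?D ?D"
    proof -
      have "(\<integral>x. e (s + h) x * e (s + h) x \<partial>\<mu>) \<le> (\<integral>x. e s x * e s x + 2 * (e s x * ?D x) + ?D x * ?D x \<partial>\<mu>)"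
        using Le LD
        by (intro integral_mono L2_integrable_mult Bochner_Integration.integrable_add integrable_mult_right)
          (auto simp: e_def sq_pos_part_le[unfolded power2_eq_square])
      then show ?thesis using Le LD by (simp add: L2_inner_def L2_integrable_mult)
    qed
    moreover have "ip (e s) ?D \<le> nrm u * r"
    proof -
      have "ip (e s) ?D = ip (e s) (\<lambda>x. h * Tz s f x + ?R x)" by simp
      also have "\<dots> = h * ip (Tz s f) (e s) + ip (e s) ?R"
        using Le LD Lu[OF s] by (subst L2_inner_add_right)
          (auto simp: L2_scale L2_inner_scale_right L2_inner_commute[of \<mu> "Tz s f"])
      also have "ip (Tz s f) (e s) = - \<E> (Tz s u) (e s)"
        using Tz_generates[OF s g] Fe[OF s] by (simp add: generates_def)
      also have "h * - \<E> (Tz s u) (e s) \<le> 0"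
        using h form_excess(2)[OF Fu[OF s] c(1)] by (simp add: e_def mult_nonneg_nonpos)
      also have "ip (e s) ?R \<le> nrm (e s) * nrm ?R"
        using L2_inner_Cauchy_Schwarz[OF Le(1) LD(2)] by simp
      also have "\<dots> \<le> nrm u * r" using ne R by (intro mult_mono) auto
      finally show ?thesis by simp
    qed
    moreover have "ip ?D ?D \<le> 2 * (nrm f)\<^sup>2 * h\<^sup>2 + 2 * (2 * nrm u + t * nrm f) * r"
    proof -
      have "nrm ?D = nrm (\<lambda>x. h * Tz s f x + ?R x)" by simp
      also have "\<dots> \<le> nrm (\<lambda>x. h * Tz s f x) + nrm ?R"
        by (rule L2_norm_triangle) (use LD Lu[OF s] L2_scale in auto)
      also have "\<dots> \<le> h * nrm f + r"
        using R h Tz_contraction[OF s L(2)] by (simp add: L2_norm_scale add_mono)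
      finally have "(nrm ?D)\<^sup>2 \<le> (h * nrm f + r)\<^sup>2" by (intro power_mono) auto
      also have "\<dots> \<le> 2 * (h * nrm f)\<^sup>2 + 2 * r\<^sup>2"
        using sum_squares_bound[of "h * nrm f" r] by (simp add: power2_sum)
      also have "r\<^sup>2 \<le> (2 * nrm u + t * nrm f) * r"
        using mult_right_mono[OF r r0] by (simp add: power2_eq_square)
      finally show ?thesis by (simp add: L2_norm_square power_mult_distrib algebra_simps)
    qed
    moreover have "2 * (nrm u * r) + (2 * (nrm f)\<^sup>2 * h\<^sup>2 + 2 * (2 * nrm u + t * nrm f) * r) \<le> K * (r + h\<^sup>2)"
    proof -
      have "0 \<le> (2 * (nrm f)\<^sup>2) * r + (2 * nrm u + 2 * (2 * nrm u + t * nrm f)) * h\<^sup>2"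
        using r0 t by (intro add_nonneg_nonneg mult_nonneg_nonneg) (auto intro!: add_nonneg_nonneg)
      then show ?thesis by (simp add: K_def algebra_simps)
    qed
    moreover have "a \<le> b + z" if "a \<le> b + 2 * c + d" "c \<le> c'" "d \<le> d'" "2 * c' + d' \<le> z" for a b c c' d d' z :: real
      using that by linarith
    ultimately have "ip (e (s + h)) (e (s + h)) \<le> ip (e s) (e s) + K * (r + h\<^sup>2)" by blast
    then show "ip (e (s + h)) (e (s + h)) \<le> (1 + 0 * h) * ip (e s) (e s) + K * (nrm (\<lambda>x. T h u x - u x - h * f x) + h\<^sup>2)"
      by (simp add: r_def)
  qed simp
  moreover have "ip (e 0) (e 0) = 0"
  proof -
    have "AE x in \<mu>. e 0 x * e 0 x = 0"
      using c(2) by eventually_elim (simp add: e_def Tz_def)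
    then show ?thesis unfolding L2_inner_def by (rule integral_eq_zero_AE)
  qed
  ultimately have "ip (e t) (e t) = 0" using L2_inner_self_nonneg[of \<mu> "e t"] by simp
  moreover have "e t \<in> L2 \<mu>" using Fe[of t] t by auto
  ultimately have "AE x in \<mu>. e t x = 0" by (auto intro: L2_inner_self_eq_0D)
  then show ?thesis by eventually_elim (use t in \<open>auto simp: e_def Tz_def max_def split: if_splits\<close>)
qed

text \<open>For a resolvent approximation w of f the maximum principle keeps w below c and the
  previous lemma applies. The excess of \<open>T t f\<close> is then dominated by
  |\<open>T t (f - w)\<close>|, whose norm is arbitrarily small.\<close>

lemma sg_le:
  assumes f: "f \<in> L2 \<mu>" and c: "0 \<le> c" "AE x in \<mu>. f x \<le> c" and t: "t > 0"
  shows "AE x in \<mu>. T t f x \<le> c"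
proof -
  let ?e = "\<lambda>x. max (T t f x - c) 0"
  have LT: "T t f \<in> L2 \<mu>" using f t by (rule sg_L2[rotated])
  have Le: "?e \<in> L2 \<mu>" by (rule L2_bound[OF LT]) (use LT c in \<open>auto simp: max_def\<close>)
  have "nrm ?e < d" if d: "d > 0" for d
  proof -
    obtain l w where w: "0 < l" "is_resolvent l (\<lambda>x. l * f x) w" "nrm (\<lambda>x. f x - w x) < d"
      using resolvent_approx[OF f d] by blast
    have Lw: "w \<in> L2 \<mu>" using w by (auto simp: is_resolvent_def)
    have "AE x in \<mu>. w x \<le> c"
      by (rule resolvent_le[OF w(2,1) c(1)]) (use f c w in \<open>auto simp: L2_scale\<close>)
    from sg_le_domain[OF resolvent_generates[OF w(2) L2_scale[OF f]] c(1) this t]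
    have Tw: "AE x in \<mu>. T t w x \<le> c" .
    have "nrm ?e \<le> nrm (T t (\<lambda>x. f x - w x))"
    proof (rule L2_norm_mono)
      show "AE x in \<mu>. \<bar>?e x\<bar> \<le> \<bar>T t (\<lambda>x. f x - w x) x\<bar>"
        using Tw sg_diff[OF t f Lw] by eventually_elim auto
    qed (use Le L2_diff[OF f Lw] t sg_L2 in auto)
    also have "\<dots> \<le> nrm (\<lambda>x. f x - w x)" by (rule sg_contraction[OF t L2_diff[OF f Lw]])
    also have "\<dots> < d" by fact
    finally show ?thesis .
  qed
  then have "nrm ?e = 0" using L2_norm_nonneg[of \<mu> ?e] by (metis less_irrefl order_le_less)
  then have "ip ?e ?e = 0" by (simp flip: L2_norm_square)
  from L2_inner_self_eq_0D[OF Le this] show ?thesis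
    by eventually_elim (auto simp: max_def split: if_splits)
qed

lemma sg_nonneg:
  assumes "f \<in> L2 \<mu>" "AE x in \<mu>. 0 \<le> f x" "t > 0"
  shows "AE x in \<mu>. 0 \<le> T t f x"
proof -
  have "AE x in \<mu>. T t (\<lambda>x. - f x) x \<le> 0"
    by (rule sg_le) (use assms L2_minus in auto)
  then show ?thesis using sg_minus[OF assms(3,1)] by eventually_elim simp
qed

lemma sg_mono:
  assumes "f \<in> L2 \<mu>" "g \<in> L2 \<mu>" "AE x in \<mu>. f x \<le> g x" "t > 0"
  shows "AE x in \<mu>. T t f x \<le> T t g x"
proof -
  have "AE x in \<mu>. 0 \<le> T t (\<lambda>x. g x - f x) x"
    by (rule sg_nonneg) (use assms in \<open>auto simp: L2_diff\<close>)
  then show ?thesis using sg_diff[OF assms(4,2,1)] by eventually_elim simp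
qed

end

section \<open>Composition with Lipschitz functions\<close>

text \<open>
  Only the unit contraction is available at first. A Lipschitz function of \<open>u\<close> is the limit of linear
  combinations of level pieces \<open>lev e i \<circ> u\<close>; each piece is saturated wherever a later one does not
  vanish, so their mutual energies are nonnegative and the slopes can be replaced by their bound.
\<close>

definition lev :: "real \<Rightarrow> nat \<Rightarrow> real \<Rightarrow> real" where
  "lev e i x = min x (real (Suc i) * e) - min x (real i * e)"

text \<open>The piecewise linear interpolant of h - h 0 at the multiples of e, extended by constants
  outside [0, n e].\<close>

definition interp :: "(real \<Rightarrow> real) \<Rightarrow> real \<Rightarrow> nat \<Rightarrow> real \<Rightarrow> real" where
  "interp h e n x = (\<Sum>i<n. (h (real (Suc i) * e) - h (real i * e)) / e * lev e i x)"

lemma lev_mono: "0 < e \<Longrightarrow> x \<le> y \<Longrightarrow> lev e i x \<le> lev e i y"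
  by (auto simp: lev_def min_def distrib_right)

lemma lev_nonneg: "0 < e \<Longrightarrow> 0 \<le> lev e i x"
  by (auto simp: lev_def min_def distrib_right)

lemma lev_le: "0 < e \<Longrightarrow> lev e i x \<le> e"
  by (auto simp: lev_def min_def distrib_right)

lemma lev_below: "0 < e \<Longrightarrow> x \<le> real i * e \<Longrightarrow> lev e i x = 0"
  by (auto simp: lev_def min_def distrib_right)

lemma lev_above: "0 < e \<Longrightarrow> real (Suc i) * e \<le> x \<Longrightarrow> lev e i x = e"
  by (auto simp: lev_def min_def distrib_right)

lemma sum_lev: "0 \<le> x \<Longrightarrow> x \<le> real n * e \<Longrightarrow> (\<Sum>i<n. lev e i x) = x"
  unfolding lev_def using sum_lessThan_telescope[of "\<lambda>i. min x (real i * e)" n] by simp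

lemma interp_node:
  assumes "0 < e" "k \<le> n" "h 0 = 0"
  shows "interp h e n (real k * e) = h (real k * e)"
proof -
  have "interp h e n (real k * e) = (\<Sum>i<n. if i < k then h (real (Suc i) * e) - h (real i * e) else 0)"
    unfolding interp_def
  proof (rule sum.cong[OF refl])
    fix i
    show "(h (real (Suc i) * e) - h (real i * e)) / e * lev e i (real k * e) =
        (if i < k then h (real (Suc i) * e) - h (real i * e) else 0)"
    proof (cases "i < k")
      case True
      then have "real (Suc i) * e \<le> real k * e" using assms(1) by (intro mult_right_mono) auto
      with True assms(1) show ?thesis by (simp add: lev_above del: of_nat_Suc)
    next
      case False
      then have "real k * e \<le> real i * e" using assms(1) by (intro mult_right_mono) auto
      with False assms(1) show ?thesis by (simp add: lev_below)
    qed
  qed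
  also have "\<dots> = (\<Sum>i<k. h (real (Suc i) * e) - h (real i * e))"
    using assms(2) by (intro sum.mono_neutral_cong_right) auto
  also have "\<dots> = h (real k * e)"
    using sum_lessThan_telescope[of "\<lambda>i. h (real i * e)" k] assms(3) by simp
  finally show ?thesis .
qed

lemma interp_slope:
  assumes e: "0 < e" and lip: "S-lipschitz_on {0..real n * e} h"
    and i: "i < n"
  shows "\<bar>(h (real (Suc i) * e) - h (real i * e)) / e\<bar> \<le> (S::real)"
proof -
  have "real (Suc i) * e \<le> real n * e" "real i * e \<le> real n * e"
    using e i by (intro mult_right_mono; simp)+
  then have "\<bar>h (real (Suc i) * e) - h (real i * e)\<bar> \<le> S * \<bar>real (Suc i) * e - real i * e\<bar>"
    using e lipschitz_onD[OF lip, of "real (Suc i) * e" "real i * e"] by (simp add: dist_real_def)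
  also have "\<bar>real (Suc i) * e - real i * e\<bar> = e" using e by (simp add: algebra_simps)
  finally show ?thesis using e by (simp add: abs_divide field_simps)
qed

lemma interp_lipschitz:
  assumes e: "0 < e" and lip: "S-lipschitz_on {0..real n * e} h"
    and xy: "0 \<le> y" "y \<le> x" "x \<le> real n * e"
  shows "\<bar>interp h e n x - interp h e n y\<bar> \<le> S * (x - y)"
proof -
  let ?s = "\<lambda>i. (h (real (Suc i) * e) - h (real i * e)) / e"
  have "\<bar>interp h e n x - interp h e n y\<bar> = \<bar>\<Sum>i<n. ?s i * (lev e i x - lev e i y)\<bar>"
    by (simp add: interp_def right_diff_distrib sum_subtractf)
  also have "\<dots> \<le> (\<Sum>i<n. S * (lev e i x - lev e i y))"
  proof (rule order_trans[OF sum_abs], rule sum_mono)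
    fix i assume "i \<in> {..<n}"
    then show "\<bar>?s i * (lev e i x - lev e i y)\<bar> \<le> S * (lev e i x - lev e i y)"
      using interp_slope[OF e lip, of i] lev_mono[OF e xy(2), of i]
        lipschitz_on_nonneg[OF lip] unfolding abs_mult by (intro mult_mono) auto
  qed
  also have "\<dots> = S * (x - y)"
    using xy by (simp add: sum_lev sum_subtractf flip: sum_distrib_left)
  finally show ?thesis .
qed

lemma interp_close:
  assumes e: "0 < e" and lip: "S-lipschitz_on {0..real n * e} h"
    and x: "0 \<le> x" "x \<le> real n * e" and h0: "h 0 = 0"
  shows "\<bar>interp h e n x - h x\<bar> \<le> 2 * S * e"
proof -
  have S: "0 \<le> S" by (rule lipschitz_on_nonneg[OF lip])
  define k where "k = nat \<lfloor>x / e\<rfloor>"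
  have "0 \<le> x / e" using x e by simp
  then have kr: "real k = of_int \<lfloor>x / e\<rfloor>" by (simp add: k_def)
  have "real k \<le> x / e" "x / e \<le> real k + 1" unfolding kr by linarith+
  then have k: "real k * e \<le> x" "x - real k * e \<le> e"
    using e by (simp_all add: field_simps)
  have "real k * e \<le> real n * e" using k x by linarith
  then have kn: "k \<le> n" using e by simp
  have "\<bar>interp h e n x - interp h e n (real k * e)\<bar> \<le> S * (x - real k * e)"
    by (rule interp_lipschitz[OF e lip]) (use k x e in auto)
  moreover have "\<bar>h (real k * e) - h x\<bar> \<le> S * \<bar>real k * e - x\<bar>"
    using lipschitz_onD[OF lip, of "real k * e" x] k x e \<open>real k * e \<le> real n * e\<close>
    by (simp add: dist_real_def)
  moreover have "S * (x - real k * e) \<le> S * e" using k S by (intro mult_left_mono) auto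
  moreover have "\<bar>real k * e - x\<bar> = x - real k * e" using k by simp
  ultimately show ?thesis unfolding interp_node[where h = h, OF e kn h0] by simp
qed

text \<open>Mean value inequality applied to y \<mapsto> h y - s y.\<close>

lemma slope_close:
  fixes h h' :: "real \<Rightarrow> real"
  assumes der: "\<And>y. y \<in> {a..b} \<Longrightarrow> (h has_real_derivative h' y) (at y within {a..b})"
    and close: "\<And>y. y \<in> {a..b} \<Longrightarrow> \<bar>h' y - s\<bar> \<le> \<omega>" and ab: "a < b"
  shows "\<bar>(h b - h a) / (b - a) - s\<bar> \<le> \<omega>"
proof -
  have "norm ((h b - s * b) - (h a - s * a)) \<le> \<omega> * norm (b - a)"
  proof (rule field_differentiable_bound[where S = "{a..b}"])
    show "((\<lambda>y. h y - s * y) has_real_derivative h' y - s) (at y within {a..b})" if "y \<in> {a..b}" for y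
      by (rule derivative_eq_intros der[OF that] refl | simp)+
  qed (use close ab in auto)
  moreover have "(h b - h a) / (b - a) - s = ((h b - s * b) - (h a - s * a)) / (b - a)"
    using ab by (simp add: field_simps)
  ultimately show ?thesis using ab by (simp add: abs_divide field_simps)
qed

lemma card_levels_le:
  assumes "0 < e"
  shows "card {i \<in> {..<n}. real i * e \<le> x \<and> x \<le> real (Suc i) * e} \<le> 2"
proof -
  define k where "k = nat \<lfloor>x / e\<rfloor>"
  \<comment> \<open>Two closed levels meet at a node, hence two candidates. For k = 0 the natural
    number k - 1 is 0, which adds nothing.\<close>
  have "{i \<in> {..<n}. real i * e \<le> x \<and> x \<le> real (Suc i) * e} \<subseteq> {k - 1, k}"
  proof
    fix i assume "i \<in> {i \<in> {..<n}. real i * e \<le> x \<and> x \<le> real (Suc i) * e}"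
    then have "real i \<le> x / e" "x / e \<le> real (Suc i)" using assms by (auto simp: field_simps)
    then have "int i \<le> \<lfloor>x / e\<rfloor>" "\<lfloor>x / e\<rfloor> \<le> int i + 1" by linarith+
    then show "i \<in> {k - 1, k}" unfolding k_def by auto
  qed
  then have "card {i \<in> {..<n}. real i * e \<le> x \<and> x \<le> real (Suc i) * e} \<le> card {k - 1, k}"
    by (intro card_mono) auto
  also have "\<dots> \<le> 2" by (simp add: card_insert_if)
  finally show ?thesis .
qed

context dirichlet_form
begin

lemma F_lev:
  assumes "u \<in> \<F>" "\<And>x. 0 \<le> u x" "0 < e"
  shows "(\<lambda>x. lev e i (u x)) \<in> \<F>"
  unfolding lev_def using assms by (intro F_diff F_trunc) auto

lemma form_lev_nonneg:
  assumes u: "u \<in> \<F>" "\<And>x. 0 \<le> u x" and e: "0 < e"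
  shows "0 \<le> \<E> (\<lambda>x. lev e i (u x)) (\<lambda>x. lev e j (u x))"
proof -
  have *: "0 \<le> \<E> (\<lambda>x. lev e i (u x)) (\<lambda>x. lev e j (u x))" if "i < j" for i j
  proof (rule form_saturated[where c = e])
    fix x
    have "real (Suc i) * e \<le> real j * e" using e that by (intro mult_right_mono) auto
    then show "lev e j (u x) = 0 \<or> lev e i (u x) = e"
      using lev_below[OF e, of "u x" j] lev_above[OF e, of i "u x"] by linarith
  qed (use u e in \<open>auto simp: F_lev lev_nonneg lev_le\<close>)
  consider "i < j" | "j < i" | "i = j" by linarith
  then show ?thesis
    using *[of i j] *[of j i] form_sym F_lev[OF u e] form_nonneg by cases metis+
qed

lemma
  assumes u: "u \<in> \<F>" "\<And>x. 0 \<le> u x" "\<And>x. u x \<le> real n * e" and e: "0 < e"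
    and lip: "S-lipschitz_on {0..real n * e} h"
  shows F_interp: "(\<lambda>x. interp h e n (u x)) \<in> \<F>"
    and form_interp_le: "\<E> (\<lambda>x. interp h e n (u x)) (\<lambda>x. interp h e n (u x)) \<le> S\<^sup>2 * \<E> u u"
proof -
  have S: "0 \<le> S" by (rule lipschitz_on_nonneg[OF lip])
  let ?s = "\<lambda>i. (h (real (Suc i) * e) - h (real i * e)) / e"
  let ?l = "\<lambda>i x. lev e i (u x)"
  note F = F_lev[OF u(1,2) e] domain_scale[OF F_lev[OF u(1,2) e]]
  show "(\<lambda>x. interp h e n (u x)) \<in> \<F>"
    unfolding interp_def by (intro F_sum F)
  have "\<E> (\<lambda>x. interp h e n (u x)) (\<lambda>x. interp h e n (u x)) =
      (\<Sum>i<n. \<Sum>j<n. ?s i * (?s j * \<E> (?l i) (?l j)))"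
    unfolding interp_def
    by (simp only: form_sum form_sum_right F F_sum form_scale form_scale_right sum_distrib_left)
  also have "\<dots> \<le> (\<Sum>i<n. \<Sum>j<n. S * S * \<E> (?l i) (?l j))"
  proof (intro sum_mono)
    fix i j assume "i \<in> {..<n}" "j \<in> {..<n}"
    then have "\<bar>?s i\<bar> \<le> S" "\<bar>?s j\<bar> \<le> S"
      using interp_slope[OF e lip] by auto
    then have "\<bar>?s i * ?s j\<bar> \<le> S * S" unfolding abs_mult using S by (intro mult_mono) auto
    then have "?s i * ?s j \<le> S * S" by linarith
    from mult_right_mono[OF this form_lev_nonneg[OF u(1,2) e]]
    show "?s i * (?s j * \<E> (?l i) (?l j)) \<le> S * S * \<E> (?l i) (?l j)" by (simp only: mult.assoc)
  qed
  also have "\<dots> = S\<^sup>2 * \<E> (\<lambda>x. \<Sum>i<n. ?l i x) (\<lambda>x. \<Sum>i<n. ?l i x)"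
    by (simp add: form_sum form_sum_right F F_sum sum_distrib_left power2_eq_square)
  also have "(\<lambda>x. \<Sum>i<n. ?l i x) = u" using u by (auto simp: sum_lev)
  finally show "\<E> (\<lambda>x. interp h e n (u x)) (\<lambda>x. interp h e n (u x)) \<le> S\<^sup>2 * \<E> u u" .
qed

lemma
  assumes u: "u \<in> \<F>" "\<And>x. 0 \<le> u x" "\<And>x. u x \<le> M" and M: "0 < M"
    and lip: "S-lipschitz_on {0..M} h"
    and h0: "h 0 = 0"
  shows F_lipschitz: "(\<lambda>x. h (u x)) \<in> \<F>"
    and interp_tendsto: "(\<lambda>n. nrm (\<lambda>x. interp h (M / real (Suc n)) (Suc n) (u x) - h (u x))) \<longlonglongrightarrow> 0"
proof -
  have S: "0 \<le> S" by (rule lipschitz_on_nonneg[OF lip])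
  define e where "e n = M / real (Suc n)" for n
  have e: "0 < e n" "real (Suc n) * e n = M" for n using M by (auto simp: e_def)
  have lip': "S-lipschitz_on {0..real (Suc n) * e n} h" for n
    using lip by (simp only: e)
  let ?U = "\<lambda>n x. interp h (e n) (Suc n) (u x)"
  have uM: "u x \<le> real (Suc n) * e n" for x n unfolding e by (rule u)
  note U = F_interp[OF u(1,2) uM e(1) lip']
    and U2 = form_interp_le[OF u(1,2) uM e(1) lip']
  have close: "\<bar>?U n x - h (u x)\<bar> \<le> 2 * S * e n" for n x
    by (rule interp_close[OF e(1) lip' _ _ h0]) (use u uM in auto)
  have e0: "(\<lambda>n. 2 * S * e n) \<longlonglongrightarrow> 0"
    using tendsto_mult_left[OF LIMSEQ_inverse_real_of_nat, of "2 * S * M"]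
    by (simp add: e_def divide_inverse mult.assoc)
  have ptw: "(\<lambda>n. ?U n x) \<longlonglongrightarrow> h (u x)" for x
  proof -
    have "(\<lambda>n. ?U n x - h (u x)) \<longlonglongrightarrow> 0"
      by (rule Lim_null_comparison[OF _ e0]) (use close in auto)
    then show ?thesis by (simp add: LIM_zero_iff)
  qed
  have meas: "(\<lambda>x. h (u x)) \<in> borel_measurable \<mu>"
    by (rule borel_measurable_LIMSEQ_real[OF ptw]) (use U in auto)
  have hb: "\<bar>h (u x)\<bar> \<le> S * u x" for x
    using lipschitz_onD[OF lip, of "u x" 0] u M h0 by (simp add: dist_real_def)
  have Ub: "\<bar>?U n x\<bar> \<le> S * u x" for n x
  proof -
    have "interp h (e n) (Suc n) 0 = 0"
      using interp_node[where h = h, OF e(1) _ h0, of 0 "Suc n" n] h0 by simp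
    then show ?thesis
      using interp_lipschitz[OF e(1)[of n] lip'[of n], of 0 "u x"] u(2)[of x] uM[of x n] by simp
  qed
  have L: "(\<lambda>x. h (u x)) \<in> L2 \<mu>"
    by (rule L2_bound[OF L2_scale[OF F_L2[OF u(1)], of S] meas])
      (use hb u(2) S in \<open>auto simp: abs_mult\<close>)
  \<comment> \<open>On a space of infinite measure uniform closeness does not give \<open>L2\<close>
    convergence; bounding both functions by S u supplies the square integrable majorant.\<close>
  have lim: "(\<lambda>n. nrm (\<lambda>x. ?U n x - h (u x))) \<longlonglongrightarrow> 0"
  proof (rule L2_dominated_convergence[OF L2_scale[OF F_L2[OF u(1)], of "2 * S"]])
    show "AE x in \<mu>. \<bar>?U n x - h (u x)\<bar> \<le> 2 * S * u x" for n
    proof (rule AE_I2)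
      fix x
      show "\<bar>?U n x - h (u x)\<bar> \<le> 2 * S * u x"
        using hb[of x] Ub[of n x] by linarith
    qed
  qed (use U meas ptw in auto)
  show "(\<lambda>x. h (u x)) \<in> \<F>" by (rule bounded_form_limit[OF U U2 L lim])
  show "(\<lambda>n. nrm (\<lambda>x. interp h (M / real (Suc n)) (Suc n) (u x) - h (u x))) \<longlonglongrightarrow> 0"
    using lim by (simp only: e_def)
qed

lemma F_square_nonneg:
  assumes "u \<in> \<F>" "\<And>x. 0 \<le> u x" "\<And>x. u x \<le> M" "0 < M"
  shows "(\<lambda>x. (u x)\<^sup>2) \<in> \<F>"
proof (rule F_lipschitz[where h = "\<lambda>y. y\<^sup>2" and S = "2 * M", OF assms lipschitz_onI])
  fix x y assume xy: "x \<in> {0..M}" "y \<in> {0..M}"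
  have "\<bar>x\<^sup>2 - y\<^sup>2\<bar> = (x + y) * \<bar>x - y\<bar>"
    using xy by (simp add: power2_eq_square square_diff_square_factored abs_mult)
  also have "\<dots> \<le> 2 * M * \<bar>x - y\<bar>" using xy by (intro mult_right_mono) auto
  finally show "dist (x\<^sup>2) (y\<^sup>2) \<le> 2 * M * dist x y" by (simp add: dist_real_def)
qed (use assms in auto)

lemma F_mult_nonneg:
  assumes "u \<in> \<F>" "\<And>x. 0 \<le> u x" "\<And>x. u x \<le> M" "v \<in> \<F>" "\<And>x. 0 \<le> v x" "\<And>x. v x \<le> N" "0 < M" "0 < N"
  shows "(\<lambda>x. u x * v x) \<in> \<F>"
proof -
  have "(\<lambda>x. 1 / 2 * ((u x + v x)\<^sup>2 - (u x)\<^sup>2 - (v x)\<^sup>2)) \<in> \<F>"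
    using assms
    by (intro F_intros F_square_nonneg[of _ "M + N"] F_square_nonneg[of u M] F_square_nonneg[of v N])
      (auto simp: add_mono)
  then show ?thesis by (simp add: power2_sum)
qed

lemma F_mult:
  assumes "u \<in> \<F> \<inter> Linf \<mu>" "v \<in> \<F> \<inter> Linf \<mu>"
  shows "(\<lambda>x. u x * v x) \<in> \<F> \<inter> Linf \<mu>"
proof -
  obtain A B where AB: "AE x in \<mu>. \<bar>u x\<bar> \<le> A" "AE x in \<mu>. \<bar>v x\<bar> \<le> B"
    using assms by (auto simp: Linf_def)
  \<comment> \<open>A common cut level for all four sign parts; the 1 makes it positive whatever A
    and B are.\<close>
  define M where "M = max 1 (max A B)"
  have M: "M > 0" by (simp add: M_def)
  define P where "P w x = min (max (w x) 0) M" for w :: "'a \<Rightarrow> real" and x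
  have P: "P w \<in> \<F>" "0 \<le> P w x" "P w x \<le> M" if "w \<in> \<F>" for w x
    using F_cut(1)[OF that M] M by (auto simp: P_def[abs_def])
  have F: "(\<lambda>x. P w x * P z x) \<in> \<F>" if "w \<in> \<F>" "z \<in> \<F>" for w z
    by (rule F_mult_nonneg[of _ M _ M]) (use P that M in auto)
  let ?u = "\<lambda>x. - u x" and ?v = "\<lambda>x. - v x"
  have uv: "u \<in> \<F>" "v \<in> \<F>" "?u \<in> \<F>" "?v \<in> \<F>" using assms by (auto intro: F_minus)
  have "(\<lambda>x. P u x * P v x - P u x * P ?v x - P ?u x * P v x + P ?u x * P ?v x) \<in> \<F>"
    by (intro F_intros F uv)
  moreover have "AE x in \<mu>. P u x * P v x - P u x * P ?v x - P ?u x * P v x + P ?u x * P ?v x = u x * v x"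
    using AB
  proof eventually_elim
    fix x assume "\<bar>u x\<bar> \<le> A" "\<bar>v x\<bar> \<le> B"
    then have "u x = P u x - P ?u x" "v x = P v x - P ?v x"
      by (auto simp: P_def M_def min_def max_def)
    then have "u x * v x = (P u x - P ?u x) * (P v x - P ?v x)" by simp
    then show "P u x * P v x - P u x * P ?v x - P ?u x * P v x + P ?u x * P ?v x = u x * v x"
      by (simp add: algebra_simps)
  qed
  moreover have "(\<lambda>x. u x * v x) \<in> borel_measurable \<mu>"
    by (intro borel_measurable_times F_measurable uv)
  ultimately have "(\<lambda>x. u x * v x) \<in> \<F>" using domain_cong by blast
  moreover have "AE x in \<mu>. \<bar>u x * v x\<bar> \<le> \<bar>A\<bar> * \<bar>B\<bar>"
    using AB by eventually_elim (auto simp: abs_mult intro!: mult_mono)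
  ultimately show ?thesis by (auto simp: Linf_def)
qed

end

section \<open>Mass loss of the semigroup\<close>

locale sigma_finite_dirichlet_semigroup =
  dirichlet_semigroup \<mu> \<E> \<F> T + sigma_finite_measure \<mu>
  for \<mu> :: "'a measure" and \<E> \<F> T
begin

text \<open>The constant 1 need not be in \<open>L2\<close>, so pair with indicators of an
  exhausting sequence: by symmetry the mass of \<open>T t h\<close> on \<open>A i\<close> is the
  pairing of h with the image of an indicator, which is at most 1. Monotone convergence gives the
  rest.\<close>

lemma
  assumes h: "h \<in> L2 \<mu>" "integrable \<mu> h" "AE x in \<mu>. 0 \<le> h x" and t: "t > 0"
  shows sg_integrable: "integrable \<mu> (T t h)"
    and sg_integral_le: "(\<integral>x. T t h x \<partial>\<mu>) \<le> (\<integral>x. h x \<partial>\<mu>)"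
proof -
  obtain A :: "nat \<Rightarrow> 'a set" where A: "range A \<subseteq> sets \<mu>" "(\<Union>i. A i) = space \<mu>"
    "\<And>i. emeasure \<mu> (A i) \<noteq> \<infinity>" "incseq A"
    using sigma_finite_incseq by blast
  have LA: "indicat_real (A i) \<in> L2 \<mu>" for i
    using A by (intro indicator_L2) (auto simp: less_top)
  have LT: "T t h \<in> L2 \<mu>" using sg_L2[OF t h(1)] .
  have nn: "AE x in \<mu>. 0 \<le> T t h x" using sg_nonneg h t by blast
  let ?f = "\<lambda>i x. T t h x * indicat_real (A i) x"
  have int: "integrable \<mu> (?f i)" for i using LT LA by (rule L2_integrable_mult)
  have le: "integral\<^sup>L \<mu> (?f i) \<le> integral\<^sup>L \<mu> h" for i
  proof -
    have "AE x in \<mu>. T t (indicat_real (A i)) x \<le> 1"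
      by (rule sg_le[OF LA]) (use t in \<open>auto simp: indicator_def\<close>)
    have "integral\<^sup>L \<mu> (?f i) = ip h (T t (indicat_real (A i)))"
      using sg_sym[OF t h(1) LA] by (simp add: L2_inner_def)
    also have "\<dots> \<le> integral\<^sup>L \<mu> h"
      unfolding L2_inner_def
    proof (rule integral_mono_AE)
      show "integrable \<mu> (\<lambda>x. h x * T t (indicat_real (A i)) x)"
        using h(1) sg_L2[OF t LA] by (rule L2_integrable_mult)
      show "AE x in \<mu>. h x * T t (indicat_real (A i)) x \<le> h x"
        using \<open>AE x in \<mu>. T t (indicat_real (A i)) x \<le> 1\<close> h(3)
        by eventually_elim (simp add: mult_left_le)
    qed (rule h)
    finally show ?thesis .
  qed
  have mono: "AE x in \<mu>. mono (\<lambda>i. ?f i x)"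
    using nn
  proof eventually_elim
    fix x assume "0 \<le> T t h x"
    then show "mono (\<lambda>i. ?f i x)"
      using A(4) by (auto simp: mono_def incseq_def indicator_def intro!: mult_left_mono)
  qed
  have "incseq (\<lambda>i. integral\<^sup>L \<mu> (?f i))"
  proof (rule incseq_SucI, rule integral_mono_AE[OF int int])
    fix i
    show "AE x in \<mu>. ?f i x \<le> ?f (Suc i) x"
      using mono by eventually_elim (auto simp: mono_def)
  qed
  then obtain L where L: "(\<lambda>i. integral\<^sup>L \<mu> (?f i)) \<longlonglongrightarrow> L"
    using le incseq_convergent[of "\<lambda>i. integral\<^sup>L \<mu> (?f i)" "integral\<^sup>L \<mu> h"] by blast
  have lim: "AE x in \<mu>. (\<lambda>i. ?f i x) \<longlonglongrightarrow> T t h x"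
  proof (rule AE_I2)
    fix x assume "x \<in> space \<mu>"
    then obtain k where k: "x \<in> A k" using A(2) by blast
    have "\<forall>\<^sub>F i in sequentially. ?f i x = T t h x"
      using eventually_ge_at_top[of k]
    proof eventually_elim
      fix i assume "k \<le> i"
      then have "x \<in> A i" using A(4) k unfolding incseq_def by blast
      then show "?f i x = T t h x" by simp
    qed
    then show "(\<lambda>i. ?f i x) \<longlonglongrightarrow> T t h x" by (rule tendsto_eventually)
  qed
  have meas: "T t h \<in> borel_measurable \<mu>" using LT by auto
  note * = integral_monotone_convergence[OF int mono lim L meas]
  show "integrable \<mu> (T t h)"
    by (rule integrable_monotone_convergence[OF int mono lim L meas])
  show "(\<integral>x. T t h x \<partial>\<mu>) \<le> (\<integral>x. h x \<partial>\<mu>)"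
    unfolding * by (rule LIMSEQ_le_const2[OF L]) (use le in auto)
qed

text \<open>
  With \<open>y s = \<integral>f - l \<langle>T\<^sub>s w, \<phi>\<rangle>\<close> one has \<open>y' = l y + l (\<langle>T\<^sub>s f, \<phi>\<rangle> - \<integral>f) \<le> l y\<close>; integrating this
  avoids the Laplace transform of the semigroup.
\<close>

lemma mass_loss:
  assumes f: "f \<in> L2 \<mu>" "integrable \<mu> f" "AE x in \<mu>. 0 \<le> f x"
    and \<phi>: "\<phi> \<in> L2 \<mu>" "AE x in \<mu>. 0 \<le> \<phi> x \<and> \<phi> x \<le> 1"
    and w: "is_resolvent l f w" and l: "0 < l" and t: "0 < t"
  shows "(\<integral>x. f x \<partial>\<mu>) - (\<integral>x. T t f x \<partial>\<mu>) \<le> exp (l * t) * ((\<integral>x. f x \<partial>\<mu>) - l * ip w \<phi>)"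
proof -
  define m where "m = (\<integral>x. f x \<partial>\<mu>)"
  let ?g = "\<lambda>x. l * w x - f x"
  have g: "generates w ?g" by (rule resolvent_generates[OF w f(1)])
  have Lw: "w \<in> L2 \<mu>" "?g \<in> L2 \<mu>" using g by (auto simp: generates_def)
  have pair: "ip q \<phi> \<le> (\<integral>x. q x \<partial>\<mu>)" if "q \<in> L2 \<mu>" "integrable \<mu> q" "AE x in \<mu>. 0 \<le> q x" for q
    unfolding L2_inner_def
  proof (rule integral_mono_AE)
    show "AE x in \<mu>. q x * \<phi> x \<le> q x"
      using that(3) \<phi>(2) by eventually_elim (simp add: mult_left_le)
  qed (use that \<phi> in \<open>auto simp: L2_integrable_mult\<close>)
  have fm: "ip (Tz s f) \<phi> \<le> m" if "0 \<le> s" for s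
  proof (cases "s = 0")
    case True
    then show ?thesis using pair[OF f] by (simp add: Tz_def m_def)
  next
    case False
    with that have s: "s > 0" by simp
    from pair[OF sg_L2[OF s f(1)] sg_integrable[OF f s] sg_nonneg[OF f(1,3) s]]
      sg_integral_le[OF f s] False
    show ?thesis by (simp add: Tz_def m_def)
  qed
  have "m - l * ip (Tz t w) \<phi> \<le> exp (l * t) * (m - l * ip (Tz 0 w) \<phi>)"
  proof (rule generates_euler[OF g t, where N = "\<lambda>s. m - l * ip (Tz s w) \<phi>" and K = "l * nrm \<phi>"])
    fix s h :: real assume s: "0 \<le> s" and h: "0 < h" "h \<le> t"
    let ?r = "nrm (\<lambda>x. T h w x - w x - h * ?g x)"
    let ?R = "\<lambda>x. Tz (s + h) w x - Tz s w x - h * Tz s ?g x"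
    have L: "Tz s w \<in> L2 \<mu>" "Tz (s + h) w \<in> L2 \<mu>" "Tz s ?g \<in> L2 \<mu>" "Tz s f \<in> L2 \<mu>"
      using s h Lw f by (auto intro!: Tz_L2)
    then have LR: "?R \<in> L2 \<mu>" by (intro L2_diff L2_scale)
    have "\<bar>ip ?R \<phi>\<bar> \<le> nrm ?R * nrm \<phi>" by (rule L2_inner_Cauchy_Schwarz[OF LR \<phi>(1)])
    also have "\<dots> \<le> ?r * nrm \<phi>" by (intro mult_right_mono Tz_increment s h Lw) simp
    finally have R: "- ip ?R \<phi> \<le> ?r * nrm \<phi>" by linarith
    have "ip (Tz s ?g) \<phi> = l * ip (Tz s w) \<phi> - ip (Tz s f) \<phi>"
    proof -
      have "AE x in \<mu>. Tz s ?g x = l * Tz s w x - Tz s f x"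
      proof (cases "s = 0")
        case True
        then show ?thesis by (simp add: Tz_def)
      next
        case False
        with s have "s > 0" by simp
        from sg_diff[OF this L2_scale[OF Lw(1)] f(1), of l] sg_scale[OF this Lw(1), of l]
        show ?thesis by eventually_elim (use False in \<open>simp add: Tz_def\<close>)
      qed
      then have "ip (Tz s ?g) \<phi> = ip (\<lambda>x. l * Tz s w x - Tz s f x) \<phi>"
        using L \<phi>(1) by (intro L2_inner_cong) (auto intro!: L2_measurable L2_diff L2_scale)
      then show ?thesis using L \<phi>(1) by (simp add: L2_inner_simps L2_scale)
    qed
    moreover have "ip ?R \<phi> = ip (Tz (s + h) w) \<phi> - ip (Tz s w) \<phi> - h * ip (Tz s ?g) \<phi>"
      using L \<phi>(1) by (simp add: L2_inner_simps L2_scale L2_diff)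
    ultimately have "ip (Tz (s + h) w) \<phi> =
        ip (Tz s w) \<phi> + h * (l * ip (Tz s w) \<phi> - ip (Tz s f) \<phi>) + ip ?R \<phi>"
      by simp
    \<comment> \<open>Replacing the pairing of \<open>Tz s f\<close> with \<phi> by the larger total
      mass m gives the one-sided inequality for y.\<close>
    moreover have "h * (l * ip (Tz s w) \<phi> - m) \<le> h * (l * ip (Tz s w) \<phi> - ip (Tz s f) \<phi>)"
      using fm[OF s] h by (intro mult_left_mono) auto
    ultimately have "ip (Tz s w) \<phi> + h * (l * ip (Tz s w) \<phi> - m) - ?r * nrm \<phi> \<le> ip (Tz (s + h) w) \<phi>"
      using R by linarith
    from mult_left_mono[OF this, of l] l
    have "l * ip (Tz s w) \<phi> + l * h * (l * ip (Tz s w) \<phi> - m) - l * nrm \<phi> * ?r \<le> l * ip (Tz (s + h) w) \<phi>"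
      by (simp add: algebra_simps)
    moreover have "0 \<le> l * nrm \<phi> * h\<^sup>2" using l by simp
    ultimately show "m - l * ip (Tz (s + h) w) \<phi> \<le> (1 + l * h) * (m - l * ip (Tz s w) \<phi>) + l * nrm \<phi> * (?r + h\<^sup>2)"
      by (simp add: algebra_simps)
  qed (use l in auto)
  \<comment> \<open>The end value is traded for the mass of \<open>T t f\<close>:
    \<open>T t w\<close> is the resolvent of \<open>T t f\<close>, symmetry moves the resolvent onto
    \<phi>, and there l q \<le> 1 by the maximum principle.\<close>
  moreover have "l * ip (T t w) \<phi> \<le> (\<integral>x. T t f x \<partial>\<mu>)"
  proof -
    have LT: "T t f \<in> L2 \<mu>" "T t w \<in> L2 \<mu>" "T t ?g \<in> L2 \<mu>" using sg_L2[OF t] f Lw by auto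
    have gT: "generates (T t w) (T t ?g)" by (rule generates_sg[OF g t])
    have ae: "AE x in \<mu>. T t ?g x = l * T t w x - T t f x"
      using sg_diff[OF t L2_scale[OF Lw(1)] f(1), of l] sg_scale[OF t Lw(1), of l]
      by eventually_elim simp
    have "frm l (T t w) v = ip (T t f) v" if v: "v \<in> \<F>" for v
    proof -
      have "ip (T t ?g) v = ip (\<lambda>x. l * T t w x - T t f x) v"
        by (rule L2_inner_cong[OF _ _ _ ae]) (use LT v in \<open>auto intro!: L2_measurable L2_diff L2_scale\<close>)
      also have "\<dots> = l * ip (T t w) v - ip (T t f) v"
        using LT v by (simp add: L2_inner_simps L2_scale F_L2)
      finally show ?thesis using gT v by (simp add: generates_def frm_def)
    qed
    then have resT: "is_resolvent l (T t f) (T t w)" using gT by (simp add: is_resolvent_def generates_def)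
    obtain q where q: "is_resolvent l \<phi> q" using resolvent_exists[OF \<phi>(1) l] by blast
    have Lq: "q \<in> L2 \<mu>" using q by (auto simp: is_resolvent_def)
    have q1: "AE x in \<mu>. q x \<le> 1 / l"
      by (rule resolvent_le[OF q l _ \<phi>(1)]) (use l \<phi>(2) in auto)
    have "l * ip (T t w) \<phi> = l * ip (T t f) q" using resolvent_symmetric[OF resT q] by simp
    also have "\<dots> = (\<integral>x. l * (T t f x * q x) \<partial>\<mu>)" by (simp add: L2_inner_def)
    also have "\<dots> \<le> (\<integral>x. T t f x \<partial>\<mu>)"
    proof (rule integral_mono_AE)
      show "AE x in \<mu>. l * (T t f x * q x) \<le> T t f x"
        using q1 sg_nonneg[OF f(1,3) t]
      proof eventually_elim
        fix x assume "q x \<le> 1 / l" "0 \<le> T t f x"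
        then have "T t f x * (l * q x) \<le> T t f x * 1"
          using l by (intro mult_left_mono) (auto simp: field_simps)
        then show "l * (T t f x * q x) \<le> T t f x" by (simp add: algebra_simps)
      qed
    qed (use LT Lq sg_integrable[OF f t] in \<open>auto intro!: L2_integrable_mult\<close>)
    finally show ?thesis .
  qed
  ultimately show ?thesis using t by (simp add: Tz_def m_def)
qed

end

section \<open>Calculus of the carre du champ\<close>

locale carre_dirichlet_form = dirichlet_form \<mu> \<E> \<F> + carre_du_champ \<mu> \<E> \<F> \<Gamma>
  for \<mu> :: "'a measure" and \<E> \<F> \<Gamma>
begin

lemma carre_measurable [dest]: "u \<in> \<F> \<Longrightarrow> v \<in> \<F> \<Longrightarrow> \<Gamma> u v \<in> borel_measurable \<mu>"
  using carre_integrable by blast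

lemma carre_add_right:
  assumes "u \<in> \<F>" "v \<in> \<F>" "w \<in> \<F>"
  shows "AE x in \<mu>. \<Gamma> w (\<lambda>y. u y + v y) x = \<Gamma> w u x + \<Gamma> w v x"
  using carre_add[OF assms] carre_sym[OF domain_add[OF assms(1,2)] assms(3)]
    carre_sym[OF assms(1,3)] carre_sym[OF assms(2,3)]
  by eventually_elim simp

lemma carre_scale_right:
  assumes "u \<in> \<F>" "w \<in> \<F>"
  shows "AE x in \<mu>. \<Gamma> w (\<lambda>y. c * u y) x = c * \<Gamma> w u x"
  using carre_scale[OF assms, of c] carre_sym[OF domain_scale[OF assms(1)] assms(2), of c]
    carre_sym[OF assms]
  by eventually_elim simp

lemma carre_expand:
  assumes "u \<in> \<F>" "v \<in> \<F>"
  shows "AE x in \<mu>. \<Gamma> (\<lambda>y. u y + t * v y) (\<lambda>y. u y + t * v y) x =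
    \<Gamma> u u x + 2 * t * \<Gamma> u v x + t\<^sup>2 * \<Gamma> v v x"
  using carre_add[OF assms(1) domain_scale[OF assms(2)] domain_add[OF assms(1) domain_scale[OF assms(2)]], of t t]
    carre_scale[OF assms(2) domain_add[OF assms(1) domain_scale[OF assms(2)]], of t t]
    carre_add_right[OF assms(1) domain_scale[OF assms(2)] assms(1), of t]
    carre_add_right[OF assms(1) domain_scale[OF assms(2)] assms(2), of t]
    carre_scale_right[OF assms(2,1), of t] carre_scale_right[OF assms(2,2), of t] carre_sym[OF assms]
  by eventually_elim (simp add: power2_eq_square algebra_simps)

lemma carre_zero_left: "w \<in> \<F> \<Longrightarrow> AE x in \<mu>. \<Gamma> (\<lambda>y. 0) w x = 0"
  using carre_scale[OF domain_zero, of w 0] by simp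

lemma carre_sum:
  assumes "\<And>i. i \<in> I \<Longrightarrow> u i \<in> \<F>" "w \<in> \<F>"
  shows "AE x in \<mu>. \<Gamma> (\<lambda>y. \<Sum>i\<in>I. u i y) w x = (\<Sum>i\<in>I. \<Gamma> (u i) w x)"
  using assms
proof (induction I rule: infinite_finite_induct)
  case (insert i I)
  have F: "u i \<in> \<F>" "(\<lambda>y. \<Sum>i\<in>I. u i y) \<in> \<F>" using insert by (auto intro: F_sum)
  have "AE x in \<mu>. \<Gamma> (\<lambda>y. \<Sum>i\<in>I. u i y) w x = (\<Sum>i\<in>I. \<Gamma> (u i) w x)" using insert by auto
  with carre_add[OF F insert.prems(2)] show ?case
    by eventually_elim (simp add: insert)
qed (auto simp: carre_zero_left)

lemma carre_le_double:
  assumes "u \<in> \<F>" "v \<in> \<F>"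
  shows "AE x in \<mu>. \<Gamma> (\<lambda>y. u y - v y) (\<lambda>y. u y - v y) x \<le> 2 * \<Gamma> u u x + 2 * \<Gamma> v v x"
  using carre_expand[OF assms, of 1] carre_expand[OF assms, of "-1"]
    carre_nonneg[OF domain_add[OF assms(1) domain_scale[OF assms(2)]], of 1]
  by eventually_elim simp

text \<open>The exceptional null set depends on t, so one weighted Young inequality per t is used in
  place of a pointwise Cauchy-Schwarz inequality.\<close>

lemma carre_young:
  assumes "u \<in> \<F>" "v \<in> \<F>" "0 < t"
  shows "AE x in \<mu>. 2 * \<bar>\<Gamma> u v x\<bar> \<le> t * \<Gamma> u u x + \<Gamma> v v x / t"
  using carre_expand[OF assms(1,2), of "1 / t"] carre_expand[OF assms(1,2), of "- (1 / t)"]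
    carre_nonneg[OF domain_add[OF assms(1) domain_scale[OF assms(2)]], of "1 / t"]
    carre_nonneg[OF domain_add[OF assms(1) domain_scale[OF assms(2)]], of "- (1 / t)"]
proof eventually_elim
  case (elim x)
  have "0 \<le> t * (\<Gamma> u u x + 2 * (1 / t) * \<Gamma> u v x + (1 / t)\<^sup>2 * \<Gamma> v v x)"
    "0 \<le> t * (\<Gamma> u u x + 2 * - (1 / t) * \<Gamma> u v x + (- (1 / t))\<^sup>2 * \<Gamma> v v x)"
    using elim assms(3) by (intro mult_nonneg_nonneg; simp)+
  then have "0 \<le> t * \<Gamma> u u x + 2 * \<Gamma> u v x + \<Gamma> v v x / t"
    "0 \<le> t * \<Gamma> u u x - 2 * \<Gamma> u v x + \<Gamma> v v x / t"
    using assms(3) by (simp_all add: power2_eq_square distrib_left right_diff_distrib)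
  then show ?case by linarith
qed

text \<open>Countably many weights Suc n share one null set; where \<open>\<Gamma> u u\<close>
  vanishes, the surviving term \<open>\<Gamma> v v\<close> / Suc n tends to 0.\<close>

lemma carre_zero:
  assumes "u \<in> \<F>" "v \<in> \<F>"
  shows "AE x in \<mu>. \<Gamma> u u x = 0 \<longrightarrow> \<Gamma> u v x = 0"
proof -
  have "AE x in \<mu>. \<forall>n::nat. 2 * \<bar>\<Gamma> u v x\<bar> \<le> real (Suc n) * \<Gamma> u u x + \<Gamma> v v x / real (Suc n)"
    unfolding AE_all_countable by (intro allI carre_young assms) simp
  then show ?thesis
  proof (eventually_elim, intro impI)
    fix x
    assume *: "\<forall>n::nat. 2 * \<bar>\<Gamma> u v x\<bar> \<le> real (Suc n) * \<Gamma> u u x + \<Gamma> v v x / real (Suc n)"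
      and 0: "\<Gamma> u u x = 0"
    have "(\<lambda>n. \<Gamma> v v x / real (Suc n)) \<longlonglongrightarrow> 0"
      using tendsto_mult_left[OF LIMSEQ_inverse_real_of_nat, of "\<Gamma> v v x"] by (simp add: divide_inverse)
    then have "2 * \<bar>\<Gamma> u v x\<bar> \<le> 0"
      by (rule LIMSEQ_le_const) (use * 0 in auto)
    then show "\<Gamma> u v x = 0" by simp
  qed
qed

text \<open>Integrating Young's inequality for every t > 0 gives a nonnegative quadratic in t, and
  the discriminant does the rest; for t \<ge> 0 in that quadratic nothing is to be shown.\<close>

lemma carre_abs_integral_le:
  assumes "u \<in> \<F>" "v \<in> \<F>"
  shows "(\<integral>x. \<bar>\<Gamma> u v x\<bar> \<partial>\<mu>) \<le> sqrt (\<E> u u) * sqrt (\<E> v v)"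
proof -
  let ?A = "\<integral>x. \<bar>\<Gamma> u v x\<bar> \<partial>\<mu>"
  have A: "0 \<le> ?A" by simp
  note int = carre_integrable[OF assms] carre_integrable[OF assms(1,1)] carre_integrable[OF assms(2,2)]
  have young: "2 * ?A \<le> t * \<E> u u + \<E> v v / t" if "t > 0" for t
  proof -
    have "(\<integral>x. 2 * \<bar>\<Gamma> u v x\<bar> \<partial>\<mu>) \<le> (\<integral>x. t * \<Gamma> u u x + \<Gamma> v v x / t \<partial>\<mu>)"
      by (rule integral_mono_AE) (use int carre_young[OF assms that] in auto)
    then show ?thesis using int by (simp add: carre_form assms)
  qed
  have "?A\<^sup>2 \<le> \<E> v v * \<E> u u"
  proof (rule nonneg_quadratic_imp_le)
    fix t
    show "0 \<le> \<E> v v + 2 * t * ?A + t\<^sup>2 * \<E> u u"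
    proof (cases "t \<ge> 0")
      case True
      then show ?thesis using A by (simp add: form_nonneg assms)
    next
      case False
      define s where "s = - t"
      have s: "s > 0" using False by (simp add: s_def)
      have "s * (2 * ?A) \<le> s * (s * \<E> u u + \<E> v v / s)"
        using s by (intro mult_left_mono young) auto
      also have "\<dots> = s\<^sup>2 * \<E> u u + \<E> v v" using s by (simp add: power2_eq_square distrib_left)
      finally show ?thesis by (simp add: s_def)
    qed
  qed (simp add: form_nonneg assms)
  from real_sqrt_le_mono[OF this] A show ?thesis by (simp add: real_sqrt_mult mult.commute)
qed

end

text \<open>Compactness of closed balls about all centres is assumed here because the local
  arguments use balls about arbitrary points; in the theorem it is derived from the balls about
  \<open>x\<^sub>0\<close>.\<close>

locale local_dirichlet_form =
  regular_dirichlet_form \<mu> \<E> \<F> + carre_du_champ \<mu> \<E> \<F> \<Gamma>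
  for \<mu> :: "'a::{metric_space, second_countable_topology} measure" and \<E> \<F> \<Gamma> +
  assumes sets_eq_borel: "sets \<mu> = sets borel"
    and local: "strongly_local \<mu> \<E> \<F>"
    and compact_cball: "compact (cball (p::'a) r)"
begin

sublocale carre_dirichlet_form ..

lemma borel_measurable_continuous: "continuous_on UNIV f \<Longrightarrow> f \<in> borel_measurable \<mu>"
  for f :: "'a \<Rightarrow> real"
  using borel_measurable_continuous_onI measurable_cong_sets[OF sets_eq_borel refl] by blast

lemma open_sets: "open U \<Longrightarrow> U \<in> sets \<mu>"
  by (simp add: sets_eq_borel)

section \<open>Cutoff functions and locality of the energy density\<close>

text \<open>Regularity only gives uniform approximation by elements of \<F>. Overshooting,
  subtracting the error and cutting to [0, 1] makes the plateau and the zero set exact.\<close>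

lemma bump:
  assumes "0 < r" "r < R"
  obtains \<psi> where "\<psi> \<in> \<F>" "continuous_on UNIV \<psi>" "\<And>x. 0 \<le> \<psi> x" "\<And>x. \<psi> x \<le> 1"
    "\<And>x. dist x p \<le> r \<Longrightarrow> \<psi> x = 1" "\<And>x. R \<le> dist x p \<Longrightarrow> \<psi> x = 0"
proof -
  \<comment> \<open>Height 2 with error below 1/2: on the inner ball the approximation minus 1/2
    exceeds 1, outside it is negative.\<close>
  define t where "t x = 2 * min (max ((R - dist x p) / (R - r)) 0) 1" for x
  have cont: "continuous_on UNIV t"
    unfolding t_def using assms by (intro continuous_intros) auto
  have t0: "t x = 0" if "R \<le> dist x p" for x
  proof -
    have "(R - dist x p) / (R - r) \<le> 0" using that assms by (simp add: field_simps)
    then show ?thesis by (simp add: t_def)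
  qed
  then have "{x. t x \<noteq> 0} \<subseteq> cball p R"
    by (metis (mono_tags, lifting) dist_commute linear mem_Collect_eq mem_cball subsetI)
  then have "closure {x. t x \<noteq> 0} \<subseteq> cball p R" by (rule closure_minimal) simp
  then have "compact (closure {x. t x \<noteq> 0})"
    using compact_Int_closed[OF compact_cball[of p R], of "closure {x. t x \<noteq> 0}"]
    by (simp add: inf.absorb2)
  with cont have "t \<in> Cc" by (simp add: Cc_def)
  from core_dense_Cc[OF this, of "1/2"] obtain \<phi> where \<phi>: "\<phi> \<in> \<F>" "\<phi> \<in> Cc" "\<And>x. \<bar>t x - \<phi> x\<bar> < 1/2"
    by auto
  define \<psi> where "\<psi> x = min (max (max (\<phi> x - 1/2) 0) 0) 1" for x
  have "\<psi> \<in> \<F>" unfolding \<psi>_def by (intro F_cut form_excess \<phi>) auto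
  moreover have "continuous_on UNIV \<psi>"
    unfolding \<psi>_def using \<phi>(2) by (intro continuous_intros) (auto simp: Cc_def)
  moreover have "\<psi> x = 1" if "dist x p \<le> r" for x
  proof -
    have "(R - dist x p) / (R - r) \<ge> 1" using that assms by (simp add: field_simps)
    then have "t x = 2" by (simp add: t_def)
    then show ?thesis using \<phi>(3)[of x] by (simp add: \<psi>_def min_def max_def abs_if split: if_splits)
  qed
  moreover have "\<psi> x = 0" if "R \<le> dist x p" for x
    using \<phi>(3)[of x] t0[OF that] by (simp add: \<psi>_def)
  ultimately show ?thesis using that[of \<psi>] by (auto simp: \<psi>_def)
qed

lemma form_local:
  assumes "u \<in> \<F>" "v \<in> \<F>" "open W" "closed S" "S \<subseteq> W"
    "AE x in \<mu>. x \<notin> S \<longrightarrow> v x = 0" "AE x in \<mu>. x \<in> W \<longrightarrow> u x = c"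
  shows "\<E> u v = 0"
proof -
  have "supp \<mu> v \<subseteq> S"
  proof
    fix x assume x: "x \<in> supp \<mu> v"
    show "x \<in> S"
    proof (rule ccontr)
      assume "x \<notin> S"
      then have "open (- S)" "x \<in> - S" using assms(4) by auto
      with x assms(6) show False unfolding supp_def by auto
    qed
  qed
  with assms local show ?thesis unfolding strongly_local_def by blast
qed

text \<open>An uncountable union of null sets is avoided by Lindelof.\<close>

lemma AE_open_cover:
  assumes "\<And>p. p \<in> V \<Longrightarrow> \<exists>U. open U \<and> p \<in> U \<and> (AE x in \<mu>. x \<in> U \<longrightarrow> P x)"
  shows "AE x in \<mu>. x \<in> V \<longrightarrow> P x"
proof -
  obtain U where U: "\<And>p. p \<in> V \<Longrightarrow> open (U p) \<and> p \<in> U p \<and> (AE x in \<mu>. x \<in> U p \<longrightarrow> P x)"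
    using assms by metis
  obtain \<U> where \<U>: "\<U> \<subseteq> U ` V" "countable \<U>" "\<Union>\<U> = \<Union>(U ` V)"
    using Lindelof[of "U ` V"] U by blast
  have "AE x in \<mu>. \<forall>A\<in>\<U>. x \<in> A \<longrightarrow> P x"
    unfolding AE_ball_countable[OF \<U>(2)] using \<U>(1) U by auto
  then show ?thesis
  proof (eventually_elim, intro impI)
    fix x assume *: "\<forall>A\<in>\<U>. x \<in> A \<longrightarrow> P x" "x \<in> V"
    then have "x \<in> \<Union>\<U>" using U \<U>(3) by blast
    with * show "P x" by blast
  qed
qed

text \<open>In \<open>carre_energy\<close> with u = v = z and a bump h supported in V, all terms on
  the left vanish by strong locality, since z and z^2 are constant on V. So the integral of h
  \<Gamma>(z, z) is 0.\<close>

lemma carre_const_bounded: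
  assumes z: "z \<in> \<F> \<inter> Linf \<mu>" and V: "open V" and c: "AE x in \<mu>. x \<in> V \<longrightarrow> z x = c"
  shows "AE x in \<mu>. x \<in> V \<longrightarrow> \<Gamma> z z x = 0"
proof (rule AE_open_cover)
  fix p assume "p \<in> V"
  then obtain R where R: "R > 0" "cball p R \<subseteq> V" using V open_contains_cball by blast
  obtain h where h: "h \<in> \<F>" "continuous_on UNIV h" "\<And>x. 0 \<le> h x" "\<And>x. h x \<le> 1"
    "\<And>x. dist x p \<le> R / 2 \<Longrightarrow> h x = 1" "\<And>x. R \<le> dist x p \<Longrightarrow> h x = 0"
    using bump[of "R / 2" R p] R by auto
  have hL: "h \<in> \<F> \<inter> Linf \<mu>" using h(1,3,4) by (auto intro!: Linf_I[where B = 1])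
  have zF: "z \<in> \<F>" using z by simp
  have zh: "(\<lambda>x. z x * h x) \<in> \<F>" "(\<lambda>x. z x * z x) \<in> \<F>"
    using F_mult[OF z hL] F_mult[OF z z] by auto
  have out: "h x = 0" if "x \<notin> cball p R" for x using that h(6)[of x] by (simp add: dist_commute)
  have "\<E> z (\<lambda>x. z x * h x) = 0"
    by (rule form_local[OF zF zh(1) V closed_cball R(2) _ c]) (use out in auto)
  moreover have "\<E> (\<lambda>x. z x * z x) h = 0"
  proof (rule form_local[OF zh(2) h(1) V closed_cball R(2), where c = "c * c"])
    show "AE x in \<mu>. x \<in> V \<longrightarrow> z x * z x = c * c" using c by eventually_elim auto
  qed (use out in auto)
  ultimately have 0: "(\<integral>x. h x * \<Gamma> z z x \<partial>\<mu>) = 0"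
    using carre_energy[OF z z hL] form_sym[OF zF zh(1)] by simp
  have nn: "AE x in \<mu>. 0 \<le> h x * \<Gamma> z z x"
    using carre_nonneg[OF zF] by eventually_elim (simp add: h(3))
  have int: "integrable \<mu> (\<lambda>x. h x * \<Gamma> z z x)"
    by (rule integrable_bounded_mult[where B = 1]) (use carre_integrable[OF zF zF] h in auto)
  have "AE x in \<mu>. h x * \<Gamma> z z x = 0"
    using integral_nonneg_eq_0_iff_AE[OF int nn] 0 by simp
  then have "AE x in \<mu>. x \<in> ball p (R / 2) \<longrightarrow> \<Gamma> z z x = 0"
  proof (eventually_elim, intro impI)
    fix x assume "h x * \<Gamma> z z x = 0" "x \<in> ball p (R / 2)"
    then show "\<Gamma> z z x = 0" using h(5)[of x] by (simp add: dist_commute)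
  qed
  then show "\<exists>U. open U \<and> p \<in> U \<and> (AE x in \<mu>. x \<in> U \<longrightarrow> \<Gamma> z z x = 0)"
    using R by (intro exI[of _ "ball p (R / 2)"]) auto
qed

text \<open>Truncations of z are bounded and still constant on V. They converge strongly, since
  truncation does not raise the energy, and on V the density of z is at most twice that of the
  vanishing remainder.\<close>

lemma carre_const_nonneg:
  assumes z: "z \<in> \<F>" "\<And>x. 0 \<le> z x" and V: "open V" and c: "AE x in \<mu>. x \<in> V \<longrightarrow> z x = c"
  shows "AE x in \<mu>. x \<in> V \<longrightarrow> \<Gamma> z z x = 0"
proof -
  let ?z = "\<lambda>n::nat. \<lambda>x. min (z x) (real n + 1)"
  let ?d = "\<lambda>n x. z x - ?z n x"
  have zF: "?z n \<in> \<F>" "\<E> (?z n) (?z n) \<le> \<E> z z" for n by (intro F_trunc z; simp)+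
  have dF: "?d n \<in> \<F>" for n by (intro F_diff z zF)
  have lim: "(\<lambda>n. \<E> (?d n) (?d n)) \<longlonglongrightarrow> 0"
    by (rule strong_convergence[OF zF z(1)])
      (use cut_tendsto_pos_part[OF F_L2[OF z(1)]] z(2) in \<open>simp add: max_absorb1\<close>)
  have 0: "AE x in \<mu>. x \<in> V \<longrightarrow> \<Gamma> (?z n) (?z n) x = 0" for n
  proof (rule carre_const_bounded[OF _ V])
    show "?z n \<in> \<F> \<inter> Linf \<mu>"
      using zF(1)[of n] z(2) by (auto intro!: Linf_I[where B = "real n + 1"])
    show "AE x in \<mu>. x \<in> V \<longrightarrow> ?z n x = min c (real n + 1)" using c by eventually_elim auto
  qed
  have le: "AE x in \<mu>. indicat_real V x * \<Gamma> z z x \<le> 2 * \<Gamma> (?d n) (?d n) x" for n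
    using 0[of n] carre_le_double[OF dF[of n] F_minus[OF zF(1)[of n]]]
      carre_scale[OF zF(1)[of n] domain_scale[OF zF(1)[of n]], of "-1" "-1"]
      carre_scale_right[OF zF(1)[of n] zF(1)[of n], of "-1"] carre_nonneg[OF dF[of n]]
    by eventually_elim (auto simp: indicator_def)
  have int: "integrable \<mu> (\<lambda>x. indicat_real V x * \<Gamma> z z x)"
    by (rule integrable_bounded_mult[where B = 1])
      (use carre_integrable[OF z(1) z(1)] open_sets[OF V] in \<open>auto simp: indicator_def\<close>)
  have nn: "AE x in \<mu>. 0 \<le> indicat_real V x * \<Gamma> z z x"
    using carre_nonneg[OF z(1)] by eventually_elim simp
  have "(\<integral>x. indicat_real V x * \<Gamma> z z x \<partial>\<mu>) \<le> 0"
  proof (rule LIMSEQ_le_const)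
    show "(\<lambda>n. 2 * \<E> (?d n) (?d n)) \<longlonglongrightarrow> 0" using tendsto_mult_left[OF lim, of 2] by simp
    have "(\<integral>x. indicat_real V x * \<Gamma> z z x \<partial>\<mu>) \<le> 2 * \<E> (?d n) (?d n)" for n
    proof -
    have "(\<integral>x. indicat_real V x * \<Gamma> z z x \<partial>\<mu>) \<le> (\<integral>x. 2 * \<Gamma> (?d n) (?d n) x \<partial>\<mu>)"
      by (rule integral_mono_AE[OF int _ le]) (simp add: carre_integrable dF)
      then show ?thesis by (simp add: carre_form dF)
    qed
    then show "\<exists>N. \<forall>n\<ge>N. (\<integral>x. indicat_real V x * \<Gamma> z z x \<partial>\<mu>) \<le> 2 * \<E> (?d n) (?d n)" by blast
  qed
  moreover have "0 \<le> (\<integral>x. indicat_real V x * \<Gamma> z z x \<partial>\<mu>)"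
    using nn by (rule integral_nonneg_AE)
  ultimately have "AE x in \<mu>. indicat_real V x * \<Gamma> z z x = 0"
    using integral_nonneg_eq_0_iff_AE[OF int nn] by simp
  then show ?thesis by eventually_elim (auto simp: indicator_def)
qed

text \<open>The positive and negative parts are constant on V too; once \<open>\<Gamma> z z\<close>
  vanishes there, \<open>carre_zero\<close> extends this to every w.\<close>

lemma carre_const_left:
  assumes z: "z \<in> \<F>" and w: "w \<in> \<F>" and V: "open V" and c: "AE x in \<mu>. x \<in> V \<longrightarrow> z x = c"
  shows "AE x in \<mu>. x \<in> V \<longrightarrow> \<Gamma> z w x = 0"
proof -
  let ?p = "\<lambda>x. max (z x) 0" and ?q = "\<lambda>x. max (- z x) 0"
  have F: "?p \<in> \<F>" "?q \<in> \<F>" by (intro F_pos_part F_neg_part z)+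
  have "AE x in \<mu>. x \<in> V \<longrightarrow> \<Gamma> ?p ?p x = 0"
    by (rule carre_const_nonneg[OF F(1) _ V, where c = "max c 0"]) (use c in auto)
  moreover have "AE x in \<mu>. x \<in> V \<longrightarrow> \<Gamma> ?q ?q x = 0"
    by (rule carre_const_nonneg[OF F(2) _ V, where c = "max (- c) 0"]) (use c in auto)
  moreover have eq: "(\<lambda>y. ?p y - ?q y) = z" by (auto simp: fun_eq_iff)
  ultimately show ?thesis
    using carre_le_double[OF F, unfolded eq] carre_zero[OF z w] carre_nonneg[OF z]
    by eventually_elim auto
qed

lemma carre_local:
  assumes "u \<in> \<F>" "u' \<in> \<F>" "w \<in> \<F>" "open V" "AE x in \<mu>. x \<in> V \<longrightarrow> u x = u' x"
  shows "AE x in \<mu>. x \<in> V \<longrightarrow> \<Gamma> u w x = \<Gamma> u' w x"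
proof -
  have "AE x in \<mu>. x \<in> V \<longrightarrow> \<Gamma> (\<lambda>x. u x + -1 * u' x) w x = 0"
    by (rule carre_const_left[where c = 0]) (use assms in \<open>auto intro!: F_intros\<close>)
  with carre_add[OF assms(1) domain_scale[OF assms(2)] assms(3), of "-1"] carre_scale[OF assms(2,3), of "-1"]
  show ?thesis by eventually_elim auto
qed

text \<open>
  A level piece \<open>lev e i \<circ> \<phi>\<close> is constant on the open sets where \<open>\<phi>\<close> is below or above the level,
  so only pieces whose closed level contains \<open>\<phi> x\<close> contribute at \<open>x\<close>, and there the slope of the
  interpolation is close to \<open>h' (\<phi> x)\<close>.
\<close>

lemma carre_interp_close:
  assumes \<phi>: "\<phi> \<in> \<F>" "continuous_on UNIV \<phi>" "\<And>x. 0 \<le> \<phi> x" "\<And>x. \<phi> x \<le> real n * e" and e: "0 < e"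
    and w: "w \<in> \<F>"
    and slope: "\<And>i x. i < n \<Longrightarrow> real i * e \<le> x \<Longrightarrow> x \<le> real (Suc i) * e \<Longrightarrow>
      \<bar>(h (real (Suc i) * e) - h (real i * e)) / e - h' x\<bar> \<le> \<omega>" and \<omega>: "0 \<le> \<omega>"
  shows "AE x in \<mu>. \<bar>\<Gamma> (\<lambda>x. interp h e n (\<phi> x)) w x - h' (\<phi> x) * \<Gamma> \<phi> w x\<bar> \<le>
    \<omega> * ((\<Sum>i<n. \<Gamma> (\<lambda>x. lev e i (\<phi> x)) (\<lambda>x. lev e i (\<phi> x)) x) / 2 + \<Gamma> w w x)"
proof -
  let ?s = "\<lambda>i. (h (real (Suc i) * e) - h (real i * e)) / e"
  let ?l = "\<lambda>i x. lev e i (\<phi> x)"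
  let ?I = "\<lambda>x. {i \<in> {..<n}. real i * e \<le> \<phi> x \<and> \<phi> x \<le> real (Suc i) * e}"
  have lF: "?l i \<in> \<F>" for i by (rule F_lev[OF \<phi>(1,3) e])
  have slF: "(\<lambda>x. ?s i * ?l i x) \<in> \<F>" for i by (rule domain_scale[OF lF])
  have A1: "AE x in \<mu>. \<Gamma> (\<lambda>x. interp h e n (\<phi> x)) w x = (\<Sum>i<n. \<Gamma> (\<lambda>x. ?s i * ?l i x) w x)"
    unfolding interp_def by (rule carre_sum[OF slF w])
  have A2: "AE x in \<mu>. \<forall>i. \<Gamma> (\<lambda>x. ?s i * ?l i x) w x = ?s i * \<Gamma> (?l i) w x"
    unfolding AE_all_countable by (intro allI carre_scale lF w)
  have "(\<lambda>x. \<Sum>i<n. ?l i x) = \<phi>" using \<phi> by (auto simp: sum_lev)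
  with carre_sum[of "{..<n}" ?l, OF lF w]
  have A3: "AE x in \<mu>. \<Gamma> \<phi> w x = (\<Sum>i<n. \<Gamma> (?l i) w x)" by simp
  have A4: "AE x in \<mu>. \<forall>i. \<phi> x < real i * e \<longrightarrow> \<Gamma> (?l i) w x = 0"
    unfolding AE_all_countable
  proof
    fix i
    have "open {x. \<phi> x < real i * e}" using \<phi>(2) by (intro open_Collect_less continuous_intros) auto
    from carre_const_left[OF lF w this, of i 0]
    show "AE x in \<mu>. \<phi> x < real i * e \<longrightarrow> \<Gamma> (?l i) w x = 0" using e by (simp add: lev_below)
  qed
  have A5: "AE x in \<mu>. \<forall>i. real (Suc i) * e < \<phi> x \<longrightarrow> \<Gamma> (?l i) w x = 0"
    unfolding AE_all_countable
  proof
    fix i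
    have "open {x. real (Suc i) * e < \<phi> x}" using \<phi>(2) by (intro open_Collect_less continuous_intros) auto
    from carre_const_left[OF lF w this, of i e]
    show "AE x in \<mu>. real (Suc i) * e < \<phi> x \<longrightarrow> \<Gamma> (?l i) w x = 0" using e by (simp add: lev_above)
  qed
  have A6: "AE x in \<mu>. \<forall>i. 2 * \<bar>\<Gamma> (?l i) w x\<bar> \<le> 1 * \<Gamma> (?l i) (?l i) x + \<Gamma> w w x / 1"
    unfolding AE_all_countable by (intro allI carre_young lF w) simp
  have A7: "AE x in \<mu>. \<forall>i. 0 \<le> \<Gamma> (?l i) (?l i) x"
    unfolding AE_all_countable by (intro allI carre_nonneg lF)
  show ?thesis using A1 A2 A3 A4 A5 A6 A7 carre_nonneg[OF w]
  proof eventually_elim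
    case (elim x)
    let ?g = "\<lambda>i. \<Gamma> (?l i) w x"
    have "\<Gamma> (\<lambda>x. interp h e n (\<phi> x)) w x - h' (\<phi> x) * \<Gamma> \<phi> w x = (\<Sum>i<n. (?s i - h' (\<phi> x)) * ?g i)"
      by (simp only: elim(1,3) elim(2)[rule_format] sum_distrib_left left_diff_distrib sum_subtractf)
    also have "\<dots> = (\<Sum>i\<in>?I x. (?s i - h' (\<phi> x)) * ?g i)"
    proof (rule sum.mono_neutral_right)
      show "\<forall>i\<in>{..<n} - ?I x. (?s i - h' (\<phi> x)) * ?g i = 0"
      proof
        fix i assume "i \<in> {..<n} - ?I x"
        then have "\<phi> x < real i * e \<or> real (Suc i) * e < \<phi> x" by auto
        then show "(?s i - h' (\<phi> x)) * ?g i = 0" using elim(4,5) by auto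
      qed
    qed auto
    finally have "\<bar>\<Gamma> (\<lambda>x. interp h e n (\<phi> x)) w x - h' (\<phi> x) * \<Gamma> \<phi> w x\<bar> \<le>
        (\<Sum>i\<in>?I x. \<bar>(?s i - h' (\<phi> x)) * ?g i\<bar>)" by simp
    also have "\<dots> \<le> (\<Sum>i\<in>?I x. \<omega> * (\<Gamma> (?l i) (?l i) x / 2 + \<Gamma> w w x / 2))"
    proof (rule sum_mono)
      fix i assume "i \<in> ?I x"
      then have "\<bar>?s i - h' (\<phi> x)\<bar> \<le> \<omega>" by (intro slope) auto
      moreover have "\<bar>?g i\<bar> \<le> \<Gamma> (?l i) (?l i) x / 2 + \<Gamma> w w x / 2" using elim(6)[rule_format, of i] by simp
      ultimately show "\<bar>(?s i - h' (\<phi> x)) * ?g i\<bar> \<le> \<omega> * (\<Gamma> (?l i) (?l i) x / 2 + \<Gamma> w w x / 2)"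
        unfolding abs_mult using \<omega> by (intro mult_mono) auto
    qed
    also have "\<dots> = \<omega> * ((\<Sum>i\<in>?I x. \<Gamma> (?l i) (?l i) x) / 2 + real (card (?I x)) * (\<Gamma> w w x / 2))"
      by (simp add: sum.distrib flip: sum_distrib_left sum_divide_distrib)
    \<comment> \<open>At most two levels are active at x. The level densities are enlarged to the
      sum over all levels, because that sum integrates to at most
      \<open>\<E> \<phi> \<phi>\<close>.\<close>
    also have "\<dots> \<le> \<omega> * ((\<Sum>i<n. \<Gamma> (?l i) (?l i) x) / 2 + 2 * (\<Gamma> w w x / 2))"
    proof (intro mult_left_mono[OF _ \<omega>] add_mono divide_right_mono mult_right_mono)
      show "(\<Sum>i\<in>?I x. \<Gamma> (?l i) (?l i) x) \<le> (\<Sum>i<n. \<Gamma> (?l i) (?l i) x)"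
        using elim(7) by (intro sum_mono2) auto
      show "real (card (?I x)) \<le> 2" using card_levels_le[OF e, of n "\<phi> x"] by linarith
    qed (use elim(8) in auto)
    finally show ?case by simp
  qed
qed

text \<open>Interpolants of h converge to h \<circ> \<phi> only weakly in \<F>, so the densities are
  compared after integration against a fixed bounded g. With g the sign of the defect D this already
  yields that the integral of |D| is 0.\<close>

lemma chain_rule:
  assumes \<phi>: "\<phi> \<in> \<F>" "continuous_on UNIV \<phi>" "\<And>x. 0 \<le> \<phi> x" "\<And>x. \<phi> x \<le> M" and M: "0 < M"
    and der: "\<And>y. y \<in> {0..M} \<Longrightarrow> (h has_real_derivative h' y) (at y within {0..M})"
    and cont: "continuous_on {0..M} h'" and h0: "h 0 = 0"
  shows "(\<lambda>x. h (\<phi> x)) \<in> \<F>"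
    and "w \<in> \<F> \<Longrightarrow> AE x in \<mu>. \<Gamma> (\<lambda>x. h (\<phi> x)) w x = h' (\<phi> x) * \<Gamma> \<phi> w x"
proof -
  have "bounded (h' ` {0..M})" by (intro compact_imp_bounded compact_continuous_image cont) simp
  then obtain S where S: "\<And>y. y \<in> {0..M} \<Longrightarrow> \<bar>h' y\<bar> \<le> S"
    unfolding bounded_iff by (metis imageI real_norm_def)
  have S0: "0 \<le> S" using S[of 0] M by auto
  have lip: "S-lipschitz_on {0..M} h"
  proof (rule lipschitz_onI[OF _ S0])
    fix x y assume "x \<in> {0..M}" "y \<in> {0..M}"
    then show "dist (h x) (h y) \<le> S * dist x y"
      using field_differentiable_bound[of "{0..M}" h h' S x y] der S by (auto simp: dist_norm)
  qed
  show hF: "(\<lambda>x. h (\<phi> x)) \<in> \<F>" by (rule F_lipschitz[OF \<phi>(1,3,4) M lip h0])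
  assume w: "w \<in> \<F>"
  define e where "e n = M / real (Suc n)" for n
  have e: "0 < e n" "real (Suc n) * e n = M" for n using M by (auto simp: e_def)
  have lip': "S-lipschitz_on {0..real (Suc n) * e n} h" for n using lip by (simp only: e)
  have \<phi>M: "\<phi> x \<le> real (Suc n) * e n" for x n using \<phi>(4) by (simp only: e)
  let ?U = "\<lambda>n x. interp h (e n) (Suc n) (\<phi> x)"
  have UF: "?U n \<in> \<F>" "\<E> (?U n) (?U n) \<le> S\<^sup>2 * \<E> \<phi> \<phi>" for n
    by (rule F_interp[OF \<phi>(1,3) \<phi>M e(1) lip'], rule form_interp_le[OF \<phi>(1,3) \<phi>M e(1) lip'])
  have lim: "(\<lambda>n. nrm (\<lambda>x. ?U n x - h (\<phi> x))) \<longlonglongrightarrow> 0"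
    using interp_tendsto[OF \<phi>(1,3,4) M lip h0] by (simp only: e_def)
  have h\<phi>: "(\<lambda>x. h' (\<phi> x)) \<in> borel_measurable \<mu>"
    by (intro borel_measurable_continuous continuous_on_compose2[OF cont \<phi>(2)]) (use \<phi> in auto)
  have int\<phi>: "integrable \<mu> (\<lambda>x. h' (\<phi> x) * \<Gamma> \<phi> w x)"
    by (rule integrable_bounded_mult[OF carre_integrable[OF \<phi>(1) w] h\<phi>, where B = S])
      (use S \<phi> in auto)
  define D where "D x = \<Gamma> (\<lambda>x. h (\<phi> x)) w x - h' (\<phi> x) * \<Gamma> \<phi> w x" for x
  have intD: "integrable \<mu> D"
    unfolding D_def by (intro Bochner_Integration.integrable_diff int\<phi> carre_integrable hF w)
  define g :: "'a \<Rightarrow> real" where "g x = (if D x > 0 then 1 else if D x < 0 then -1 else 0)" for x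
  have g_meas: "g \<in> borel_measurable \<mu>"
    unfolding g_def using intD[THEN borel_measurable_integrable] by measurable
  have g1: "\<bar>g x\<bar> \<le> 1" for x by (simp add: g_def)
  have g_int: "integrable \<mu> (\<lambda>x. g x * f x)" if "integrable \<mu> f" for f
    by (rule integrable_bounded_mult[OF that g_meas, where B = 1]) (use g1 in auto)
  let ?L = "\<lambda>z. \<integral>x. g x * \<Gamma> z w x \<partial>\<mu>"
  have L_lim: "(\<lambda>n. ?L (?U n)) \<longlonglongrightarrow> ?L (\<lambda>x. h (\<phi> x))"
  proof (rule weak_convergence[OF UF F_L2[OF hF] lim, where D = "sqrt (\<E> w w)"])
    show "?L (\<lambda>x. u x + v x) = ?L u + ?L v" if "u \<in> \<F>" "v \<in> \<F>" for u v
    proof -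
      have "?L (\<lambda>x. u x + v x) = (\<integral>x. g x * \<Gamma> u w x + g x * \<Gamma> v w x \<partial>\<mu>)"
      proof (rule integral_cong_AE)
        show "AE x in \<mu>. g x * \<Gamma> (\<lambda>x. u x + v x) w x = g x * \<Gamma> u w x + g x * \<Gamma> v w x"
          using carre_add[OF that w] by eventually_elim (simp add: distrib_left)
      qed (use that w domain_add[OF that] g_meas in \<open>auto intro!: borel_measurable_times borel_measurable_add\<close>)
      then show ?thesis by (simp add: g_int carre_integrable that w)
    qed
    show "?L (\<lambda>x. c * u x) = c * ?L u" if "u \<in> \<F>" for u c
    proof -
      have "?L (\<lambda>x. c * u x) = (\<integral>x. c * (g x * \<Gamma> u w x) \<partial>\<mu>)"
      proof (rule integral_cong_AE)
        show "AE x in \<mu>. g x * \<Gamma> (\<lambda>x. c * u x) w x = c * (g x * \<Gamma> u w x)"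
          using carre_scale[OF that w, of c] by eventually_elim simp
      qed (use that w domain_scale[OF that] g_meas in \<open>auto intro!: borel_measurable_times\<close>)
      then show ?thesis by simp
    qed
    show "\<bar>?L u\<bar> \<le> sqrt (\<E> w w) * sqrt (frm 1 u u)" if u: "u \<in> \<F>" for u
    proof -
      have "\<bar>?L u\<bar> \<le> (\<integral>x. \<bar>g x * \<Gamma> u w x\<bar> \<partial>\<mu>)" by (rule integral_abs_bound)
      also have "\<dots> \<le> (\<integral>x. \<bar>\<Gamma> u w x\<bar> \<partial>\<mu>)"
        by (intro integral_mono integrable_abs g_int carre_integrable u w)
          (simp add: abs_mult mult_left_le_one_le g1)
      also have "\<dots> \<le> sqrt (\<E> u u) * sqrt (\<E> w w)" by (rule carre_abs_integral_le[OF u w])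
      also have "\<dots> \<le> sqrt (frm 1 u u) * sqrt (\<E> w w)"
        by (intro mult_right_mono sqrt_form_le_frm u) (simp add: form_nonneg w)
      finally show ?thesis by (simp add: mult.commute)
    qed
  qed
  have "(\<lambda>n. ?L (?U n) - (\<integral>x. g x * (h' (\<phi> x) * \<Gamma> \<phi> w x) \<partial>\<mu>)) \<longlonglongrightarrow> 0"
  proof (rule LIMSEQ_I)
    fix \<epsilon> :: real assume \<epsilon>: "\<epsilon> > 0"
    \<comment> \<open>The factor of \<omega> in the integrated error; the added 1 makes it positive
      and the final inequality strict.\<close>
    define C where "C = \<E> \<phi> \<phi> / 2 + \<E> w w + 1"
    have C: "C > 0" using form_nonneg[OF \<phi>(1)] form_nonneg[OF w] by (simp add: C_def)
    define \<omega> where "\<omega> = \<epsilon> / (2 * C)"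
    have \<omega>: "\<omega> > 0" using \<epsilon> C by (simp add: \<omega>_def)
    have "uniformly_continuous_on {0..M} h'" by (rule compact_uniformly_continuous[OF cont]) simp
    then obtain \<delta> where \<delta>: "\<delta> > 0" "\<And>x y. x \<in> {0..M} \<Longrightarrow> y \<in> {0..M} \<Longrightarrow> dist x y < \<delta> \<Longrightarrow> dist (h' x) (h' y) < \<omega>"
      unfolding uniformly_continuous_on_def using \<omega> by blast
    have "e \<longlonglongrightarrow> 0"
      using tendsto_mult_left[OF LIMSEQ_inverse_real_of_nat, of M] by (simp add: e_def[abs_def] divide_inverse)
    from order_tendstoD(2)[OF this \<delta>(1)] obtain N where N: "\<And>n. n \<ge> N \<Longrightarrow> e n < \<delta>"
      by (auto simp: eventually_sequentially)
    have "\<bar>?L (?U n) - (\<integral>x. g x * (h' (\<phi> x) * \<Gamma> \<phi> w x) \<partial>\<mu>)\<bar> < \<epsilon>" if "n \<ge> N" for n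
    proof -
      let ?l = "\<lambda>i x. lev (e n) i (\<phi> x)"
      have lF: "?l i \<in> \<F>" for i by (rule F_lev[OF \<phi>(1,3) e(1)])
      have slope: "\<bar>(h (real (Suc i) * e n) - h (real i * e n)) / e n - h' x\<bar> \<le> \<omega>"
        if i: "i < Suc n" and x: "real i * e n \<le> x" "x \<le> real (Suc i) * e n" for i x
      proof -
        let ?a = "real i * e n" and ?b = "real (Suc i) * e n"
        have "?b \<le> real (Suc n) * e n" using i e(1)[of n] by (intro mult_right_mono) auto
        then have ab: "0 \<le> ?a" "?b \<le> M" "?b - ?a = e n" using e[of n] by (auto simp: algebra_simps)
        have "\<bar>(h ?b - h ?a) / (?b - ?a) - h' x\<bar> \<le> \<omega>"
        proof (rule slope_close[where h' = h'])
          have sub: "{?a..?b} \<subseteq> {0..M}" using ab by (simp only: atLeastatMost_subset_iff) simp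
          have xM: "x \<in> {0..M}" using sub x by (meson atLeastAtMost_iff subsetD)
          fix y assume y: "y \<in> {?a..?b}"
          show "(h has_real_derivative h' y) (at y within {?a..?b})"
            by (rule DERIV_subset[OF der sub]) (use y sub in blast)
          have "dist y x < \<delta>" using y x ab(3) N[OF \<open>n \<ge> N\<close>] by (auto simp: dist_real_def)
          then have "dist (h' y) (h' x) < \<omega>" by (intro \<delta>(2)) (use xM y sub in blast)+
          then show "\<bar>h' y - h' x\<bar> \<le> \<omega>" by (simp add: dist_real_def)
        qed (use ab(3) e(1)[of n] in linarith)
        then show ?thesis by (simp only: ab(3))
      qed
      let ?R = "\<lambda>x. \<omega> * ((\<Sum>i<Suc n. \<Gamma> (?l i) (?l i) x) / 2 + \<Gamma> w w x)"
      have intR: "integrable \<mu> ?R"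
        by (intro integrable_mult_right Bochner_Integration.integrable_add integrable_divide
            Bochner_Integration.integrable_sum carre_integrable lF w)
      have close: "AE x in \<mu>. \<bar>\<Gamma> (?U n) w x - h' (\<phi> x) * \<Gamma> \<phi> w x\<bar> \<le> ?R x"
        by (rule carre_interp_close[OF \<phi>(1,2,3) \<phi>M e(1) w slope]) (use \<omega> in auto)
      have intU: "integrable \<mu> (\<Gamma> (?U n) w)" by (intro carre_integrable UF w)
      have "?L (?U n) - (\<integral>x. g x * (h' (\<phi> x) * \<Gamma> \<phi> w x) \<partial>\<mu>) =
          (\<integral>x. g x * (\<Gamma> (?U n) w x - h' (\<phi> x) * \<Gamma> \<phi> w x) \<partial>\<mu>)"
        using g_int[OF intU] g_int[OF int\<phi>] by (simp add: right_diff_distrib)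
      also have "\<bar>\<dots>\<bar> \<le> (\<integral>x. ?R x \<partial>\<mu>)"
      proof (rule order_trans[OF integral_abs_bound], rule integral_mono_AE[OF _ intR])
        show "integrable \<mu> (\<lambda>x. \<bar>g x * (\<Gamma> (?U n) w x - h' (\<phi> x) * \<Gamma> \<phi> w x)\<bar>)"
          by (intro integrable_abs g_int Bochner_Integration.integrable_diff intU int\<phi>)
        show "AE x in \<mu>. \<bar>g x * (\<Gamma> (?U n) w x - h' (\<phi> x) * \<Gamma> \<phi> w x)\<bar> \<le> ?R x"
          using close
        proof eventually_elim
          case (elim x)
          have "\<bar>g x\<bar> * \<bar>\<Gamma> (?U n) w x - h' (\<phi> x) * \<Gamma> \<phi> w x\<bar> \<le> 1 * \<bar>\<Gamma> (?U n) w x - h' (\<phi> x) * \<Gamma> \<phi> w x\<bar>"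
            by (intro mult_right_mono g1) simp
          with elim show ?case by (simp add: abs_mult)
        qed
      qed
      also have "(\<integral>x. ?R x \<partial>\<mu>) = \<omega> * ((\<Sum>i<Suc n. \<E> (?l i) (?l i)) / 2 + \<E> w w)"
        using lF w by (simp only: carre_form integral_mult_right_zero Bochner_Integration.integral_add
            Bochner_Integration.integral_sum integral_divide_zero carre_integrable
            Bochner_Integration.integrable_sum integrable_divide)
      also have "\<dots> \<le> \<omega> * (\<E> \<phi> \<phi> / 2 + \<E> w w)"
      proof -
        \<comment> \<open>Mutual energies of levels are nonnegative, so adding the off-diagonal
          terms only increases the sum, which then is the energy of \<phi>.\<close>
        have "(\<Sum>i<Suc n. \<E> (?l i) (?l i)) \<le> (\<Sum>i<Suc n. \<Sum>j<Suc n. \<E> (?l i) (?l j))"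
        proof (rule sum_mono)
          fix i assume "i \<in> {..<Suc n}"
          then show "\<E> (?l i) (?l i) \<le> (\<Sum>j<Suc n. \<E> (?l i) (?l j))"
            using form_lev_nonneg[OF \<phi>(1,3) e(1)[of n]]
            by (intro member_le_sum[of i "{..<Suc n}" "\<lambda>j. \<E> (?l i) (?l j)"]) auto
        qed
        also have "\<dots> = \<E> (\<lambda>x. \<Sum>i<Suc n. ?l i x) (\<lambda>x. \<Sum>i<Suc n. ?l i x)"
          by (simp only: form_sum form_sum_right lF F_sum)
        also have "(\<lambda>x. \<Sum>i<Suc n. ?l i x) = \<phi>"
          by (rule ext, rule sum_lev) (use \<phi>(3) \<phi>M in auto)
        finally show ?thesis using \<omega> by (intro mult_left_mono add_mono divide_right_mono) auto
      qed
      also have "\<dots> \<le> \<omega> * C" using \<omega> by (intro mult_left_mono) (auto simp: C_def)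
      also have "\<dots> < \<epsilon>" using C \<epsilon> by (simp add: \<omega>_def)
      finally show ?thesis .
    qed
    then show "\<exists>N. \<forall>n\<ge>N. norm (?L (?U n) - (\<integral>x. g x * (h' (\<phi> x) * \<Gamma> \<phi> w x) \<partial>\<mu>) - 0) < \<epsilon>" by auto
  qed
  then have "?L (\<lambda>x. h (\<phi> x)) = (\<integral>x. g x * (h' (\<phi> x) * \<Gamma> \<phi> w x) \<partial>\<mu>)"
    using LIMSEQ_unique[OF L_lim] by (simp add: LIM_zero_iff)
  then have "(\<integral>x. g x * D x \<partial>\<mu>) = 0"
    using g_int[OF carre_integrable[OF hF w]] g_int[OF int\<phi>] by (simp add: D_def right_diff_distrib)
  moreover have "(\<lambda>x. g x * D x) = (\<lambda>x. \<bar>D x\<bar>)" by (auto simp: g_def fun_eq_iff)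
  ultimately have "(\<integral>x. \<bar>D x\<bar> \<partial>\<mu>) = 0" by simp
  then have "AE x in \<mu>. \<bar>D x\<bar> = 0"
    using integral_nonneg_eq_0_iff_AE[of \<mu> "\<lambda>x. \<bar>D x\<bar>"] intD by simp
  then show "AE x in \<mu>. \<Gamma> (\<lambda>x. h (\<phi> x)) w x = h' (\<phi> x) * \<Gamma> \<phi> w x"
    by eventually_elim (simp add: D_def)
qed

end

section \<open>Weighted energy estimates\<close>

context local_dirichlet_form
begin

lemma carre_square:
  assumes \<kappa>: "\<kappa> \<in> \<F>" "continuous_on UNIV \<kappa>" "\<And>x. 0 \<le> \<kappa> x" "\<And>x. \<kappa> x \<le> M" "0 < M"
    and w: "w \<in> \<F>"
  shows "AE x in \<mu>. \<Gamma> (\<lambda>x. (\<kappa> x)\<^sup>2) w x = 2 * \<kappa> x * \<Gamma> \<kappa> w x"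
  by (rule chain_rule(2)[OF \<kappa> _ _ _ w, where h = "\<lambda>y. y\<^sup>2" and h' = "\<lambda>y. 2 * y"])
    (auto intro!: derivative_eq_intros continuous_intros)

text \<open>A product rule for \<Gamma> is bypassed: three instances of \<open>carre_energy\<close>
  express everything through integrals, and only the square of the continuous \<kappa> needs the
  chain rule. Eliminating the mixed integral of \<kappa> w \<Gamma>(\<kappa>, w) leaves the
  identity.\<close>

lemma form_mult_square:
  assumes \<kappa>: "\<kappa> \<in> \<F>" "continuous_on UNIV \<kappa>" "\<And>x. 0 \<le> \<kappa> x" "\<And>x. \<kappa> x \<le> M" "0 < M"
    and w: "w \<in> \<F> \<inter> Linf \<mu>"
  shows "\<E> (\<lambda>x. \<kappa> x * w x) (\<lambda>x. \<kappa> x * w x) =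
    \<E> w (\<lambda>x. (\<kappa> x)\<^sup>2 * w x) + (\<integral>x. (w x)\<^sup>2 * \<Gamma> \<kappa> \<kappa> x \<partial>\<mu>)"
proof -
  have \<kappa>L: "\<kappa> \<in> \<F> \<inter> Linf \<mu>" using \<kappa> by (auto intro!: Linf_I[where B = M])
  let ?kw = "\<lambda>x. \<kappa> x * w x" and ?w2 = "\<lambda>x. (w x)\<^sup>2" and ?k2 = "\<lambda>x. (\<kappa> x)\<^sup>2"
  let ?k2w = "\<lambda>x. (\<kappa> x)\<^sup>2 * w x" and ?kw2 = "\<lambda>x. \<kappa> x * (w x)\<^sup>2"
  have kw: "?kw \<in> \<F> \<inter> Linf \<mu>" by (rule F_mult[OF \<kappa>L w])
  have w2: "?w2 \<in> \<F> \<inter> Linf \<mu>" using F_mult[OF w w] by (simp add: power2_eq_square)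
  have k2: "?k2 \<in> \<F> \<inter> Linf \<mu>" using F_mult[OF \<kappa>L \<kappa>L] by (simp add: power2_eq_square)
  have k2w: "?k2w \<in> \<F> \<inter> Linf \<mu>" by (rule F_mult[OF k2 w])
  have eqs: "(\<lambda>x. \<kappa> x * (\<kappa> x * w x)) = ?k2w" "(\<lambda>x. w x * (\<kappa> x * w x)) = ?kw2"
    "(\<lambda>x. w x * w x) = ?w2" "(\<lambda>x. \<kappa> x * \<kappa> x) = ?k2"
    by (auto simp: power2_eq_square)
  have 1: "\<E> ?w2 ?k2 = 2 * (\<integral>x. w x * \<Gamma> ?k2 w x \<partial>\<mu>)"
    using carre_energy[OF k2 w w] by (simp add: eqs)
  have 2: "\<E> ?k2w w + \<E> ?kw2 \<kappa> - \<E> ?kw ?kw = 2 * (\<integral>x. \<kappa> x * w x * \<Gamma> \<kappa> w x \<partial>\<mu>)"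
    using carre_energy[OF \<kappa>L w kw] by (simp add: eqs)
  have 3: "2 * \<E> ?kw2 \<kappa> - \<E> ?k2 ?w2 = 2 * (\<integral>x. (w x)\<^sup>2 * \<Gamma> \<kappa> \<kappa> x \<partial>\<mu>)"
    using carre_energy[OF \<kappa>L \<kappa>L w2] by (simp add: eqs)
  have "(\<integral>x. w x * \<Gamma> ?k2 w x \<partial>\<mu>) = (\<integral>x. 2 * (\<kappa> x * w x * \<Gamma> \<kappa> w x) \<partial>\<mu>)"
  proof (rule integral_cong_AE)
    show "AE x in \<mu>. w x * \<Gamma> ?k2 w x = 2 * (\<kappa> x * w x * \<Gamma> \<kappa> w x)"
      using carre_square[OF \<kappa>, of w] w by (auto elim!: eventually_mono)
  qed (use w k2 \<kappa> in \<open>auto intro!: borel_measurable_times\<close>)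
  then have "\<E> ?w2 ?k2 = 4 * (\<integral>x. \<kappa> x * w x * \<Gamma> \<kappa> w x \<partial>\<mu>)" using 1 by simp
  moreover have "\<E> ?k2 ?w2 = \<E> ?w2 ?k2" "\<E> ?k2w w = \<E> w ?k2w"
    using k2 w2 k2w w by (auto intro: form_sym)
  ultimately show ?thesis using 2 3 by linarith
qed

text \<open>C need not lie in \<F>, so the identity for \<kappa> w is expanded into one for (C -
  \<kappa>) w. The gradient term is at most half of l times the pairing of w with (C - \<kappa>)^2
  w; the resolvent equation supplies the whole pairing, and the other half is nonnegative and
  dropped.\<close>

lemma weighted_energy_le:
  assumes \<kappa>: "\<kappa> \<in> \<F>" "continuous_on UNIV \<kappa>" "\<And>x. 0 \<le> \<kappa> x" "\<And>x. \<kappa> x \<le> M" "0 < M"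
    and w: "w \<in> Linf \<mu>" "is_resolvent l f w" and f: "f \<in> L2 \<mu>" and l: "0 < l"
    and small: "AE x in \<mu>. \<Gamma> \<kappa> \<kappa> x \<le> l / 2 * (C - \<kappa> x)\<^sup>2"
  shows "(\<lambda>x. (C - \<kappa> x) * w x) \<in> \<F>"
    and "\<E> (\<lambda>x. (C - \<kappa> x) * w x) (\<lambda>x. (C - \<kappa> x) * w x) \<le> (\<integral>x. f x * ((C - \<kappa> x)\<^sup>2 * w x) \<partial>\<mu>)"
proof -
  let ?z = "\<lambda>x. (C - \<kappa> x) * w x" and ?v = "\<lambda>x. (C - \<kappa> x)\<^sup>2 * w x"
  let ?kw = "\<lambda>x. \<kappa> x * w x" and ?k2w = "\<lambda>x. (\<kappa> x)\<^sup>2 * w x"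
  have wF: "w \<in> \<F>" "w \<in> \<F> \<inter> Linf \<mu>" using w by (auto simp: is_resolvent_def)
  have \<kappa>L: "\<kappa> \<in> \<F> \<inter> Linf \<mu>" using \<kappa> by (auto intro!: Linf_I[where B = M])
  have kw: "?kw \<in> \<F>" using F_mult[OF \<kappa>L wF(2)] by simp
  have k2w: "?k2w \<in> \<F>"
    using F_mult[OF \<kappa>L F_mult[OF \<kappa>L wF(2)]] by (simp add: power2_eq_square mult.assoc)
  have z_eq: "?z = (\<lambda>x. C * w x - ?kw x)" by (auto simp: algebra_simps)
  have v_eq: "?v = (\<lambda>x. C\<^sup>2 * w x - (2 * C) * ?kw x + ?k2w x)"
    by (auto simp: power2_eq_square algebra_simps)
  show zF: "?z \<in> \<F>" unfolding z_eq by (intro F_intros wF kw)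
  have vF: "?v \<in> \<F>" unfolding v_eq by (intro F_intros wF kw k2w)
  have "\<E> ?z ?z = C\<^sup>2 * \<E> w w - 2 * C * \<E> w ?kw + \<E> ?kw ?kw"
    unfolding z_eq using wF kw form_sym[OF kw wF(1)]
    by (simp add: form_simps power2_eq_square algebra_simps)
  also have "\<dots> = \<E> w ?v + (\<integral>x. (w x)\<^sup>2 * \<Gamma> \<kappa> \<kappa> x \<partial>\<mu>)" (is "_ = _ + ?I")
  proof -
    have "\<E> w ?v = C\<^sup>2 * \<E> w w - (2 * C) * \<E> w ?kw + \<E> w ?k2w"
      unfolding v_eq using wF kw k2w by (simp add: form_simps)
    then show ?thesis by (simp add: form_mult_square[OF \<kappa> wF(2)])
  qed
  finally have 1: "\<E> ?z ?z = \<E> w ?v + ?I" .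
  have 2: "?I \<le> (\<integral>x. l / 2 * (w x * ?v x) \<partial>\<mu>)"
  proof (rule integral_mono_AE)
    show "integrable \<mu> (\<lambda>x. l / 2 * (w x * ?v x))"
      by (intro integrable_mult_right L2_integrable_mult F_L2 wF vF)
    have le: "AE x in \<mu>. 0 \<le> (w x)\<^sup>2 * \<Gamma> \<kappa> \<kappa> x \<and> (w x)\<^sup>2 * \<Gamma> \<kappa> \<kappa> x \<le> l / 2 * (w x * ?v x)"
      using small carre_nonneg[OF \<kappa>(1)]
    proof eventually_elim
      case (elim x)
      then have "(w x)\<^sup>2 * \<Gamma> \<kappa> \<kappa> x \<le> (w x)\<^sup>2 * (l / 2 * (C - \<kappa> x)\<^sup>2)"
        by (intro mult_left_mono) auto
      also have "\<dots> = l / 2 * (w x * ?v x)" by (simp only: power2_eq_square mult_ac)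
      finally show ?case using elim by simp
    qed
    then have ae: "AE x in \<mu>. norm ((w x)\<^sup>2 * \<Gamma> \<kappa> \<kappa> x) \<le> norm (l / 2 * (w x * ?v x))"
      by eventually_elim simp
    have "(\<lambda>x. (w x)\<^sup>2 * \<Gamma> \<kappa> \<kappa> x) \<in> borel_measurable \<mu>"
      by (intro borel_measurable_times borel_measurable_power F_measurable wF carre_measurable \<kappa>)
    then show "integrable \<mu> (\<lambda>x. (w x)\<^sup>2 * \<Gamma> \<kappa> \<kappa> x)"
      by (rule Bochner_Integration.integrable_bound[OF \<open>integrable \<mu> (\<lambda>x. l / 2 * (w x * ?v x))\<close> _ ae])
    show "AE x in \<mu>. (w x)\<^sup>2 * \<Gamma> \<kappa> \<kappa> x \<le> l / 2 * (w x * ?v x)"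
      using le by eventually_elim simp
  qed
  have 3: "(\<integral>x. l / 2 * (w x * ?v x) \<partial>\<mu>) = l / 2 * ip w ?v" by (simp add: L2_inner_def)
  have 4: "\<E> w ?v + l * ip w ?v = ip f ?v"
    using w(2) vF unfolding is_resolvent_def frm_def by blast
  have 5: "0 \<le> l * ip w ?v"
  proof (rule mult_nonneg_nonneg)
    show "0 \<le> ip w ?v" unfolding L2_inner_def
    proof (rule integral_nonneg_AE, rule AE_I2)
      fix x
      have "0 \<le> (C - \<kappa> x)\<^sup>2 * (w x * w x)" by (rule mult_nonneg_nonneg[OF zero_le_power2 zero_le_square])
      then show "0 \<le> w x * ?v x" by (simp only: mult_ac)
    qed
  qed (use l in simp)
  have "\<E> ?z ?z \<le> ip f ?v" using 1 2 3 4 5 by linarith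
  then show "\<E> ?z ?z \<le> (\<integral>x. f x * ?v x \<partial>\<mu>)" by (simp add: L2_inner_def)
qed

text \<open>
  Near the support of \<open>\<phi>\<close>'s gradient the weight \<open>C - \<kappa>\<close> equals the large constant \<open>C\<close>, so
  locality turns \<open>\<E> w \<phi>\<close> into \<open>\<E> ((C - \<kappa>) w) \<phi> / C\<close>.
\<close>

lemma form_cutoff_le:
  assumes \<kappa>: "\<kappa> \<in> \<F>" "continuous_on UNIV \<kappa>" "\<And>x. 0 \<le> \<kappa> x" "\<And>x. \<kappa> x \<le> M" "0 < M"
    and f: "f \<in> L2 \<mu>" "\<And>x. 0 \<le> f x" "\<And>x. f x \<le> N" and l: "0 < l" and w: "is_resolvent l f w"
    and small: "AE x in \<mu>. \<Gamma> \<kappa> \<kappa> x \<le> l / 2 * (C - \<kappa> x)\<^sup>2"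
    and C: "0 < C" "\<And>x. f x \<noteq> 0 \<Longrightarrow> \<kappa> x = C - 1"
    and supp: "closed S" "open W" "S \<subseteq> W" "\<And>x. x \<notin> S \<Longrightarrow> \<kappa> x = 0"
    and \<phi>: "\<phi> \<in> \<F>" "\<And>x. x \<in> W \<Longrightarrow> \<phi> x = 1"
  shows "C * \<E> w \<phi> \<le> nrm f / sqrt l * sqrt (\<E> \<phi> \<phi>)"
proof -
  let ?z = "\<lambda>x. (C - \<kappa> x) * w x" and ?kw = "\<lambda>x. \<kappa> x * w x"
  have wF: "w \<in> \<F>" using w by (simp add: is_resolvent_def)
  have N: "0 \<le> N" using f(2,3) by (meson order_trans)
  \<comment> \<open>Products with w stay in \<F> only for bounded w; the bound comes from the
    maximum principle.\<close>
  have "AE x in \<mu>. w x \<le> N / l" by (rule resolvent_le[OF w l _ f(1)]) (use l N f(3) in auto)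
  moreover have "AE x in \<mu>. 0 \<le> w x" by (rule resolvent_nonneg[OF w l f(1)]) (use f(2) in auto)
  ultimately have "AE x in \<mu>. \<bar>w x\<bar> \<le> N / l" by eventually_elim simp
  then have wL: "w \<in> Linf \<mu>" using wF by (auto simp: Linf_def)
  have \<kappa>L: "\<kappa> \<in> \<F> \<inter> Linf \<mu>" using \<kappa> by (auto intro!: Linf_I[where B = M])
  have kwF: "?kw \<in> \<F>" using F_mult[OF \<kappa>L, of w] wF wL by simp
  note z = weighted_energy_le[OF \<kappa> wL w f(1) l small]
  have "\<E> ?z ?z \<le> ip f w"
  proof -
    \<comment> \<open>The weight is 1 wherever f lives, so the large constant C does not enter the
      right-hand side.\<close>
    have "f x * ((C - \<kappa> x)\<^sup>2 * w x) = f x * w x" for x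
      using C(2)[of x] by (cases "f x = 0") auto
    with z(2) show ?thesis by (simp add: L2_inner_def)
  qed
  also have "\<dots> \<le> nrm f * nrm w" using L2_inner_Cauchy_Schwarz[OF f(1) F_L2[OF wF]] by simp
  also have "\<dots> \<le> nrm f * (nrm f / l)"
  proof (rule mult_left_mono)
    have "is_resolvent l (\<lambda>x. l * (1 / l * f x)) w" using w l by simp
    from resolvent_contraction[OF this L2_scale[OF f(1)] l]
    show "nrm w \<le> nrm f / l" using l by (simp only: L2_norm_scale) simp
  qed simp
  finally have "sqrt (\<E> ?z ?z) \<le> sqrt ((nrm f)\<^sup>2 / l)"
    by (simp add: power2_eq_square)
  then have sz: "sqrt (\<E> ?z ?z) \<le> nrm f / sqrt l" by (simp add: real_sqrt_divide)
  have "\<E> \<phi> ?kw = 0"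
    by (rule form_local[OF \<phi>(1) kwF supp(2,1,3), where c = 1]) (use supp(4) \<phi>(2) in auto)
  moreover have "\<E> ?z \<phi> = C * \<E> w \<phi> - \<E> ?kw \<phi>"
  proof -
    have "?z = (\<lambda>x. C * w x - ?kw x)" by (auto simp: algebra_simps)
    then show ?thesis using wF kwF \<phi>(1) by (simp add: form_simps)
  qed
  ultimately have "C * \<E> w \<phi> = \<E> ?z \<phi>" using form_sym[OF kwF \<phi>(1)] by simp
  also have "\<dots> \<le> sqrt (\<E> ?z ?z) * sqrt (\<E> \<phi> \<phi>)"
    using form_Cauchy_Schwarz[OF z(1) \<phi>(1)] by simp
  also have "\<dots> \<le> nrm f / sqrt l * sqrt (\<E> \<phi> \<phi>)"
    using sz by (intro mult_right_mono) (auto simp: form_nonneg \<phi>(1))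
  finally show ?thesis .
qed

section \<open>Radial functions\<close>

lemma relatively_compact_ball: "relatively_compact_open (ball (p::'a) r)"
proof -
  have "closure (ball p r) \<subseteq> cball p r" by (rule closure_minimal) auto
  then have "compact (closure (ball p r))"
    using compact_Int_closed[OF compact_cball[of p r], of "closure (ball p r)"]
    by (simp add: inf.absorb2)
  then show ?thesis by (simp add: relatively_compact_open_def)
qed

lemma F_locE:
  assumes "u \<in> F_loc \<mu> \<F>" "relatively_compact_open V"
  obtains v where "v \<in> \<F>" "AE x in \<mu>. x \<in> V \<longrightarrow> u x = v x"
  using assms unfolding F_loc_def by auto

text \<open>\<open>carre_loc\<close> is a choice, so nothing is known of it before a witness exists.
  Local representatives on balls of integer radius are glued; locality of \<Gamma> makes the result
  independent of the representatives.\<close>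

lemma carre_loc_exists:
  assumes u: "u \<in> F_loc \<mu> \<F>"
  shows "\<exists>g. g \<in> borel_measurable \<mu> \<and>
     (\<forall>V. relatively_compact_open V \<longrightarrow>
        (\<forall>u'\<in>\<F>. \<forall>w'\<in>\<F>.
           (AE x in \<mu>. x \<in> V \<longrightarrow> u x = u' x) \<and> (AE x in \<mu>. x \<in> V \<longrightarrow> u x = w' x) \<longrightarrow>
           (AE x in \<mu>. x \<in> V \<longrightarrow> g x = \<Gamma> u' w' x)))"
proof -
  fix p :: 'a
  have "\<exists>v. v \<in> \<F> \<and> (AE x in \<mu>. x \<in> ball p (real n) \<longrightarrow> u x = v x)" for n :: nat
    by (rule F_locE[OF u relatively_compact_ball]) (intro exI conjI)
  then have "\<forall>n::nat. \<exists>v. v \<in> \<F> \<and> (AE x in \<mu>. x \<in> ball p (real n) \<longrightarrow> u x = v x)" ..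
  from choice[OF this] obtain v where
    v: "\<And>n::nat. v n \<in> \<F>" "\<And>n. AE x in \<mu>. x \<in> ball p (real n) \<longrightarrow> u x = v n x"
    by auto
  \<comment> \<open>Index of an open ball containing x; the added 1 makes the inclusion strict. N is
    measurable with countably many values, hence so is the glued function.\<close>
  define N where "N x = nat \<lfloor>dist p x\<rfloor> + 1" for x
  have N: "x \<in> ball p (real (N x))" for x
  proof -
    have "real (nat \<lfloor>dist p x\<rfloor>) = of_int \<lfloor>dist p x\<rfloor>" by (rule of_nat_nat) simp
    then show ?thesis unfolding N_def mem_ball of_nat_add by linarith
  qed
  define g where "g x = \<Gamma> (v (N x)) (v (N x)) x" for x
  have "(\<lambda>x. dist p x) \<in> borel_measurable \<mu>" by (intro borel_measurable_continuous continuous_intros)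
  from measurable_compose[OF measurable_compose[OF this measurable_real_floor],
      of "\<lambda>i. nat i + 1" "count_space UNIV"]
  have "N \<in> measurable \<mu> (count_space UNIV)" unfolding N_def[abs_def] by simp
  from measurable_compose_countable[OF carre_measurable[OF v(1) v(1)] this]
  have "g \<in> borel_measurable \<mu>" unfolding g_def[abs_def] .
  moreover have "AE x in \<mu>. x \<in> V \<longrightarrow> g x = \<Gamma> u' w' x"
    if V: "relatively_compact_open V" and F: "u' \<in> \<F>" "w' \<in> \<F>"
      and eq: "AE x in \<mu>. x \<in> V \<longrightarrow> u x = u' x" "AE x in \<mu>. x \<in> V \<longrightarrow> u x = w' x" for V u' w'
  proof -
    have "AE x in \<mu>. x \<in> V \<inter> ball p (real n) \<longrightarrow> \<Gamma> (v n) (v n) x = \<Gamma> u' w' x" for n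
    proof -
      have O: "open (V \<inter> ball p (real n))" using V by (auto simp: relatively_compact_open_def)
      have "AE x in \<mu>. x \<in> V \<inter> ball p (real n) \<longrightarrow> v n x = u' x"
        using v(2)[of n] eq(1) by eventually_elim auto
      from carre_local[OF v(1) F(1) v(1) O this]
      have 1: "AE x in \<mu>. x \<in> V \<inter> ball p (real n) \<longrightarrow> \<Gamma> (v n) (v n) x = \<Gamma> u' (v n) x" .
      have "AE x in \<mu>. x \<in> V \<inter> ball p (real n) \<longrightarrow> v n x = w' x"
        using v(2)[of n] eq(2) by eventually_elim auto
      from carre_local[OF v(1) F(2) F(1) O this]
      have 2: "AE x in \<mu>. x \<in> V \<inter> ball p (real n) \<longrightarrow> \<Gamma> (v n) u' x = \<Gamma> w' u' x" .
      show ?thesis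
        using 1 2 carre_sym[OF v(1) F(1), of n] carre_sym[OF F(2,1)] by eventually_elim auto
    qed
    then have "AE x in \<mu>. \<forall>n. x \<in> V \<inter> ball p (real n) \<longrightarrow> \<Gamma> (v n) (v n) x = \<Gamma> u' w' x"
      unfolding AE_all_countable by (intro allI)
    then show ?thesis by eventually_elim (use N in \<open>auto simp: g_def\<close>)
  qed
  ultimately show ?thesis by blast
qed

lemma carre_loc_eq:
  assumes u: "u \<in> F_loc \<mu> \<F>" and V: "relatively_compact_open V" and v: "v \<in> \<F>"
    and eq: "AE x in \<mu>. x \<in> V \<longrightarrow> u x = v x"
  shows "AE x in \<mu>. x \<in> V \<longrightarrow> carre_loc \<mu> \<F> \<Gamma> u u x = \<Gamma> v v x"
proof -
  have "\<forall>V. relatively_compact_open V \<longrightarrow>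
        (\<forall>u'\<in>\<F>. \<forall>w'\<in>\<F>.
           (AE x in \<mu>. x \<in> V \<longrightarrow> u x = u' x) \<and> (AE x in \<mu>. x \<in> V \<longrightarrow> u x = w' x) \<longrightarrow>
           (AE x in \<mu>. x \<in> V \<longrightarrow> carre_loc \<mu> \<F> \<Gamma> u u x = \<Gamma> u' w' x))"
    unfolding carre_loc_def by (rule someI_ex[OF carre_loc_exists[OF u], THEN conjunct2])
  then show ?thesis using V v eq by simp
qed

text \<open>The distance reversed and clipped to [0, b - a]. Unlike the distance it vanishes outside
  a ball and lies in \<F>, and a radial function that is constant up to radius a and zero beyond b
  is h \<circ> \<open>band\<close> with h 0 = 0.\<close>

definition band :: "'a \<Rightarrow> real \<Rightarrow> real \<Rightarrow> 'a \<Rightarrow> real" where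
  "band p a b x = min (max (b - dist x p) 0) (b - a)"

lemma band_nonneg: "a \<le> b \<Longrightarrow> 0 \<le> band p a b x"
  and band_le: "band p a b x \<le> b - a"
  and band_inner: "a \<le> b \<Longrightarrow> dist x p \<le> a \<Longrightarrow> band p a b x = b - a"
  and band_outer: "a \<le> b \<Longrightarrow> b \<le> dist x p \<Longrightarrow> band p a b x = 0"
  and band_mid: "a \<le> dist x p \<Longrightarrow> dist x p \<le> b \<Longrightarrow> band p a b x = b - dist x p"
  unfolding band_def by (auto simp: min_def max_def)

lemma band_continuous: "continuous_on UNIV (band p a b)"
  unfolding band_def by (intro continuous_intros)

text \<open>A local representative v of the distance is uncontrolled far out, so it is clipped and
  multiplied by a bump. On the annulus \<open>band\<close> + v is the constant b; hence \<Gamma>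
  annihilates this sum, and two applications turn \<Gamma> of \<open>band\<close> into \<Gamma> of
  v.\<close>

lemma
  assumes d: "(\<lambda>x. dist x p) \<in> F_loc \<mu> \<F>" and ab: "0 \<le> a" "a < b"
  shows F_band: "band p a b \<in> \<F>"
    and carre_band: "AE x in \<mu>. a < dist x p \<and> dist x p < b \<longrightarrow>
      \<Gamma> (band p a b) (band p a b) x = carre_loc \<mu> \<F> \<Gamma> (\<lambda>x. dist x p) (\<lambda>x. dist x p) x"
proof -
  let ?V = "ball p (b + 2)"
  obtain v where v: "v \<in> \<F>" "AE x in \<mu>. x \<in> ?V \<longrightarrow> dist x p = v x"
    by (rule F_locE[OF d relatively_compact_ball])
  define v' where "v' x = min (max (v x) 0) b" for x
  have v': "v' \<in> \<F>" "\<And>x. 0 \<le> v' x" "\<And>x. v' x \<le> b"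
    using F_cut(1)[OF v(1), of b] ab by (auto simp: v'_def[abs_def])
  define q where "q x = v' x - min (v' x) a" for x
  have qF: "q \<in> \<F>" unfolding q_def by (intro F_diff F_trunc v' ab)
  have "\<bar>q x\<bar> \<le> b" for x using v'(2,3)[of x] ab by (auto simp: q_def min_def)
  then have qL: "q \<in> \<F> \<inter> Linf \<mu>" using qF by (auto intro!: Linf_I[where B = b])
  obtain \<psi> where \<psi>: "\<psi> \<in> \<F>" "continuous_on UNIV \<psi>" "\<And>x. 0 \<le> \<psi> x" "\<And>x. \<psi> x \<le> 1"
    "\<And>x. dist x p \<le> b \<Longrightarrow> \<psi> x = 1" "\<And>x. b + 1 \<le> dist x p \<Longrightarrow> \<psi> x = 0"
    by (rule bump[of b "b + 1" p]) (use ab in auto)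
  have \<psi>L: "\<psi> \<in> \<F> \<inter> Linf \<mu>" using \<psi> by (auto intro!: Linf_I[where B = 1])
  have "(\<lambda>x. (b - a) * \<psi> x - \<psi> x * q x) \<in> \<F>"
    using F_mult[OF \<psi>L qL] by (intro F_intros \<psi>(1)) auto
  moreover have "AE x in \<mu>. (b - a) * \<psi> x - \<psi> x * q x = band p a b x"
    using v(2)
  proof eventually_elim
    fix x assume *: "x \<in> ?V \<longrightarrow> dist x p = v x"
    show "(b - a) * \<psi> x - \<psi> x * q x = band p a b x"
    proof (cases "dist x p < b + 1")
      case True
      then have "v x = dist x p" using * by (simp add: dist_commute)
      then show ?thesis
        using \<psi>(5)[of x] ab by (cases "dist x p \<le> b") (auto simp: q_def v'_def band_def min_def max_def)
    next
      case False
      then show ?thesis using \<psi>(6)[of x] ab by (simp add: band_def)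
    qed
  qed
  moreover have "band p a b \<in> borel_measurable \<mu>"
    by (intro borel_measurable_continuous band_continuous)
  ultimately show B: "band p a b \<in> \<F>" using domain_cong by blast
  let ?U = "{x. a < dist x p \<and> dist x p < b}"
  have U: "open ?U"
    by (intro open_Collect_conj open_Collect_less continuous_intros)
  let ?z = "\<lambda>x. band p a b x + v x"
  have zF: "?z \<in> \<F>" using B v by (intro F_intros)
  have const: "AE x in \<mu>. x \<in> ?U \<longrightarrow> ?z x = b"
    using v(2) by eventually_elim (auto simp: band_mid dist_commute)
  show "AE x in \<mu>. a < dist x p \<and> dist x p < b \<longrightarrow>
      \<Gamma> (band p a b) (band p a b) x = carre_loc \<mu> \<F> \<Gamma> (\<lambda>x. dist x p) (\<lambda>x. dist x p) x"
    using carre_const_left[OF zF B U const] carre_const_left[OF zF v(1) U const]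
      carre_add[OF B v(1) B] carre_add[OF B v(1) v(1)] carre_sym[OF B v(1)]
      carre_loc_eq[OF d relatively_compact_ball v]
    by eventually_elim (auto simp: dist_commute)
qed

text \<open>Vanishing of h' at both ends settles the spheres of radius a and b:
  \<open>carre_band\<close> covers only the open annulus, and the spheres may carry mass.\<close>

lemma
  assumes d: "(\<lambda>x. dist x p) \<in> F_loc \<mu> \<F>" and ab: "0 \<le> a" "a < b"
    and der: "\<And>y. y \<in> {0..b - a} \<Longrightarrow> (h has_real_derivative h' y) (at y within {0..b - a})"
    and cont: "continuous_on {0..b - a} h'" and h0: "h 0 = 0" "h' 0 = 0" "h' (b - a) = 0"
  shows F_radial: "(\<lambda>x. h (band p a b x)) \<in> \<F>"
    and carre_radial: "AE x in \<mu>. \<Gamma> (\<lambda>x. h (band p a b x)) (\<lambda>x. h (band p a b x)) x =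
      (if a < dist x p \<and> dist x p < b
       then (h' (b - dist x p))\<^sup>2 * carre_loc \<mu> \<F> \<Gamma> (\<lambda>x. dist x p) (\<lambda>x. dist x p) x else 0)"
proof -
  have nn: "0 \<le> band p a b x" for x using ab by (simp add: band_nonneg)
  have pos: "0 < b - a" using ab by simp
  note B = F_band[OF d ab]
  note chain = chain_rule[where \<phi> = "band p a b" and M = "b - a" and h = h and h' = h', OF B band_continuous nn band_le pos _ cont h0(1)]
  let ?u = "\<lambda>x. h (band p a b x)"
  show F: "?u \<in> \<F>" by (intro chain(1) der)
  have chain2: "AE x in \<mu>. \<Gamma> ?u w x = h' (band p a b x) * \<Gamma> (band p a b) w x" if "w \<in> \<F>" for w
    by (intro chain(2) der that)
  show "AE x in \<mu>. \<Gamma> ?u ?u x =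
      (if a < dist x p \<and> dist x p < b
       then (h' (b - dist x p))\<^sup>2 * carre_loc \<mu> \<F> \<Gamma> (\<lambda>x. dist x p) (\<lambda>x. dist x p) x else 0)"
    using chain2[OF F] chain2[OF B] carre_sym[OF F B] carre_band[OF d ab]
  proof eventually_elim
    case (elim x)
    consider "dist x p \<le> a" | "b \<le> dist x p" | "a < dist x p" "dist x p < b" by linarith
    then show ?case
    proof cases
      case 1
      then show ?thesis using elim ab h0 by (simp add: band_inner)
    next
      case 2
      then show ?thesis using elim ab h0 by (simp add: band_outer)
    next
      case 3
      then show ?thesis using elim by (simp add: band_mid power2_eq_square)
    qed
  qed
qed

end

section \<open>Mass loss across annuli\<close>

text \<open>A transition from 0 to 1 with flat ends, as the radial calculus requires. Its maximal
  slope is 3/2, which is the origin of every 9/4 below.\<close>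

definition smoothstep :: "real \<Rightarrow> real" where
  "smoothstep y = y\<^sup>2 * (3 - 2 * y)"

lemma smoothstep_deriv: "(smoothstep has_real_derivative 6 * y * (1 - y)) (at y)"
  unfolding smoothstep_def
  by (auto intro!: derivative_eq_intros simp: power2_eq_square algebra_simps)

lemma smoothstep_0 [simp]: "smoothstep 0 = 0"
  and smoothstep_1 [simp]: "smoothstep 1 = 1"
  by (simp_all add: smoothstep_def)

lemma smoothstep_nonneg: "0 \<le> y \<Longrightarrow> y \<le> 1 \<Longrightarrow> 0 \<le> smoothstep y"
  by (simp add: smoothstep_def)

lemma smoothstep_le_1: "0 \<le> y \<Longrightarrow> smoothstep y \<le> 1"
proof -
  assume "0 \<le> y"
  \<comment> \<open>This product is 1 - \<open>smoothstep y\<close>.\<close>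
  then have "0 \<le> (1 - y)\<^sup>2 * (1 + 2 * y)" by simp
  then show ?thesis by (simp add: smoothstep_def power2_eq_square algebra_simps)
qed

lemma smoothstep_deriv_square_le: "0 \<le> y \<Longrightarrow> y \<le> 1 \<Longrightarrow> (6 * y * (1 - y))\<^sup>2 \<le> (9 / 4 :: real)"
proof -
  assume "0 \<le> y" "y \<le> 1"
  then have "0 \<le> 6 * y * (1 - y)" by simp
  moreover have "6 * y * (1 - y) \<le> 3 / 2"
    using zero_le_power2[of "y - 1/2"] by (simp add: power2_eq_square algebra_simps)
  ultimately have "(6 * y * (1 - y))\<^sup>2 \<le> (3 / 2)\<^sup>2" by (intro power_mono)
  then show ?thesis by (simp add: power2_eq_square)
qed

locale local_dirichlet_semigroup =
  local_dirichlet_form \<mu> \<E> \<F> \<Gamma> + form_semigroup \<mu> \<E> \<F> T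
  for \<mu> :: "'a::{metric_space, second_countable_topology} measure" and \<E> \<F> \<Gamma> T +
  assumes finite_on_compact: "compact C \<Longrightarrow> emeasure \<mu> C < \<infinity>"
begin

lemma space_eq_UNIV: "space \<mu> = UNIV"
  using sets_eq_imp_space_eq[OF sets_eq_borel] by simp

lemma emeasure_cball: "emeasure \<mu> (cball p r) < \<infinity>"
  by (rule finite_on_compact[OF compact_cball])

lemma cball_sets: "cball p r \<in> sets \<mu>"
  by (simp add: sets_eq_borel)

sublocale sigma_finite_dirichlet_semigroup
proof (unfold_locales, intro exI conjI ballI)
  fix p :: 'a
  let ?A = "range (\<lambda>n::nat. cball p (real n))"
  show "countable ?A" by simp
  show "?A \<subseteq> sets \<mu>" using cball_sets by auto
  have "\<exists>n::nat. dist p x \<le> real n" for x by (rule real_arch_simple)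
  then show "\<Union>?A = space \<mu>" by (auto simp: space_eq_UNIV)
  show "emeasure \<mu> a \<noteq> \<infinity>" if "a \<in> ?A" for a
    using that emeasure_cball by (auto simp: less_top[symmetric])
qed

lemma indicator_cball_L2: "indicat_real (cball p r) \<in> L2 \<mu>"
  by (rule indicator_L2[OF cball_sets emeasure_cball])

definition rad :: "'a \<Rightarrow> 'a \<Rightarrow> real" where
  "rad p = carre_loc \<mu> \<F> \<Gamma> (\<lambda>x. dist x p) (\<lambda>x. dist x p)"

text \<open>The dual form of T_t 1 = 1; it keeps the extension to bounded functions out of the
  estimates.\<close>

definition mass_preserving :: "real \<Rightarrow> bool" where
  "mass_preserving t \<longleftrightarrow> (\<forall>h. h \<in> L2 \<mu> \<longrightarrow> integrable \<mu> h \<longrightarrow> (AE x in \<mu>. 0 \<le> h x) \<longrightarrow>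
     (\<integral>x. T t h x \<partial>\<mu>) = (\<integral>x. h x \<partial>\<mu>))"

context
  fixes p :: 'a
  assumes d: "(\<lambda>x. dist x p) \<in> F_loc \<mu> \<F>"
begin

lemma radial_cutoff:
  assumes ab: "0 \<le> a" "a < b" and G: "AE x in \<mu>. a < dist x p \<and> dist x p < b \<longrightarrow> rad p x \<le> G" "0 \<le> G"
  obtains \<phi> where "\<phi> \<in> \<F>" "\<And>x. 0 \<le> \<phi> x" "\<And>x. \<phi> x \<le> 1" "\<And>x. dist x p \<le> a \<Longrightarrow> \<phi> x = 1"
    "\<E> \<phi> \<phi> \<le> 9 / 4 * G / (b - a)\<^sup>2 * measure \<mu> (ball p b - ball p a)"
proof -
  let ?h = "\<lambda>y. smoothstep (y / (b - a))"
  let ?h' = "\<lambda>y. 6 * (y / (b - a)) * (1 - y / (b - a)) / (b - a)"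
  let ?\<phi> = "\<lambda>x. ?h (band p a b x)"
  let ?S = "ball p b - ball p a"
  have der: "(?h has_real_derivative ?h' y) (at y within {0..b - a})" for y
  proof (rule has_field_derivative_at_within)
    have "((\<lambda>y. y / (b - a)) has_real_derivative 1 / (b - a)) (at y)"
      by (intro DERIV_cdivide DERIV_ident)
    from DERIV_chain2[OF smoothstep_deriv this] show "(?h has_real_derivative ?h' y) (at y)" by simp
  qed
  have cont: "continuous_on {0..b - a} ?h'" using ab by (intro continuous_intros) auto
  have ends: "?h 0 = 0" "?h' 0 = 0" "?h' (b - a) = 0" using ab by auto
  note F = F_radial[OF d ab der cont ends] and C = carre_radial[OF d ab der cont ends]
  have y: "0 \<le> band p a b x / (b - a)" "band p a b x / (b - a) \<le> 1" for x
    using band_nonneg[of a b p x] band_le[of p a b x] ab by auto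
  have S: "?S \<in> sets \<mu>" by (simp add: sets_eq_borel)
  have "emeasure \<mu> ?S \<le> emeasure \<mu> (cball p b)"
    by (rule emeasure_mono) (auto simp: cball_sets)
  then have Sfin: "emeasure \<mu> ?S < \<infinity>" using emeasure_cball[of p b] by (rule le_less_trans)
  have "\<E> ?\<phi> ?\<phi> = (\<integral>x. \<Gamma> ?\<phi> ?\<phi> x \<partial>\<mu>)" by (rule carre_form[OF F F])
  also have "\<dots> \<le> (\<integral>x. (9 / 4 * G / (b - a)\<^sup>2) * indicat_real ?S x \<partial>\<mu>)"
  proof (rule integral_mono_AE[OF carre_integrable[OF F F]])
    show "integrable \<mu> (\<lambda>x. (9 / 4 * G / (b - a)\<^sup>2) * indicat_real ?S x)"
      using S Sfin by simp
    show "AE x in \<mu>. \<Gamma> ?\<phi> ?\<phi> x \<le> (9 / 4 * G / (b - a)\<^sup>2) * indicat_real ?S x"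
      using C G(1) carre_nonneg[OF F]
    proof eventually_elim
      case (elim x)
      show ?case
      proof (cases "a < dist x p \<and> dist x p < b")
        case True
        let ?y = "(b - dist x p) / (b - a)"
        have "(?h' (b - dist x p))\<^sup>2 \<le> 9 / 4 / (b - a)\<^sup>2"
          by (subst power_divide, intro divide_right_mono smoothstep_deriv_square_le)
            (use True ab in auto)
        moreover have "rad p x \<le> G" using elim True by simp
        ultimately have "(?h' (b - dist x p))\<^sup>2 * rad p x \<le> 9 / 4 / (b - a)\<^sup>2 * G"
          using G(2) by (meson mult_left_mono mult_right_mono order_trans zero_le_power2)
        moreover have "x \<in> ?S" using True by (auto simp: dist_commute)
        moreover have "\<Gamma> ?\<phi> ?\<phi> x = (?h' (b - dist x p))\<^sup>2 * rad p x"
          using elim(1) True by (simp add: rad_def)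
        ultimately show ?thesis by simp
      next
        case False
        then have "\<Gamma> ?\<phi> ?\<phi> x = 0" using elim(1) by auto
        then show ?thesis using G(2) by simp
      qed
    qed
  qed
  also have "\<dots> = 9 / 4 * G / (b - a)\<^sup>2 * measure \<mu> ?S"
    using S Sfin by (simp add: space_eq_UNIV)
  finally have "\<E> ?\<phi> ?\<phi> \<le> 9 / 4 * G / (b - a)\<^sup>2 * measure \<mu> ?S" .
  moreover have "?\<phi> x = 1" if "dist x p \<le> a" for x using that ab by (simp add: band_inner)
  ultimately show ?thesis
    using that[of ?\<phi>] F smoothstep_nonneg[OF y] smoothstep_le_1[OF y(1)] by blast
qed

text \<open>The weight is exp (\<alpha> L \<open>smoothstep\<close> Y), with Y the increment of
  \<rho> normalised to [0, 1]. An exponential is used because its gradient is controlled by itself: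
  the logarithmic slope is at most 3/2 \<alpha> \<rho>'. The smoothstep flattens both ends without
  changing the values 1 and exp (\<alpha> L).\<close>

lemma radial_weight:
  assumes rR: "0 \<le> r" "r < R" and \<alpha>: "0 < \<alpha>"
    and der: "\<And>s. r \<le> s \<Longrightarrow> s \<le> R \<Longrightarrow> (\<rho> has_real_derivative \<rho>' s) (at s)"
    and cont: "continuous_on {r..R} \<rho>'" and mono: "mono_on {r..R} \<rho>" and L: "\<rho> r < \<rho> R"
    and M: "AE x in \<mu>. r < dist x p \<and> dist x p < R \<longrightarrow> (\<rho>' (dist x p))\<^sup>2 * rad p x \<le> M" "0 \<le> M"
  obtains \<kappa> where "\<kappa> \<in> \<F>" "continuous_on UNIV \<kappa>" "\<And>x. 0 \<le> \<kappa> x" "\<And>x. \<kappa> x \<le> exp (\<alpha> * (\<rho> R - \<rho> r))"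
    "\<And>x. dist x p \<le> r \<Longrightarrow> \<kappa> x = exp (\<alpha> * (\<rho> R - \<rho> r)) - 1" "\<And>x. R \<le> dist x p \<Longrightarrow> \<kappa> x = 0"
    "AE x in \<mu>. \<Gamma> \<kappa> \<kappa> x \<le> 9 / 4 * \<alpha>\<^sup>2 * M * (exp (\<alpha> * (\<rho> R - \<rho> r)) - \<kappa> x)\<^sup>2"
proof -
  define L where "L = \<rho> R - \<rho> r"
  have L0: "0 < L" using L by (simp add: L_def)
  \<comment> \<open>The variable y is the value of \<open>band\<close>, so R - y is the
    distance.\<close>
  define Y where "Y y = (\<rho> (R - y) - \<rho> r) / L" for y
  define h where "h y = exp (\<alpha> * L) - exp (\<alpha> * L * smoothstep (Y y))" for y
  define h' where "h' y = exp (\<alpha> * L * smoothstep (Y y)) * (\<alpha> * (6 * Y y * (1 - Y y)) * \<rho>' (R - y))" for y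
  let ?I = "{0..R - r}"
  let ?\<kappa> = "\<lambda>x. h (band p r R x)"
  have Y01: "0 \<le> Y y" "Y y \<le> 1" if "y \<in> ?I" for y
  proof -
    have "\<rho> r \<le> \<rho> (R - y)" "\<rho> (R - y) \<le> \<rho> R"
      using mono that rR by (auto simp: mono_on_def)
    then show "0 \<le> Y y" "Y y \<le> 1" using L0 by (auto simp: Y_def L_def field_simps)
  qed
  have Yder: "(Y has_real_derivative - \<rho>' (R - y) / L) (at y)" if "y \<in> ?I" for y
  proof -
    have "(\<rho> has_real_derivative \<rho>' (R - y)) (at (R - y))" using that rR by (intro der) auto
    moreover have "((\<lambda>y. R - y) has_real_derivative -1) (at y)"
      by (auto intro!: derivative_eq_intros)
    ultimately have "((\<lambda>y. \<rho> (R - y)) has_real_derivative \<rho>' (R - y) * -1) (at y)"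
      by (rule DERIV_chain2)
    from DERIV_cdivide[OF DERIV_diff[OF this DERIV_const[of "\<rho> r"]], of L]
    show ?thesis unfolding Y_def[abs_def] by simp
  qed
  have hder: "(h has_real_derivative h' y) (at y within ?I)" if "y \<in> ?I" for y
  proof (rule has_field_derivative_at_within)
    have "((\<lambda>y. smoothstep (Y y)) has_real_derivative 6 * Y y * (1 - Y y) * (- \<rho>' (R - y) / L)) (at y)"
      by (rule DERIV_chain2[OF smoothstep_deriv Yder[OF that]])
    then have "(h has_real_derivative - (exp (\<alpha> * L * smoothstep (Y y)) * (\<alpha> * L * (6 * Y y * (1 - Y y) * (- \<rho>' (R - y) / L))))) (at y)"
      unfolding h_def[abs_def] by (auto intro!: derivative_eq_intros)
    also have "- (exp (\<alpha> * L * smoothstep (Y y)) * (\<alpha> * L * (6 * Y y * (1 - Y y) * (- \<rho>' (R - y) / L)))) = h' y"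
      using L0 by (simp add: h'_def)
    finally show "(h has_real_derivative h' y) (at y)" .
  qed
  have Ycont: "continuous_on ?I Y"
    by (rule DERIV_continuous_on[OF has_field_derivative_at_within[OF Yder]])
  have scont: "continuous_on ?I (\<lambda>y. smoothstep (Y y))"
    unfolding smoothstep_def by (intro continuous_intros Ycont)
  have h'cont: "continuous_on ?I h'"
    unfolding h'_def[abs_def]
    by (intro continuous_intros Ycont scont continuous_on_compose2[OF cont]) auto
  have "Y 0 = 1" "Y (R - r) = 0" using L0 by (auto simp: Y_def L_def)
  then have ends: "h 0 = 0" "h' 0 = 0" "h' (R - r) = 0" and h_end: "h (R - r) = exp (\<alpha> * L) - 1"
    by (auto simp: h_def h'_def)
  have F: "?\<kappa> \<in> \<F>" by (intro F_radial[where h = h and h' = h', OF d rR _ h'cont ends] hder)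
  have C: "AE x in \<mu>. \<Gamma> ?\<kappa> ?\<kappa> x = (if r < dist x p \<and> dist x p < R
       then (h' (R - dist x p))\<^sup>2 * carre_loc \<mu> \<F> \<Gamma> (\<lambda>x. dist x p) (\<lambda>x. dist x p) x else 0)"
    by (intro carre_radial[where h = h and h' = h', OF d rR _ h'cont ends] hder)
  have B: "band p r R x \<in> ?I" for x
    using band_nonneg[of r R p x] band_le[of p r R x] rR by auto
  have hcont: "continuous_on ?I h" by (rule DERIV_continuous_on[OF hder])
  have kcont: "continuous_on UNIV ?\<kappa>"
    by (rule continuous_on_compose2[OF hcont band_continuous]) (use B in auto)
  have h_bounds: "0 \<le> h y" "h y \<le> exp (\<alpha> * L)" if "y \<in> ?I" for y
  proof -
    have "\<alpha> * L * smoothstep (Y y) \<le> \<alpha> * L * 1"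
      using smoothstep_le_1[OF Y01(1)[OF that]] \<alpha> L0 by (intro mult_left_mono) auto
    then show "0 \<le> h y" "h y \<le> exp (\<alpha> * L)" by (auto simp: h_def)
  qed
  have "AE x in \<mu>. \<Gamma> ?\<kappa> ?\<kappa> x \<le> 9 / 4 * \<alpha>\<^sup>2 * M * (exp (\<alpha> * L) - ?\<kappa> x)\<^sup>2"
    using C M(1)
  proof eventually_elim
    case (elim x)
    show ?case
    proof (cases "r < dist x p \<and> dist x p < R")
      case True
      let ?y = "R - dist x p" let ?q = "6 * Y ?y * (1 - Y ?y)" let ?e = "exp (\<alpha> * L * smoothstep (Y ?y))"
      have y: "?y \<in> ?I" using True by auto
      have "\<Gamma> ?\<kappa> ?\<kappa> x = (h' ?y)\<^sup>2 * rad p x" using elim(1) True by (simp add: rad_def)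
      also have "\<dots> = (\<alpha>\<^sup>2 * ?e\<^sup>2) * (?q\<^sup>2 * ((\<rho>' (dist x p))\<^sup>2 * rad p x))"
        by (simp add: h'_def power_mult_distrib)
      also have "\<dots> \<le> (\<alpha>\<^sup>2 * ?e\<^sup>2) * (9 / 4 * M)"
      proof (rule mult_left_mono)
        have "?q\<^sup>2 * ((\<rho>' (dist x p))\<^sup>2 * rad p x) \<le> ?q\<^sup>2 * M"
          using elim(2) True by (intro mult_left_mono) auto
        also have "\<dots> \<le> 9 / 4 * M"
          using smoothstep_deriv_square_le[OF Y01[OF y]] M(2) by (intro mult_right_mono)
        finally show "?q\<^sup>2 * ((\<rho>' (dist x p))\<^sup>2 * rad p x) \<le> 9 / 4 * M" .
      qed simp
      also have "?e = exp (\<alpha> * L) - ?\<kappa> x" using True by (simp add: h_def band_mid)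
      finally show ?thesis by (simp add: mult_ac)
    next
      case False
      then have "\<Gamma> ?\<kappa> ?\<kappa> x = 0" using elim(1) by auto
      then show ?thesis using M(2) by simp
    qed
  qed
  moreover have "?\<kappa> x = exp (\<alpha> * L) - 1" if "dist x p \<le> r" for x
    using that rR h_end by (simp add: band_inner)
  moreover have "?\<kappa> x = 0" if "R \<le> dist x p" for x
    using that rR ends by (simp add: band_outer)
  ultimately show ?thesis
    using that[of ?\<kappa>] F kcont h_bounds[OF B] unfolding L_def by blast
qed

lemma mass_loss_annulus:
  assumes f: "f \<in> L2 \<mu>" "\<And>x. 0 \<le> f x" "\<And>x. f x \<le> K" "\<And>x. f x \<noteq> 0 \<Longrightarrow> dist x p \<le> r"
    and rR: "0 \<le> r" "r < R" "R < a" "a < b" and \<alpha>: "0 < \<alpha>" and t: "0 < t"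
    and der: "\<And>s. r \<le> s \<Longrightarrow> s \<le> R \<Longrightarrow> (\<rho> has_real_derivative \<rho>' s) (at s)"
    and cont: "continuous_on {r..R} \<rho>'" and mono: "mono_on {r..R} \<rho>" and L: "\<rho> r < \<rho> R"
    and M: "AE x in \<mu>. r < dist x p \<and> dist x p < R \<longrightarrow> (\<rho>' (dist x p))\<^sup>2 * rad p x \<le> M" "0 < M"
    and G: "AE x in \<mu>. a < dist x p \<and> dist x p < b \<longrightarrow> rad p x \<le> G" "0 \<le> G"
    and l: "l = 9 / 2 * \<alpha>\<^sup>2 * M"
  shows "(\<integral>x. f x \<partial>\<mu>) - (\<integral>x. T t f x \<partial>\<mu>) \<le>
    exp (l * t) * (nrm f / sqrt l * sqrt (9 / 4 * G / (b - a)\<^sup>2 * measure \<mu> (ball p b - ball p a)) /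
      exp (\<alpha> * (\<rho> R - \<rho> r)))"
proof -
  let ?C = "exp (\<alpha> * (\<rho> R - \<rho> r))"
  have l0: "0 < l" using \<alpha> M by (simp add: l)
  have M0: "0 \<le> M" using M by simp
  obtain \<kappa> where \<kappa>: "\<kappa> \<in> \<F>" "continuous_on UNIV \<kappa>" "\<And>x. 0 \<le> \<kappa> x" "\<And>x. \<kappa> x \<le> ?C"
    and \<kappa>_in: "\<And>x. dist x p \<le> r \<Longrightarrow> \<kappa> x = ?C - 1" and \<kappa>_out: "\<And>x. R \<le> dist x p \<Longrightarrow> \<kappa> x = 0"
    and small: "AE x in \<mu>. \<Gamma> \<kappa> \<kappa> x \<le> 9 / 4 * \<alpha>\<^sup>2 * M * (?C - \<kappa> x)\<^sup>2"
    using radial_weight[OF rR(1,2) \<alpha> der cont mono L M(1) M0] by blast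
  have a0: "0 \<le> a" using rR by simp
  obtain \<phi> where \<phi>: "\<phi> \<in> \<F>" "\<And>x. 0 \<le> \<phi> x" "\<And>x. \<phi> x \<le> 1" "\<And>x. dist x p \<le> a \<Longrightarrow> \<phi> x = 1"
    and E\<phi>: "\<E> \<phi> \<phi> \<le> 9 / 4 * G / (b - a)\<^sup>2 * measure \<mu> (ball p b - ball p a)"
    using radial_cutoff[OF a0 rR(4) G] by blast
  obtain w where w: "is_resolvent l f w" using resolvent_exists[OF f(1) l0] by blast
  have f_eq: "(\<lambda>x. f x * indicat_real (cball p r) x) = f"
    using f(4) by (auto simp: fun_eq_iff indicator_def dist_commute)
  have fint: "integrable \<mu> f"
    using L2_integrable_mult[OF f(1) indicator_cball_L2, of p r] by (simp only: f_eq)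
  have "?C * \<E> w \<phi> \<le> nrm f / sqrt l * sqrt (\<E> \<phi> \<phi>)"
  proof (rule form_cutoff_le[OF \<kappa> _ f(1-3) l0 w])
    \<comment> \<open>l is twice the constant of \<open>radial_weight\<close>, leaving the factor l
      / 2 demanded by the energy estimate.\<close>
    show "AE x in \<mu>. \<Gamma> \<kappa> \<kappa> x \<le> l / 2 * (?C - \<kappa> x)\<^sup>2"
      using small by eventually_elim (simp add: l)
    \<comment> \<open>The gap R < a gives the open neighbourhood on which \<phi> is constant, as
      strong locality demands.\<close>
    show "cball p R \<subseteq> ball p a" using rR by auto
    show "\<kappa> x = 0" if "x \<notin> cball p R" for x
      using that by (intro \<kappa>_out) (simp add: dist_commute)
    show "\<phi> x = 1" if "x \<in> ball p a" for x using that by (intro \<phi>(4)) (simp add: dist_commute)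
  qed (use \<kappa>_in f(4) \<phi> in auto)
  also have "\<dots> \<le> nrm f / sqrt l * sqrt (9 / 4 * G / (b - a)\<^sup>2 * measure \<mu> (ball p b - ball p a))"
    using l0 by (intro mult_left_mono real_sqrt_le_mono E\<phi>) auto
  finally have "\<E> w \<phi> * ?C \<le> nrm f / sqrt l * sqrt (9 / 4 * G / (b - a)\<^sup>2 * measure \<mu> (ball p b - ball p a))"
    by (simp only: mult.commute)
  then have "\<E> w \<phi> \<le> nrm f / sqrt l * sqrt (9 / 4 * G / (b - a)\<^sup>2 * measure \<mu> (ball p b - ball p a)) / ?C"
    by (rule mult_imp_le_div_pos[OF exp_gt_zero])
  moreover have "(\<integral>x. f x \<partial>\<mu>) - (\<integral>x. T t f x \<partial>\<mu>) \<le> exp (l * t) * ((\<integral>x. f x \<partial>\<mu>) - l * ip w \<phi>)"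
    by (rule mass_loss[OF f(1) fint _ _ _ w l0 t]) (use \<phi> f(2) in auto)
  \<comment> \<open>The resolvent equation tested with \<phi>, which is 1 on the support of f: the
    deficit is exactly a mutual energy.\<close>
  moreover have "(\<integral>x. f x \<partial>\<mu>) - l * ip w \<phi> = \<E> w \<phi>"
  proof -
    have "(\<lambda>x. f x * \<phi> x) = f"
    proof
      show "f x * \<phi> x = f x" for x
        using f(4)[of x] \<phi>(4)[of x] rR by (cases "f x = 0") auto
    qed
    then have "ip f \<phi> = (\<integral>x. f x \<partial>\<mu>)" by (simp only: L2_inner_def)
    moreover have "\<E> w \<phi> + l * ip w \<phi> = ip f \<phi>"
      using w \<phi>(1) unfolding is_resolvent_def frm_def by blast
    ultimately show ?thesis by linarith
  qed
  ultimately show ?thesis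
    by (smt (verit) exp_gt_zero mult_left_mono)
qed

text \<open>The weight grows between a fixed radius and n, while the cutoff falls between 2 n and 4
  n. Letting n grow with \<alpha> = (N + 1) \<open>\<rho> (real n)\<close> drives the mass loss to
  zero for one fixed range of t.\<close>

lemma short_time_mass:
  assumes der: "\<And>s. r\<^sub>0 < s \<Longrightarrow> (\<rho> has_real_derivative \<rho>' s) (at s)"
    and cont: "continuous_on {r\<^sub>0<..} \<rho>'" and mono: "mono_on {r\<^sub>0<..} \<rho>"
    and top: "filterlim \<rho> at_top at_top" and r0: "0 \<le> r\<^sub>0"
    and M: "AE x in \<mu>. r\<^sub>0 < dist x p \<longrightarrow> (\<rho>' (dist x p))\<^sup>2 * rad p x \<le> M" "0 < M"
    and N: "0 \<le> N"
    and G: "\<forall>\<^sub>F n::nat in sequentially. 0 \<le> G n \<and>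
      (AE x in \<mu>. 2 * real n < dist x p \<and> dist x p < 4 * real n \<longrightarrow> rad p x \<le> G n) \<and>
      G n / (real n)\<^sup>2 * measure \<mu> (ball p (4 * real n) - ball p (2 * real n)) \<le> exp (2 * N * (\<rho> (real n))\<^sup>2)"
    and t: "0 < t" "t \<le> 1 / (9 * M * (N + 1)\<^sup>2)"
    and f: "f \<in> L2 \<mu>" "\<And>x. 0 \<le> f x" "\<And>x. f x \<le> K" "\<And>x. f x \<noteq> 0 \<Longrightarrow> dist x p \<le> r"
  shows "(\<integral>x. f x \<partial>\<mu>) \<le> (\<integral>x. T t f x \<partial>\<mu>)"
proof -
  \<comment> \<open>Beyond the support of f and strictly beyond \<open>r\<^sub>0\<close>, where the
    hypotheses on \<rho> are available.\<close>
  define r1 where "r1 = max r (r\<^sub>0 + 1)"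
  have r1: "r\<^sub>0 < r1" "r \<le> r1" "0 \<le> r1" using r0 by (auto simp: r1_def)
  have f1: "dist x p \<le> r1" if "f x \<noteq> 0" for x using f(4)[OF that] r1 by simp
  define c where "c = (N + 1) * \<rho> r1"
  have \<rho>_top: "filterlim (\<lambda>n. \<rho> (real n)) at_top sequentially"
    by (rule filterlim_compose[OF top filterlim_real_sequentially])
  have "((\<lambda>x::real. exp (c * x - x\<^sup>2 / 2)) \<longlongrightarrow> 0) at_top" by real_asymp
  from tendsto_mult_left[OF filterlim_compose[OF this \<rho>_top], of "nrm f"]
  have lim: "(\<lambda>n. nrm f * exp (c * \<rho> (real n) - (\<rho> (real n))\<^sup>2 / 2)) \<longlonglongrightarrow> 0" by simp
  have bound: "\<forall>\<^sub>F n in sequentially. (\<integral>x. f x \<partial>\<mu>) - (\<integral>x. T t f x \<partial>\<mu>) \<le>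
      nrm f * exp (c * \<rho> (real n) - (\<rho> (real n))\<^sup>2 / 2)"
    using G eventually_gt_at_top[of "nat \<lceil>r1\<rceil> + 1"]
      filterlim_at_top_dense[THEN iffD1, OF \<rho>_top, rule_format, of "max 1 (\<rho> r1)"]
      filterlim_at_top_dense[THEN iffD1, OF \<rho>_top, rule_format, of "1 / M"]
  proof eventually_elim
    case (elim n)
    define \<nu> where "\<nu> = \<rho> (real n)"
    have \<nu>: "1 < \<nu>" "\<rho> r1 < \<nu>" "1 / M < \<nu>" using elim by (auto simp: \<nu>_def)
    have n: "r1 < real n" "0 < real n" using elim(2) r1 by linarith+
    define \<alpha> where "\<alpha> = (N + 1) * \<nu>"
    have \<alpha>: "0 < \<alpha>" using N \<nu> by (simp add: \<alpha>_def)
    define l where "l = 9 / 2 * \<alpha>\<^sup>2 * M"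
    let ?G = "9 / 4 * G n / (4 * real n - 2 * real n)\<^sup>2 *
      measure \<mu> (ball p (4 * real n) - ball p (2 * real n))"
    have "(\<integral>x. f x \<partial>\<mu>) - (\<integral>x. T t f x \<partial>\<mu>) \<le>
      exp (l * t) * (nrm f / sqrt l * sqrt ?G / exp (\<alpha> * (\<rho> (real n) - \<rho> r1)))"
    proof (rule mass_loss_annulus[OF f(1-3) f1 r1(3) n(1) _ _ \<alpha> t(1) _ _ _ _ _ M(2) _ _ l_def])
      show "(\<rho> has_real_derivative \<rho>' s) (at s)" if "r1 \<le> s" "s \<le> real n" for s
        using that r1 by (intro der) auto
      show "continuous_on {r1..real n} \<rho>'" by (rule continuous_on_subset[OF cont]) (use r1 in auto)
      show "mono_on {r1..real n} \<rho>" by (rule mono_on_subset[OF mono]) (use r1 in auto)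
      show "AE x in \<mu>. r1 < dist x p \<and> dist x p < real n \<longrightarrow> (\<rho>' (dist x p))\<^sup>2 * rad p x \<le> M"
        using M(1) by eventually_elim (use r1 in auto)
    qed (use elim n \<nu> in \<open>auto simp: \<nu>_def\<close>)
    also have "\<dots> \<le> exp (\<nu>\<^sup>2 / 2) * (nrm f * exp (N * \<nu>\<^sup>2) / exp (\<alpha> * (\<nu> - \<rho> r1)))"
    proof -
      have "l * t \<le> l * (1 / (9 * M * (N + 1)\<^sup>2))"
        by (rule mult_left_mono[OF t(2)]) (use \<alpha> M in \<open>simp add: l_def\<close>)
      also have "\<dots> = \<nu>\<^sup>2 / 2" using M N by (simp add: l_def \<alpha>_def power_mult_distrib)
      finally have A: "exp (l * t) \<le> exp (\<nu>\<^sup>2 / 2)" by simp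
      \<comment> \<open>The threshold 1 / M < \<nu> serves to get l \<ge> 1, so that the factor 1 /
        sqrt l can be discarded.\<close>
      have "1 \<le> \<nu> * M" using \<nu>(3) M by (simp add: field_simps)
      also have "\<nu> * M \<le> \<alpha>\<^sup>2 * M"
      proof (rule mult_right_mono)
        have "1 * \<nu> \<le> (N + 1) * \<nu>" using N \<nu> by (intro mult_right_mono) auto
        then have "\<nu> \<le> \<alpha>" by (simp add: \<alpha>_def)
        then have "1 * \<nu> \<le> \<alpha> * \<alpha>" using \<nu> by (intro mult_mono) auto
        then show "\<nu> \<le> \<alpha>\<^sup>2" by (simp add: power2_eq_square)
      qed (use M in simp)
      also have "\<alpha>\<^sup>2 * M \<le> l" using M by (simp add: l_def)
      finally have "1 \<le> sqrt l" by simp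
      then have B: "nrm f / sqrt l \<le> nrm f"
        using divide_left_mono[of 1 "sqrt l" "nrm f"] by simp
      \<comment> \<open>The annulus has width 2 n, which turns 9/4 into 9/16.\<close>
      have G_eq: "?G = 9 / 16 * (G n / (real n)\<^sup>2 * measure \<mu> (ball p (4 * real n) - ball p (2 * real n)))"
        by (simp add: power2_eq_square)
      have G0: "0 \<le> ?G" using elim(1) by simp
      have "?G \<le> 9 / 16 * exp (2 * N * \<nu>\<^sup>2)"
        unfolding G_eq \<nu>_def using elim(1) by (intro mult_left_mono) auto
      also have "\<dots> \<le> 1 * exp (2 * N * \<nu>\<^sup>2)" by (intro mult_right_mono) auto
      also have "\<dots> = (exp (N * \<nu>\<^sup>2))\<^sup>2" by (simp add: power2_eq_square flip: exp_add)
      finally have "sqrt ?G \<le> sqrt ((exp (N * \<nu>\<^sup>2))\<^sup>2)" by (rule real_sqrt_le_mono)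
      then have C: "sqrt ?G \<le> exp (N * \<nu>\<^sup>2)" by (simp only: real_sqrt_abs abs_exp_cancel)
      have "nrm f / sqrt l * sqrt ?G \<le> nrm f * exp (N * \<nu>\<^sup>2)"
        by (rule mult_mono[OF B C L2_norm_nonneg real_sqrt_ge_zero[OF G0]])
      then have D: "nrm f / sqrt l * sqrt ?G / exp (\<alpha> * (\<nu> - \<rho> r1)) \<le>
          nrm f * exp (N * \<nu>\<^sup>2) / exp (\<alpha> * (\<nu> - \<rho> r1))"
        by (rule divide_right_mono) simp
      have "0 \<le> nrm f / sqrt l * sqrt ?G / exp (\<alpha> * (\<nu> - \<rho> r1))"
        using G0 \<open>1 \<le> sqrt l\<close>
        by (intro real_sqrt_ge_zero[OF G0] divide_nonneg_nonneg mult_nonneg_nonneg) auto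
      from mult_mono[OF A D _ this] show ?thesis unfolding \<nu>_def by simp
    qed
    also have "\<dots> = nrm f * exp (\<nu>\<^sup>2 / 2 + N * \<nu>\<^sup>2 - \<alpha> * (\<nu> - \<rho> r1))"
      by (simp add: exp_add exp_diff)
    also have "\<nu>\<^sup>2 / 2 + N * \<nu>\<^sup>2 - \<alpha> * (\<nu> - \<rho> r1) = c * \<nu> - \<nu>\<^sup>2 / 2"
      by (simp add: \<alpha>_def c_def power2_eq_square algebra_simps)
    finally show ?case unfolding \<nu>_def .
  qed
  have "(\<integral>x. f x \<partial>\<mu>) - (\<integral>x. T t f x \<partial>\<mu>) \<le> 0"
    by (rule tendsto_lowerbound[OF lim bound]) simp
  then show ?thesis by simp
qed

section \<open>Conservativeness\<close>

text \<open>Truncating h in height and to balls gives admissible f below h; positivity passes their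
  lower bound to \<open>T t h\<close>, and the reverse inequality always holds.\<close>

lemma mass_preservingI:
  assumes t: "0 < t"
    and *: "\<And>f K r. f \<in> L2 \<mu> \<Longrightarrow> (\<And>x. 0 \<le> f x) \<Longrightarrow> (\<And>x. f x \<le> K) \<Longrightarrow>
      (\<And>x. f x \<noteq> 0 \<Longrightarrow> dist x p \<le> r) \<Longrightarrow> (\<integral>x. f x \<partial>\<mu>) \<le> (\<integral>x. T t f x \<partial>\<mu>)"
  shows "mass_preserving t"
  unfolding mass_preserving_def
proof (intro allI impI)
  fix h assume h: "h \<in> L2 \<mu>" "integrable \<mu> h" "AE x in \<mu>. 0 \<le> h x"
  define f where "f k x = min (max (h x) 0) (real k) * indicat_real (cball p (real k)) x" for k x
  have f_meas: "f k \<in> borel_measurable \<mu>" for k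
    unfolding f_def using h(1) cball_sets by (intro borel_measurable_times) auto
  have f_abs: "\<bar>f k x\<bar> \<le> \<bar>h x\<bar>" for k x by (auto simp: f_def indicator_def)
  have fL: "f k \<in> L2 \<mu>" for k by (rule L2_bound[OF h(1) f_meas]) (use f_abs in auto)
  have f_le: "AE x in \<mu>. f k x \<le> h x" for k
    using h(3) by eventually_elim (auto simp: f_def indicator_def)
  have le: "(\<integral>x. f k x \<partial>\<mu>) \<le> (\<integral>x. T t h x \<partial>\<mu>)" for k
  proof -
    have fint: "integrable \<mu> (f k)"
      by (rule Bochner_Integration.integrable_bound[OF h(2) f_meas]) (use f_abs in auto)
    have "(\<integral>x. f k x \<partial>\<mu>) \<le> (\<integral>x. T t (f k) x \<partial>\<mu>)"
    proof (rule *[where K = "real k" and r = "real k"])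
      show "0 \<le> f k x" "f k x \<le> real k" for x by (auto simp: f_def indicator_def)
      show "dist x p \<le> real k" if "f k x \<noteq> 0" for x
        using that by (auto simp: f_def indicator_def dist_commute split: if_splits)
    qed (rule fL)
    also have "\<dots> \<le> (\<integral>x. T t h x \<partial>\<mu>)"
    proof (rule integral_mono_AE)
      show "integrable \<mu> (T t (f k))"
        by (rule sg_integrable[OF fL fint _ t]) (auto simp: f_def)
    qed (use sg_integrable[OF h t] sg_mono[OF fL h(1) f_le t] in auto)
    finally show ?thesis .
  qed
  have "(\<lambda>k. \<integral>x. f k x \<partial>\<mu>) \<longlonglongrightarrow> (\<integral>x. h x \<partial>\<mu>)"
  proof (rule integral_dominated_convergence[where w = "\<lambda>x. \<bar>h x\<bar>"])
    show "AE x in \<mu>. (\<lambda>k. f k x) \<longlonglongrightarrow> h x"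
      using h(3)
    proof eventually_elim
      fix x assume "0 \<le> h x"
      obtain k0 :: nat where k0: "max (h x) (dist p x) \<le> real k0" using real_arch_simple by blast
      have "\<forall>\<^sub>F k in sequentially. f k x = h x"
        using eventually_ge_at_top[of k0]
      proof eventually_elim
        fix k assume "k0 \<le> k"
        then have "h x \<le> real k" "dist p x \<le> real k" using k0 by linarith+
        then show "f k x = h x" using \<open>0 \<le> h x\<close> by (simp add: f_def)
      qed
      then show "(\<lambda>k. f k x) \<longlonglongrightarrow> h x" by (rule tendsto_eventually)
    qed
  qed (use h f_meas f_abs in auto)
  then have "(\<integral>x. h x \<partial>\<mu>) \<le> (\<integral>x. T t h x \<partial>\<mu>)"
    by (rule LIMSEQ_le_const2) (use le in auto)
  with sg_integral_le[OF h t] show "(\<integral>x. T t h x \<partial>\<mu>) = (\<integral>x. h x \<partial>\<mu>)" by simp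
qed

end

lemma mass_preserving_add:
  assumes "mass_preserving s" "mass_preserving t" "0 < s" "0 < t"
  shows "mass_preserving (s + t)"
  unfolding mass_preserving_def
proof (intro allI impI)
  fix h assume h: "h \<in> L2 \<mu>" "integrable \<mu> h" "AE x in \<mu>. 0 \<le> h x"
  have L: "T t h \<in> L2 \<mu>" "T s (T t h) \<in> L2 \<mu>" "T (s + t) h \<in> L2 \<mu>"
    using h assms by (auto intro!: sg_L2)
  have "(\<integral>x. T (s + t) h x \<partial>\<mu>) = (\<integral>x. T s (T t h) x \<partial>\<mu>)"
    by (rule integral_cong_AE) (use L sg_semigroup[OF assms(3,4) h(1)] in auto)
  also have "\<dots> = (\<integral>x. T t h x \<partial>\<mu>)"
    using assms(1) L(1) sg_integrable[OF h assms(4)] sg_nonneg[OF h(1,3) assms(4)]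
    unfolding mass_preserving_def by blast
  also have "\<dots> = (\<integral>x. h x \<partial>\<mu>)" using assms(2) h unfolding mass_preserving_def by blast
  finally show "(\<integral>x. T (s + t) h x \<partial>\<mu>) = (\<integral>x. h x \<partial>\<mu>)" .
qed

text \<open>The time threshold is the same for all functions, so t is cut into equal steps below
  it.\<close>

lemma mass_preserving_all:
  assumes "0 < t\<^sub>0" "\<And>t. 0 < t \<Longrightarrow> t \<le> t\<^sub>0 \<Longrightarrow> mass_preserving t" "0 < t"
  shows "mass_preserving t"
proof -
  obtain n :: nat where n: "t / t\<^sub>0 \<le> real n" using real_arch_simple by blast
  define s where "s = t / real (Suc n)"
  have s: "0 < s" "s \<le> t\<^sub>0" "real (Suc n) * s = t"
    using assms n by (auto simp: s_def field_simps)
  have "mass_preserving (real (Suc k) * s)" for k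
  proof (induction k)
    case 0
    then show ?case using assms(2) s by simp
  next
    case (Suc k)
    have "mass_preserving (real (Suc k) * s + s)"
      using s assms(2) by (intro mass_preserving_add Suc) auto
    then show ?case by (simp add: algebra_simps)
  qed
  from this[of n] show ?thesis by (simp only: s)
qed

section \<open>From mass preservation to the extension on bounded functions\<close>

lemma L2_approx_indicator: "L2_approx \<mu> (\<lambda>x. 1) (\<lambda>n. indicat_real (cball p (real n)))"
  unfolding L2_approx_def
proof (intro conjI allI AE_I2)
  show "indicat_real (cball p (real n)) \<in> L2 \<mu> \<inter> Linf \<mu>" for n
    using indicator_cball_L2 cball_sets by (auto intro!: Linf_I[where B = 1])
  show "(\<lambda>n. indicat_real (cball p (real n)) x) \<longlonglongrightarrow> 1" for x
  proof -
    obtain k :: nat where "dist p x \<le> real k" using real_arch_simple by blast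
    then have "indicat_real (cball p (real n)) x = 1" if "k \<le> n" for n
      using that by (auto simp: indicator_def)
    then have "\<forall>\<^sub>F n in sequentially. indicat_real (cball p (real n)) x = 1"
      unfolding eventually_sequentially by blast
    then show ?thesis by (rule tendsto_eventually)
  qed
qed (auto simp: indicator_def)

text \<open>The images increase to some g \<le> 1. Paired with the indicator of a ball, symmetry and
  mass preservation give the limit measure of the ball, so g has the full integral there and equals
  1.\<close>

lemma approx_one_tendsto:
  assumes t: "0 < t" and P: "mass_preserving t" and F: "L2_approx \<mu> (\<lambda>x. 1) F"
  shows "AE x in \<mu>. (\<lambda>n. T t (F n) x) \<longlonglongrightarrow> 1"
proof -
  fix p :: 'a
  have FL: "F n \<in> L2 \<mu>" for n using F by (auto simp: L2_approx_def)
  have FT: "T t (F n) \<in> L2 \<mu>" for n by (rule sg_L2[OF t FL])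
  have F_AE: "AE x in \<mu>. (\<forall>n. 0 \<le> F n x \<and> F n x \<le> F (Suc n) x) \<and> (\<lambda>n. F n x) \<longlonglongrightarrow> 1"
    using F by (simp add: L2_approx_def)
  have F1: "AE x in \<mu>. \<forall>n. F n x \<le> 1"
    using F_AE
  proof eventually_elim
    case (elim x)
    then have "incseq (\<lambda>n. F n x)" by (auto intro: incseq_SucI)
    from incseq_le[OF this] elim show ?case by simp
  qed
  have T1: "AE x in \<mu>. \<forall>n. T t (F n) x \<le> 1"
    unfolding AE_all_countable
    by (intro allI sg_le FL t) (use F1 in auto)
  have T0: "AE x in \<mu>. \<forall>n. 0 \<le> T t (F n) x"
    unfolding AE_all_countable
  proof
    fix n show "AE x in \<mu>. 0 \<le> T t (F n) x" by (rule sg_nonneg[OF FL _ t]) (use F_AE in auto)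
  qed
  have Tm: "AE x in \<mu>. \<forall>n. T t (F n) x \<le> T t (F (Suc n)) x"
    unfolding AE_all_countable
  proof
    fix n show "AE x in \<mu>. T t (F n) x \<le> T t (F (Suc n)) x"
      by (rule sg_mono[OF FL FL _ t]) (use F_AE in auto)
  qed
  define g where "g x = Topological_Spaces.lim (\<lambda>n. T t (F n) x)" for x
  have g_meas: "g \<in> borel_measurable \<mu>"
    unfolding g_def using FT by (intro borel_measurable_lim_metric) auto
  have conv: "AE x in \<mu>. (\<lambda>n. T t (F n) x) \<longlonglongrightarrow> g x \<and> g x \<le> 1 \<and> 0 \<le> g x"
    using T1 Tm T0
  proof eventually_elim
    case (elim x)
    then have "incseq (\<lambda>n. T t (F n) x)" by (auto intro: incseq_SucI)
    obtain L where L: "(\<lambda>n. T t (F n) x) \<longlonglongrightarrow> L"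
      by (rule incseq_convergent[OF \<open>incseq (\<lambda>n. T t (F n) x)\<close> elim(1)])
    then have "g x = L" by (simp add: g_def limI)
    moreover have "L \<le> 1" by (rule LIMSEQ_le_const2[OF L]) (use elim in auto)
    moreover have "0 \<le> L" by (rule LIMSEQ_le_const[OF L]) (use elim in auto)
    ultimately show ?case using L by simp
  qed
  have "AE x in \<mu>. x \<in> cball p (real k) \<longrightarrow> g x = 1" for k :: nat
  proof -
    let ?h = "indicat_real (cball p (real k))"
    have h: "?h \<in> L2 \<mu>" "AE x in \<mu>. 0 \<le> ?h x" by (simp_all add: indicator_cball_L2)
    have h2: "integrable \<mu> ?h"
      by (rule integrable_real_indicator[OF cball_sets emeasure_cball])
    have Th: "T t ?h \<in> L2 \<mu>" "integrable \<mu> (T t ?h)" using sg_L2[OF t h(1)] sg_integrable[OF h(1) h2 h(2) t] by auto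
    have "(\<lambda>n. \<integral>x. F n x * T t ?h x \<partial>\<mu>) \<longlonglongrightarrow> (\<integral>x. T t ?h x \<partial>\<mu>)"
    proof (rule integral_dominated_convergence[where w = "\<lambda>x. \<bar>T t ?h x\<bar>"])
      show "AE x in \<mu>. (\<lambda>n. F n x * T t ?h x) \<longlonglongrightarrow> T t ?h x"
        using F_AE by eventually_elim (auto intro!: tendsto_eq_intros)
      show "AE x in \<mu>. norm (F n x * T t ?h x) \<le> \<bar>T t ?h x\<bar>" for n
        using F_AE F1 by eventually_elim (auto simp: abs_mult mult_left_le_one_le)
    qed (use Th FL in \<open>auto intro!: borel_measurable_times\<close>)
    moreover have "(\<integral>x. F n x * T t ?h x \<partial>\<mu>) = (\<integral>x. T t (F n) x * ?h x \<partial>\<mu>)" for n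
      using sg_sym[OF t FL h(1)] by (simp add: L2_inner_def)
    moreover have "(\<integral>x. T t ?h x \<partial>\<mu>) = (\<integral>x. ?h x \<partial>\<mu>)"
      using P h h2 unfolding mass_preserving_def by blast
    ultimately have lim1: "(\<lambda>n. \<integral>x. T t (F n) x * ?h x \<partial>\<mu>) \<longlonglongrightarrow> (\<integral>x. ?h x \<partial>\<mu>)" by simp
    have lim2: "(\<lambda>n. \<integral>x. T t (F n) x * ?h x \<partial>\<mu>) \<longlonglongrightarrow> (\<integral>x. g x * ?h x \<partial>\<mu>)"
    proof (rule integral_dominated_convergence[where w = ?h])
      show "AE x in \<mu>. (\<lambda>n. T t (F n) x * ?h x) \<longlonglongrightarrow> g x * ?h x"
        using conv by eventually_elim (auto intro!: tendsto_intros)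
      show "AE x in \<mu>. norm (T t (F n) x * ?h x) \<le> ?h x" for n
        using T1 T0 by eventually_elim (auto simp: indicator_def)
    qed (use h h2 g_meas FT in \<open>auto intro!: borel_measurable_times\<close>)
    have gh: "integrable \<mu> (\<lambda>x. g x * ?h x)"
    proof (rule Bochner_Integration.integrable_bound[OF h2])
      show "AE x in \<mu>. norm (g x * ?h x) \<le> norm (?h x)"
        using conv by eventually_elim (auto simp: indicator_def)
    qed (use h h2 g_meas in \<open>auto intro!: borel_measurable_times\<close>)
    have "(\<integral>x. ?h x - g x * ?h x \<partial>\<mu>) = 0"
      using LIMSEQ_unique[OF lim1 lim2] gh h2 by simp
    moreover have "integrable \<mu> (\<lambda>x. ?h x - g x * ?h x)" using gh h2 by simp
    moreover have "AE x in \<mu>. 0 \<le> ?h x - g x * ?h x"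
      using conv by eventually_elim (auto simp: indicator_def)
    ultimately have "AE x in \<mu>. ?h x - g x * ?h x = 0"
      using integral_nonneg_eq_0_iff_AE[of \<mu> "\<lambda>x. ?h x - g x * ?h x"] by simp
    then show ?thesis by eventually_elim (auto simp: indicator_def)
  qed
  then have "AE x in \<mu>. \<forall>k::nat. x \<in> cball p (real k) \<longrightarrow> g x = 1"
    unfolding AE_all_countable by (intro allI)
  with conv show "AE x in \<mu>. (\<lambda>n. T t (F n) x) \<longlonglongrightarrow> 1"
  proof eventually_elim
    case (elim x)
    obtain k :: nat where "dist p x \<le> real k" using real_arch_simple by blast
    then have "g x = 1" using elim by auto
    then show ?case using elim by simp
  qed
qed

text \<open>The extension is a choice. The given g shows that the choice succeeds; one concrete
  approximating sequence then identifies the chosen function through uniqueness of limits.\<close>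

lemma Linf_ext_nonneg_eq:
  assumes "\<And>F. L2_approx \<mu> f F \<Longrightarrow> AE x in \<mu>. (\<lambda>n. T t (F n) x) \<longlonglongrightarrow> g x"
    and "g \<in> borel_measurable \<mu>" "L2_approx \<mu> f F"
  shows "AE x in \<mu>. Linf_ext_nonneg \<mu> T t f x = g x"
proof -
  have "\<exists>g. g \<in> borel_measurable \<mu> \<and> (\<forall>F. L2_approx \<mu> f F \<longrightarrow> (AE x in \<mu>. (\<lambda>n. T t (F n) x) \<longlonglongrightarrow> g x))"
    using assms(1,2) by blast
  then have *: "\<forall>F. L2_approx \<mu> f F \<longrightarrow> (AE x in \<mu>. (\<lambda>n. T t (F n) x) \<longlonglongrightarrow> Linf_ext_nonneg \<mu> T t f x)"
    unfolding Linf_ext_nonneg_def by (rule someI_ex[THEN conjunct2])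
  have "AE x in \<mu>. (\<lambda>n. T t (F n) x) \<longlonglongrightarrow> Linf_ext_nonneg \<mu> T t f x"
    using assms(3) by (rule *[rule_format])
  with assms(1)[OF assms(3)] show ?thesis by eventually_elim (rule LIMSEQ_unique)
qed

text \<open>\<open>Linf_ext\<close> subtracts the extension of the negative part, here the zero
  function, whose value also comes from a choice and must be computed.\<close>

lemma approx_zero_tendsto:
  assumes t: "0 < t" and F: "L2_approx \<mu> (\<lambda>x. 0) F"
  shows "AE x in \<mu>. (\<lambda>n. T t (F n) x) \<longlonglongrightarrow> 0"
proof -
  have FL: "F n \<in> L2 \<mu>" for n using F by (auto simp: L2_approx_def)
  have F_AE: "AE x in \<mu>. (\<forall>n. 0 \<le> F n x \<and> F n x \<le> F (Suc n) x) \<and> (\<lambda>n. F n x) \<longlonglongrightarrow> 0"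
    using F by (simp add: L2_approx_def)
  have F0: "AE x in \<mu>. \<forall>n. F n x = 0"
    using F_AE
  proof eventually_elim
    case (elim x)
    then have "incseq (\<lambda>n. F n x)" by (auto intro: incseq_SucI)
    from incseq_le[OF this] elim have "F n x \<le> 0" for n by simp
    with elim show ?case by (simp add: order_antisym)
  qed
  have "AE x in \<mu>. \<forall>n. T t (F n) x = 0"
    unfolding AE_all_countable
  proof
    fix n
    have le: "AE x in \<mu>. T t (F n) x \<le> 0" by (rule sg_le[OF FL _ _ t]) (use F0 in auto)
    have "AE x in \<mu>. 0 \<le> T t (F n) x" by (rule sg_nonneg[OF FL _ t]) (use F_AE in auto)
    with le show "AE x in \<mu>. T t (F n) x = 0" by eventually_elim simp
  qed
  then show ?thesis by eventually_elim simp
qed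

lemma conservativeI:
  assumes "\<And>t. 0 < t \<Longrightarrow> mass_preserving t"
  shows "conservative \<mu> T"
  unfolding conservative_def
proof (intro allI impI)
  fix t :: real assume t: "0 < t"
  have 1: "AE x in \<mu>. Linf_ext_nonneg \<mu> T t (\<lambda>x. 1) x = 1"
    by (rule Linf_ext_nonneg_eq[OF approx_one_tendsto[OF t assms[OF t]] _ L2_approx_indicator]) auto
  have "L2_approx \<mu> (\<lambda>x. 0) (\<lambda>n x. 0)" by (auto simp: L2_approx_def intro!: Linf_I[where B = 0])
  then have 0: "AE x in \<mu>. Linf_ext_nonneg \<mu> T t (\<lambda>x. 0) x = 0"
    by (rule Linf_ext_nonneg_eq[OF approx_zero_tendsto[OF t], rotated 2]) auto
  show "AE x in \<mu>. Linf_ext \<mu> T t (\<lambda>y. 1) x = 1"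
    unfolding Linf_ext_def using 1 0 by eventually_elim simp
qed

lemma conservative_criterion:
  assumes d: "(\<lambda>x. dist x p) \<in> F_loc \<mu> \<F>"
    and "\<And>s. r\<^sub>0 < s \<Longrightarrow> (\<rho> has_real_derivative \<rho>' s) (at s)"
    and "continuous_on {r\<^sub>0<..} \<rho>'" and "mono_on {r\<^sub>0<..} \<rho>"
    and "filterlim \<rho> at_top at_top" and "0 \<le> r\<^sub>0"
    and "AE x in \<mu>. r\<^sub>0 < dist x p \<longrightarrow> (\<rho>' (dist x p))\<^sup>2 * rad p x \<le> M" and M: "0 < M" and N: "0 \<le> N"
    and "\<forall>\<^sub>F n::nat in sequentially. 0 \<le> G n \<and>
      (AE x in \<mu>. 2 * real n < dist x p \<and> dist x p < 4 * real n \<longrightarrow> rad p x \<le> G n) \<and>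
      G n / (real n)\<^sup>2 * measure \<mu> (ball p (4 * real n) - ball p (2 * real n)) \<le> exp (2 * N * (\<rho> (real n))\<^sup>2)"
  shows "conservative \<mu> T"
proof (rule conservativeI, rule mass_preserving_all)
  show "0 < 1 / (9 * M * (N + 1)\<^sup>2)" using M N by simp
  show "mass_preserving t" if "0 < t" "t \<le> 1 / (9 * M * (N + 1)\<^sup>2)" for t
    by (rule mass_preservingI[OF d that(1)], rule short_time_mass[OF assms(1-9,10) that]) auto
qed

end

section \<open>The growth conditions\<close>

text \<open>Energy cost of a cutoff per unit volume. The exponent \<beta> is raised to 2; 25 comes
  from 4 n + 1 \<le> 5 n, and 4 from ln (4 n + 1) \<le> 2 ln (n + 1).\<close>

lemma eventually_carre_bound_le:
  assumes "0 < M" "0 \<le> \<beta>" "\<beta> \<le> 2"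
  shows "\<forall>\<^sub>F n::nat in sequentially.
    M * (4 * real n + 1)\<^sup>2 * ln (4 * real n + 1) powr \<beta> / (real n)\<^sup>2 \<le> 100 * M * (ln (real n + 1))\<^sup>2"
  using eventually_ge_at_top[of 3]
proof eventually_elim
  fix n :: nat assume n: "3 \<le> n"
  then have n': "3 \<le> real n" by simp
  let ?l = "ln (4 * real n + 1)"
  have "exp 1 \<le> 4 * real n + 1" using exp_le n' by linarith
  then have l1: "1 \<le> ?l" using n' by (simp add: ln_ge_iff)
  have "3 * real n \<le> real n * real n" using n' by (intro mult_right_mono) auto
  then have "4 * real n + 1 \<le> (real n + 1)\<^sup>2"
    unfolding power2_eq_square distrib_left distrib_right using n' by linarith
  then have "?l \<le> ln ((real n + 1)\<^sup>2)" using n' by (subst ln_le_cancel_iff) auto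
  also have "\<dots> = 2 * ln (real n + 1)" using n' by (simp add: ln_realpow)
  finally have l2: "?l \<le> 2 * ln (real n + 1)" .
  have "?l powr \<beta> \<le> ?l powr 2" using l1 assms by (intro powr_mono) auto
  also have "\<dots> = ?l\<^sup>2" using l1 by simp
  also have "\<dots> \<le> (2 * ln (real n + 1))\<^sup>2" using l1 l2 by (intro power_mono) auto
  finally have A: "?l powr \<beta> \<le> 4 * (ln (real n + 1))\<^sup>2" by (simp add: power_mult_distrib)
  have "(4 * real n + 1)\<^sup>2 \<le> (5 * real n)\<^sup>2" using n' by (intro power_mono) auto
  then have B: "(4 * real n + 1)\<^sup>2 / (real n)\<^sup>2 \<le> 25" using n' by (simp add: field_simps)
  have "M * (4 * real n + 1)\<^sup>2 * ?l powr \<beta> / (real n)\<^sup>2 = M * ((4 * real n + 1)\<^sup>2 / (real n)\<^sup>2 * ?l powr \<beta>)"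
    by simp
  also have "\<dots> \<le> M * (25 * (4 * (ln (real n + 1))\<^sup>2))"
    using assms A B by (intro mult_left_mono mult_mono) auto
  finally show "M * (4 * real n + 1)\<^sup>2 * ?l powr \<beta> / (real n)\<^sup>2 \<le> 100 * M * (ln (real n + 1))\<^sup>2"
    by simp
qed

text \<open>With y = x powr \<delta> this is the comparison of a power of y with exp (2 y).\<close>

lemma eventually_square_le_exp_powr:
  assumes "0 < (\<delta>::real)"
  shows "\<forall>\<^sub>F x in at_top. C * x\<^sup>2 \<le> exp (2 * x powr \<delta>)"
proof -
  have "((\<lambda>y::real. C * (y powr (2 / \<delta>) / exp (2 * y))) \<longlongrightarrow> C * 0) at_top"
    by (intro tendsto_mult_left, real_asymp)
  moreover have "filterlim (\<lambda>x::real. x powr \<delta>) at_top at_top" using assms by real_asymp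
  ultimately have "((\<lambda>x. C * ((x powr \<delta>) powr (2 / \<delta>) / exp (2 * x powr \<delta>))) \<longlongrightarrow> C * 0) at_top"
    by (rule filterlim_compose)
  from order_tendstoD(2)[OF this, of 1] have
    "\<forall>\<^sub>F x in at_top. C * ((x powr \<delta>) powr (2 / \<delta>) / exp (2 * x powr \<delta>)) < 1" by simp
  with eventually_gt_at_top[of 0] show ?thesis
  proof eventually_elim
    fix x :: real assume "0 < x" "C * ((x powr \<delta>) powr (2 / \<delta>) / exp (2 * x powr \<delta>)) < 1"
    moreover have "(x powr \<delta>) powr (2 / \<delta>) = x\<^sup>2"
      using \<open>0 < x\<close> assms by (simp add: powr_powr)
    ultimately show "C * x\<^sup>2 \<le> exp (2 * x powr \<delta>)" by (simp add: divide_less_eq)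
  qed
qed

context local_dirichlet_semigroup
begin

text \<open>With a bounded density the distance is its own scale. The factor M / n^2 is eventually
  at most 1, so the volume bound passes to the cutoff with the same N.\<close>

lemma conservative_gaussian_growth:
  assumes d: "(\<lambda>x. dist x p) \<in> F_loc \<mu> \<F>" and M: "0 < M" and N: "0 < N"
    and K: "compact K" and rad: "AE x in \<mu>. x \<notin> K \<longrightarrow> rad p x \<le> M"
    and vol: "\<forall>\<^sub>F n::nat in sequentially.
      emeasure \<mu> (ball p (4 * real n) - ball p (2 * real n)) \<le> ennreal (exp (2 * N * (real n)\<^sup>2))"
  shows "conservative \<mu> T"
proof -
  obtain k where k: "\<forall>x\<in>K. dist p x \<le> k"
    using compact_imp_bounded[OF K] unfolding bounded_any_center[of K p] by blast
  define r where "r = max k 0"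
  have out: "x \<notin> K" if "r < dist x p" for x using that k by (force simp: r_def dist_commute)
  show ?thesis
  proof (rule conservative_criterion[OF d, where r\<^sub>0 = r and \<rho> = "\<lambda>s. s" and \<rho>' = "\<lambda>s. 1" and M = M
        and N = N and G = "\<lambda>n. M"])
    show "AE x in \<mu>. r < dist x p \<longrightarrow> 1\<^sup>2 * rad p x \<le> M"
      using rad by eventually_elim (use out in simp)
    show "\<forall>\<^sub>F n::nat in sequentially. 0 \<le> M \<and>
      (AE x in \<mu>. 2 * real n < dist x p \<and> dist x p < 4 * real n \<longrightarrow> rad p x \<le> M) \<and>
      M / (real n)\<^sup>2 * measure \<mu> (ball p (4 * real n) - ball p (2 * real n)) \<le> exp (2 * N * (real n)\<^sup>2)"
      using vol eventually_ge_at_top[of "nat \<lceil>M\<rceil> + nat \<lceil>r\<rceil> + 1"]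
    proof eventually_elim
      case (elim n)
      have n: "M \<le> real n" "r \<le> real n" "1 \<le> real n" using elim(2) by linarith+
      have "M * 1 \<le> real n * real n" using n M by (intro mult_mono) auto
      then have "M / (real n)\<^sup>2 \<le> 1" using n by (simp add: power2_eq_square)
      then have "M / (real n)\<^sup>2 * measure \<mu> (ball p (4 * real n) - ball p (2 * real n)) \<le> 1 * exp (2 * N * (real n)\<^sup>2)"
        using measure_le_of_emeasure_le[OF elim(1)] by (intro mult_mono) auto
      moreover have "AE x in \<mu>. 2 * real n < dist x p \<and> dist x p < 4 * real n \<longrightarrow> rad p x \<le> M"
        using rad by eventually_elim (use out n in auto)
      ultimately show ?case using M by simp
    qed
    show "((\<lambda>s. s) has_real_derivative 1) (at s)" for s :: real by (rule DERIV_ident)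
    show "filterlim (\<lambda>s::real. s) at_top at_top" by (rule filterlim_ident)
    show "mono_on {r<..} (\<lambda>s. s)" by (rule mono_onI)
  qed (use M N in \<open>simp_all add: r_def\<close>)
qed

text \<open>Up to a factor at most 1, \<rho>' is 1 / ((s + 1) ln (s + 1) powr (\<beta> / 2)), which
  cancels the allowed growth of \<Gamma>(d, d). Its antiderivative is a power of the logarithm for
  \<beta> < 2 and ln ln for \<beta> = 2, whence the two cases. N is raised by 1 to absorb the
  logarithmic factor of the cutoff energy.\<close>

lemma conservative_log_growth:
  assumes d: "(\<lambda>x. dist x p) \<in> F_loc \<mu> \<F>" and M: "0 < M" and N: "0 < N" and \<beta>: "0 \<le> \<beta>" "\<beta> \<le> 2"
    and K: "compact K"
    and rad: "AE x in \<mu>. x \<notin> K \<longrightarrow> rad p x \<le> M * (dist x p + 1)\<^sup>2 * rpow (ln (dist x p + 1)) \<beta>"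
    and vol: "\<beta> < 2 \<Longrightarrow> \<forall>\<^sub>F n::nat in sequentially.
      emeasure \<mu> (ball p (4 * real n) - ball p (2 * real n))
        \<le> ennreal (exp (2 * N * rpow (ln (real n + 1)) (2 - \<beta>)))"
    and vol2: "\<beta> = 2 \<Longrightarrow> \<forall>\<^sub>F n::nat in sequentially.
      emeasure \<mu> (ball p (4 * real n) - ball p (2 * real n))
        \<le> ennreal (rpow (ln (real n + 1)) (2 * N))"
  shows "conservative \<mu> T"
proof -
  obtain k where k: "\<forall>x\<in>K. dist p x \<le> k"
    using compact_imp_bounded[OF K] unfolding bounded_any_center[of K p] by blast
  \<comment> \<open>Beyond K, and with 2 to keep all logarithms positive; there \<open>rpow\<close>
    and \<open>powr\<close> agree.\<close>
  define r where "r = max k 2"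
  have r: "2 \<le> r" by (simp add: r_def)
  have out: "x \<notin> K" if "r < dist x p" for x using that k by (force simp: r_def dist_commute)
  have lnpos: "0 < ln (s + 1)" if "r < s" for s :: real using that r by simp
  have rpow: "rpow x \<beta> = x powr \<beta>" if "0 < x" for x using that by (simp add: rpow_def)
  have rad': "AE x in \<mu>. r < dist x p \<longrightarrow> rad p x \<le> M * (dist x p + 1)\<^sup>2 * ln (dist x p + 1) powr \<beta>"
    using rad by eventually_elim (use out rpow lnpos in auto)
  define G where "G n = M * (4 * real n + 1)\<^sup>2 * ln (4 * real n + 1) powr \<beta>" for n
  have G0: "0 \<le> G n" for n using M by (simp add: G_def)
  have G_rad: "AE x in \<mu>. 2 * real n < dist x p \<and> dist x p < 4 * real n \<longrightarrow> rad p x \<le> G n"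
    if n: "r \<le> real n" for n
    using rad'
  proof (eventually_elim, intro impI)
    fix x assume *: "r < dist x p \<longrightarrow> rad p x \<le> M * (dist x p + 1)\<^sup>2 * ln (dist x p + 1) powr \<beta>"
      and x: "2 * real n < dist x p \<and> dist x p < 4 * real n"
    then have rx: "r < dist x p" using n r by linarith
    then have "rad p x \<le> M * (dist x p + 1)\<^sup>2 * ln (dist x p + 1) powr \<beta>" using * by simp
    also have "\<dots> \<le> G n" unfolding G_def
      using x M \<beta> lnpos[OF rx] r rx
      by (intro mult_mono mult_left_mono power_mono powr_mono2) auto
    finally show "rad p x \<le> G n" .
  qed
  have ln_top: "filterlim (\<lambda>n. ln (real n + 1)) at_top sequentially" by real_asymp
  show ?thesis
  proof (cases "\<beta> = 2")
    case True
    define \<rho> where "\<rho> s = ln (ln (s + 1))" for s :: real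
    define \<rho>' where "\<rho>' s = 1 / (ln (s + 1) * (s + 1))" for s :: real
    show ?thesis
    proof (rule conservative_criterion[OF d, where r\<^sub>0 = r and \<rho> = \<rho> and \<rho>' = \<rho>' and M = M
          and N = "N + 1" and G = G])
      show "(\<rho> has_real_derivative \<rho>' s) (at s)" if "r < s" for s
        unfolding \<rho>_def[abs_def] \<rho>'_def using that r lnpos[OF that]
        by (auto intro!: derivative_eq_intros simp: field_simps)
      show "continuous_on {r<..} \<rho>'"
        unfolding \<rho>'_def[abs_def] using r lnpos by (intro continuous_intros) force+
      show "mono_on {r<..} \<rho>"
        unfolding \<rho>_def using lnpos r by (intro mono_onI) auto
      show "filterlim \<rho> at_top at_top" unfolding \<rho>_def by real_asymp
      show "AE x in \<mu>. r < dist x p \<longrightarrow> (\<rho>' (dist x p))\<^sup>2 * rad p x \<le> M"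
        using rad'
      proof (eventually_elim, intro impI)
        fix x assume *: "r < dist x p \<longrightarrow> rad p x \<le> M * (dist x p + 1)\<^sup>2 * ln (dist x p + 1) powr \<beta>" "r < dist x p"
        let ?s = "dist x p"
        have "(\<rho>' ?s)\<^sup>2 * rad p x \<le> (\<rho>' ?s)\<^sup>2 * (M * (?s + 1)\<^sup>2 * ln (?s + 1) powr \<beta>)"
          using * by (intro mult_left_mono) auto
        also have "\<dots> = M" using lnpos[OF *(2)] r *(2) True
          by (simp add: \<rho>'_def power_divide power_mult_distrib)
        finally show "(\<rho>' ?s)\<^sup>2 * rad p x \<le> M" .
      qed
      have "\<forall>\<^sub>F x::real in at_top. 100 * M * x\<^sup>2 \<le> exp (2 * (ln x)\<^sup>2)" by real_asymp
      from eventually_compose_filterlim[OF this ln_top]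
      have ev: "\<forall>\<^sub>F n in sequentially. 100 * M * (ln (real n + 1))\<^sup>2 \<le> exp (2 * (\<rho> (real n))\<^sup>2)"
        by (simp add: \<rho>_def)
      show "\<forall>\<^sub>F n::nat in sequentially. 0 \<le> G n \<and>
        (AE x in \<mu>. 2 * real n < dist x p \<and> dist x p < 4 * real n \<longrightarrow> rad p x \<le> G n) \<and>
        G n / (real n)\<^sup>2 * measure \<mu> (ball p (4 * real n) - ball p (2 * real n)) \<le> exp (2 * (N + 1) * (\<rho> (real n))\<^sup>2)"
        using vol2[OF True] eventually_carre_bound_le[OF M \<beta>] ev eventually_ge_at_top[of "nat \<lceil>r\<rceil>"]
          filterlim_at_top[THEN iffD1, OF ln_top, rule_format, of "exp 1"]
      proof eventually_elim
        case (elim n)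
        have rn: "r \<le> real n" using elim(4) by linarith
        have l: "0 < ln (real n + 1)" using elim(5) exp_gt_zero[of "1::real"] by linarith
        have \<rho>1: "1 \<le> \<rho> (real n)" using elim(5) l by (simp add: \<rho>_def ln_ge_iff)
        have "rpow (ln (real n + 1)) (2 * N) = exp (2 * N * \<rho> (real n))"
          using l N by (simp add: rpow_def powr_def \<rho>_def)
        also have "\<dots> \<le> exp (2 * N * (\<rho> (real n))\<^sup>2)"
        proof -
          \<comment> \<open>For \<beta> = 2 the volume bound is exp (2 N \<rho>), only linear in
            \<rho>; it is weakened to the square once \<rho> \<ge> 1.\<close>
          have "\<rho> (real n) * 1 \<le> \<rho> (real n) * \<rho> (real n)" using \<rho>1 by (intro mult_left_mono) auto
          then show ?thesis using N by (simp add: power2_eq_square)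
        qed
        finally have v: "measure \<mu> (ball p (4 * real n) - ball p (2 * real n)) \<le> exp (2 * N * (\<rho> (real n))\<^sup>2)"
          using measure_le_of_emeasure_le[OF elim(1)] l by (simp add: rpow_def split: if_splits)
        have "G n / (real n)\<^sup>2 \<le> exp (2 * (\<rho> (real n))\<^sup>2)" using elim(2,3) by (simp add: G_def)
        then have "G n / (real n)\<^sup>2 * measure \<mu> (ball p (4 * real n) - ball p (2 * real n)) \<le>
            exp (2 * (\<rho> (real n))\<^sup>2) * exp (2 * N * (\<rho> (real n))\<^sup>2)"
          using v by (intro mult_mono) auto
        also have "\<dots> = exp (2 * (N + 1) * (\<rho> (real n))\<^sup>2)"
          by (simp add: algebra_simps flip: exp_add)
        finally show ?case using G0 G_rad[OF rn] by blast
      qed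
    qed (use M N r in auto)
  next
    case False
    then have \<beta>2: "\<beta> < 2" using \<beta> by simp
    define \<gamma> where "\<gamma> = 1 - \<beta> / 2"
    have \<gamma>: "0 < \<gamma>" "\<gamma> \<le> 1" "2 * \<gamma> = 2 - \<beta>" using \<beta> \<beta>2 by (auto simp: \<gamma>_def)
    define \<rho> where "\<rho> s = ln (s + 1) powr \<gamma>" for s :: real
    define \<rho>' where "\<rho>' s = \<gamma> * ln (s + 1) powr (\<gamma> - 1) / (s + 1)" for s :: real
    \<comment> \<open>This makes the volume hypothesis literally exp (2 N \<rho>^2).\<close>
    have \<rho>_sq: "(\<rho> s)\<^sup>2 = ln (s + 1) powr (2 - \<beta>)" for s
      unfolding \<rho>_def \<gamma>(3)[symmetric] by (simp add: power2_eq_square flip: powr_add)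
    show ?thesis
    proof (rule conservative_criterion[OF d, where r\<^sub>0 = r and \<rho> = \<rho> and \<rho>' = \<rho>' and M = M
          and N = "N + 1" and G = G])
      show "(\<rho> has_real_derivative \<rho>' s) (at s)" if "r < s" for s
      proof -
        have "((\<lambda>s. ln (s + 1)) has_real_derivative 1 / (s + 1)) (at s)"
          using that r by (auto intro!: derivative_eq_intros)
        from DERIV_chain2[OF has_real_derivative_powr[OF lnpos[OF that], of \<gamma>] this]
        show ?thesis unfolding \<rho>_def[abs_def] \<rho>'_def by simp
      qed
      show "continuous_on {r<..} \<rho>'"
        unfolding \<rho>'_def[abs_def] using r lnpos by (intro continuous_intros) force+
      show "mono_on {r<..} \<rho>"
        unfolding \<rho>_def using lnpos r \<gamma> by (intro mono_onI powr_mono2) (auto simp: less_imp_le)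
      show "filterlim \<rho> at_top at_top" unfolding \<rho>_def using \<gamma>(1) by real_asymp
      show "AE x in \<mu>. r < dist x p \<longrightarrow> (\<rho>' (dist x p))\<^sup>2 * rad p x \<le> M"
        using rad'
      proof (eventually_elim, intro impI)
        fix x assume *: "r < dist x p \<longrightarrow> rad p x \<le> M * (dist x p + 1)\<^sup>2 * ln (dist x p + 1) powr \<beta>" "r < dist x p"
        let ?s = "dist x p"
        have "(\<rho>' ?s)\<^sup>2 * rad p x \<le> (\<rho>' ?s)\<^sup>2 * (M * (?s + 1)\<^sup>2 * ln (?s + 1) powr \<beta>)"
          using * by (intro mult_left_mono) auto
        also have "\<dots> = \<gamma>\<^sup>2 * M * ((ln (?s + 1) powr (\<gamma> - 1))\<^sup>2 * ln (?s + 1) powr \<beta>)"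
          using r *(2) by (simp add: \<rho>'_def power_divide power_mult_distrib)
        also have "(ln (?s + 1) powr (\<gamma> - 1))\<^sup>2 * ln (?s + 1) powr \<beta> = ln (?s + 1) powr ((\<gamma> - 1) + (\<gamma> - 1) + \<beta>)"
          by (simp only: power2_eq_square powr_add)
        also have "(\<gamma> - 1) + (\<gamma> - 1) + \<beta> = 0" using \<gamma>(3) by simp
        also have "\<gamma>\<^sup>2 * M * ln (?s + 1) powr 0 \<le> 1 * M"
          using lnpos[OF *(2)] \<gamma> M by (simp add: power_le_one)
        finally show "(\<rho>' ?s)\<^sup>2 * rad p x \<le> M" by simp
      qed
      have "\<forall>\<^sub>F x::real in at_top. 100 * M * x\<^sup>2 \<le> exp (2 * x powr (2 - \<beta>))"
        by (rule eventually_square_le_exp_powr) (use \<beta>2 in simp)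
      from eventually_compose_filterlim[OF this ln_top]
      have ev: "\<forall>\<^sub>F n in sequentially. 100 * M * (ln (real n + 1))\<^sup>2 \<le> exp (2 * (\<rho> (real n))\<^sup>2)"
        by (simp add: \<rho>_sq)
      show "\<forall>\<^sub>F n::nat in sequentially. 0 \<le> G n \<and>
        (AE x in \<mu>. 2 * real n < dist x p \<and> dist x p < 4 * real n \<longrightarrow> rad p x \<le> G n) \<and>
        G n / (real n)\<^sup>2 * measure \<mu> (ball p (4 * real n) - ball p (2 * real n)) \<le> exp (2 * (N + 1) * (\<rho> (real n))\<^sup>2)"
        using vol[OF \<beta>2] eventually_carre_bound_le[OF M \<beta>] ev eventually_ge_at_top[of "nat \<lceil>r\<rceil>"]
      proof eventually_elim
        case (elim n)
        have rn: "r \<le> real n" using elim(4) by linarith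
        have v: "measure \<mu> (ball p (4 * real n) - ball p (2 * real n)) \<le> exp (2 * N * (\<rho> (real n))\<^sup>2)"
          using measure_le_of_emeasure_le[OF elim(1)] \<beta>2 by (simp add: rpow_def \<rho>_sq)
        have "G n / (real n)\<^sup>2 \<le> exp (2 * (\<rho> (real n))\<^sup>2)" using elim(2,3) by (simp add: G_def)
        then have "G n / (real n)\<^sup>2 * measure \<mu> (ball p (4 * real n) - ball p (2 * real n)) \<le>
            exp (2 * (\<rho> (real n))\<^sup>2) * exp (2 * N * (\<rho> (real n))\<^sup>2)"
          using v by (intro mult_mono) auto
        also have "\<dots> = exp (2 * (N + 1) * (\<rho> (real n))\<^sup>2)"
          by (simp add: algebra_simps flip: exp_add)
        finally show ?case using G0 G_rad[OF rn] by blast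
      qed
    qed (use M N r in auto)
  qed
qed

end

theorem proposition11:
  fixes \<mu> :: "'a::{metric_space, second_countable_topology} measure"
    and \<E> :: "('a \<Rightarrow> real) \<Rightarrow> ('a \<Rightarrow> real) \<Rightarrow> real"
    and \<F> :: "('a \<Rightarrow> real) set"
    and \<Gamma> :: "('a \<Rightarrow> real) \<Rightarrow> ('a \<Rightarrow> real) \<Rightarrow> 'a \<Rightarrow> real"
    and T :: "real \<Rightarrow> ('a \<Rightarrow> real) \<Rightarrow> 'a \<Rightarrow> real"
    and x\<^sub>0 :: 'a
    and K\<^sub>0 :: "'a set"
  defines "d \<equiv> (\<lambda>x. dist x x\<^sub>0)"
    and "B \<equiv> (\<lambda>r::real. {x. dist x x\<^sub>0 < r})"
  assumes "locally compact (UNIV :: 'a set)"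
    and "sets \<mu> = sets borel"
    and "\<And>C. compact C \<Longrightarrow> emeasure \<mu> C < \<infinity>"
    and "\<And>U. open U \<Longrightarrow> U \<noteq> {} \<Longrightarrow> 0 < emeasure \<mu> U"
    and "regular_dirichlet_form \<mu> \<E> \<F>"
    and "strongly_local \<mu> \<E> \<F>"
    and "carre_du_champ \<mu> \<E> \<F> \<Gamma>"
    and "form_semigroup \<mu> \<E> \<F> T"
    and "d \<in> F_loc \<mu> \<F>"
    and "\<And>r. r > 0 \<Longrightarrow> relatively_compact_open (B r)"
    and "compact K\<^sub>0"
    and "carre_loc \<mu> \<F> \<Gamma> d d \<in> Linf_loc (- K\<^sub>0) \<mu>"
  shows
    "((\<exists>M>0. \<exists>N>0. \<exists>\<beta>\<ge>0. \<beta> \<le> 2 \<and>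
         (\<exists>K. compact K \<and> K\<^sub>0 \<subseteq> K \<and>
            (AE x in \<mu>. x \<notin> K \<longrightarrow>
               carre_loc \<mu> \<F> \<Gamma> d d x \<le> M * (d x + 1)\<^sup>2 * rpow (ln (d x + 1)) \<beta>)) \<and>
         (\<beta> < 2 \<longrightarrow> (\<forall>\<^sub>F n::nat in sequentially.
            emeasure \<mu> (B (4 * real n) - B (2 * real n))
              \<le> ennreal (exp (2 * N * rpow (ln (real n + 1)) (2 - \<beta>))))) \<and>
         (\<beta> = 2 \<longrightarrow> (\<forall>\<^sub>F n::nat in sequentially.
            emeasure \<mu> (B (4 * real n) - B (2 * real n))
              \<le> ennreal (rpow (ln (real n + 1)) (2 * N)))))
      \<longrightarrow> conservative \<mu> T)
   \<and> ((\<exists>M>0. \<exists>N>0.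
         (\<exists>K. compact K \<and> K\<^sub>0 \<subseteq> K \<and>
            (AE x in \<mu>. x \<notin> K \<longrightarrow> carre_loc \<mu> \<F> \<Gamma> d d x \<le> M)) \<and>
         (\<forall>\<^sub>F n::nat in sequentially.
            emeasure \<mu> (B (4 * real n) - B (2 * real n)) \<le> ennreal (exp (2 * N * (real n)\<^sup>2))))
      \<longrightarrow> conservative \<mu> T)"
proof -
  have B: "B r = ball x\<^sub>0 r" for r by (auto simp: B_def dist_commute)
  have cball: "compact (cball p r)" for p :: 'a and r
  proof -
    \<comment> \<open>The added 1 puts the closed ball inside an open ball about
      \<open>x\<^sub>0\<close>, and |r| covers negative radii.\<close>
    let ?s = "dist p x\<^sub>0 + \<bar>r\<bar> + 1"
    have "0 < ?s" by (simp add: add_nonneg_pos)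
    then have "compact (closure (B ?s))" using assms(12) by (simp add: relatively_compact_open_def)
    moreover have "cball p r \<subseteq> B ?s"
    proof
      fix x assume "x \<in> cball p r"
      then show "x \<in> B ?s" using dist_triangle[of x x\<^sub>0 p] by (simp add: B_def dist_commute)
    qed
    then have "closure (B ?s) \<inter> cball p r = cball p r" using closure_subset[of "B ?s"] by blast
    ultimately show ?thesis using compact_Int_closed[of "closure (B ?s)" "cball p r"] by simp
  qed
  have "local_dirichlet_form \<mu> \<E> \<F> \<Gamma>"
    by (rule local_dirichlet_form.intro[OF assms(7,9) local_dirichlet_form_axioms.intro[OF assms(4,8) cball]])
  then interpret local_dirichlet_semigroup \<mu> \<E> \<F> \<Gamma> T
    by (rule local_dirichlet_semigroup.intro[OF _ assms(10) local_dirichlet_semigroup_axioms.intro[OF assms(5)]])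
  have rad: "carre_loc \<mu> \<F> \<Gamma> d d = rad x\<^sub>0" by (simp add: rad_def d_def)
  have dF: "(\<lambda>x. dist x x\<^sub>0) \<in> F_loc \<mu> \<F>" using assms(11) by (simp only: d_def)
  show ?thesis
    unfolding rad B unfolding d_def
  proof (intro conjI impI; elim exE conjE)
    fix M N \<beta> :: real and K
    assume *: "0 < M" "0 < N" "0 \<le> \<beta>" "\<beta> \<le> 2" "compact K"
      "AE x in \<mu>. x \<notin> K \<longrightarrow> rad x\<^sub>0 x \<le> M * (dist x x\<^sub>0 + 1)\<^sup>2 * rpow (ln (dist x x\<^sub>0 + 1)) \<beta>"
      and vol: "\<beta> < 2 \<longrightarrow> (\<forall>\<^sub>F n::nat in sequentially.
        emeasure \<mu> (ball x\<^sub>0 (4 * real n) - ball x\<^sub>0 (2 * real n))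
          \<le> ennreal (exp (2 * N * rpow (ln (real n + 1)) (2 - \<beta>))))"
      "\<beta> = 2 \<longrightarrow> (\<forall>\<^sub>F n::nat in sequentially.
        emeasure \<mu> (ball x\<^sub>0 (4 * real n) - ball x\<^sub>0 (2 * real n))
          \<le> ennreal (rpow (ln (real n + 1)) (2 * N)))"
    show "conservative \<mu> T"
      by (rule conservative_log_growth[OF dF * vol(1)[rule_format] vol(2)[rule_format]])
  next
    fix M N :: real and K
    assume *: "0 < M" "0 < N" "compact K" "AE x in \<mu>. x \<notin> K \<longrightarrow> rad x\<^sub>0 x \<le> M"
      "\<forall>\<^sub>F n::nat in sequentially.
        emeasure \<mu> (ball x\<^sub>0 (4 * real n) - ball x\<^sub>0 (2 * real n)) \<le> ennreal (exp (2 * N * (real n)\<^sup>2))"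
    show "conservative \<mu> T"
      by (rule conservative_gaussian_growth[OF dF *])
  qed
qed

end
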